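(* For $\varepsilon>0$, let $\Omega_\varepsilon=\{x\in\mathbb{R}^2:\operatorname{dist}(x,\Gamma)<\varepsilon\}$ be the $\varepsilon$-tubular neighborhood of the curve $\Gamma$ consisting of two drops linked by a circular arc (described in the context). For $\varepsilon$ small enough, every minimal curve $\gamma$ for $\Omega_\varepsilon$ has a self-contact point, i.e. there are $t\ne s$ in $\mathbb{S}^1$ with $\gamma(t)=\gamma(s)$.
   Context: $\mathbb{S}^1$ is the circle. A regular curve is a closed curve $\gamma:\mathbb{S}^1\to\mathbb{R}^2$ with $\gamma,\gamma',\gamma''\in L^2(\mathbb{S}^1,\mathbb{R}^2)$ (so $\gamma\in C^1$) and $|\gamma'(t)|>0$ for all $t$; $(\gamma)$ denotes its image. Writing $\gamma:[0,L]\to\mathbb{R}^2$ for its arc-length parametrization, the bending energy is $\mathcal{W}(\gamma)=\int_0^L|\gamma''(s)|^2\,ds$. For an open set $\Omega$, the set $\mathcal{A}$ of admissible curves is the set of regular closed curves with $(\gamma)\subset\overline\Omega$ all of whose self-intersections (if any) are tangential: if $\gamma(t)=\gamma(s)$ with $t\ne s$, then $\gamma'(t)$ and $\gamma'(s)$ are parallel (same or opposite directions). A minimal curve for $\Omega$ is a $\gamma\in\mathcal{A}$ with $\mathcal{W}(\gamma)=\min_{\tilde\gamma\in\mathcal{A}}\mathcal{W}(\tilde\gamma)$. The curve $\Gamma$ describes two drops linked by a circular arc with angular amplitude bigger than $\pi$, as follows. Let $c=(-\tfrac32,-\tfrac{\sqrt6}{2})$. The left drop is the union of three arcs of circles of radius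 $1$: the arc of the circle centered at $c+2(-\cos75^\circ,\sin75^\circ)$ with polar angle (about its center) from $225^\circ$ to $285^\circ$; the arc of the circle centered at $c$ with polar angle from $105^\circ$ decreasing to $-195^\circ$ (amplitude $300^\circ$); the arc of the circle centered at $c+2(-\cos15^\circ,\sin15^\circ)$ with polar angle from $-15^\circ$ to $45^\circ$. These arcs join tangentially to form a closed curve with a single cusp at $P=(-\tfrac{3+\sqrt6}{2},0)$. The right drop is the mirror image of the left drop with respect to the $y$-axis, with cusp at $(\tfrac{3+\sqrt6}{2},0)$. The linking arc is the arc of the circle centered at $(0,\tfrac{3+\sqrt6}{2})$ of radius $\sqrt2\,\tfrac{3+\sqrt6}{2}$ with polar angle from $225^\circ$ decreasing to $-45^\circ$ (amplitude $270^\circ$); it joins the two cusps and is tangent to the drops there. As a set, $\Gamma$ is the union of the two drops and the linking arc (as a closed admissible curve it runs along the linking arc twice, once in each direction). *)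

theory Defs
  imports "HOL-Complex_Analysis.Complex_Analysis"
begin

text \<open>
  The plane is identified with \<^typ>\<open>complex\<close>. The circle is \<open>\<real> / 2\<pi>\<int>\<close>: functions on it are
  \<open>2\<pi>\<close>-periodic functions on the reals, and its points are represented by \<open>{0..<2\<pi>}\<close>.
\<close>

definition L2_circle :: "(real \<Rightarrow> complex) \<Rightarrow> bool" where
  "L2_circle f \<longleftrightarrow>
     (\<forall>t. f (t + 2 * pi) = f t) \<and>
     f \<in> borel_measurable lebesgue \<and>
     set_integrable lebesgue {0..2 * pi} (\<lambda>t. (norm (f t))\<^sup>2)"

definition test_function :: "real set \<Rightarrow> (real \<Rightarrow> real) \<Rightarrow> bool" where
  "test_function U \<phi> \<longleftrightarrow>
     \<phi> C1_differentiable_on UNIV \<and> (\<exists>K. compact K \<and> K \<subseteq> U \<and> (\<forall>x. x \<notin> K \<longrightarrow> \<phi> x = 0))"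

definition locally_integrable_on :: "real set \<Rightarrow> (real \<Rightarrow> complex) \<Rightarrow> bool" where
  "locally_integrable_on U f \<longleftrightarrow> (\<forall>K. compact K \<longrightarrow> K \<subseteq> U \<longrightarrow> set_integrable lebesgue K f)"

text \<open>
  Weak derivative on an open set \<open>U\<close>, tested against compactly supported \<open>C\<^sup>1\<close> functions (as in
  Brezis's treatment of Sobolev spaces in dimension one). Local integrability is required because
  the Bochner integral of a non-integrable function is \<open>0\<close>. For periodic functions, \<open>U = \<real>\<close> gives
  the weak derivative on the circle.
\<close>

definition has_weak_deriv_on :: "real set \<Rightarrow> (real \<Rightarrow> complex) \<Rightarrow> (real \<Rightarrow> complex) \<Rightarrow> bool" where
  "has_weak_deriv_on U f g \<longleftrightarrow>
     locally_integrable_on U f \<and> locally_integrable_on U g \<and>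
     (\<forall>\<phi>. test_function U \<phi> \<longrightarrow>
        (LINT x:U|lebesgue. deriv \<phi> x *\<^sub>R f x) = - (LINT x:U|lebesgue. \<phi> x *\<^sub>R g x))"

definition H2_circle :: "(real \<Rightarrow> complex) \<Rightarrow> bool" where
  "H2_circle \<gamma> \<longleftrightarrow>
     L2_circle \<gamma> \<and>
     (\<exists>v a. L2_circle v \<and> L2_circle a \<and>
            has_weak_deriv_on UNIV \<gamma> v \<and> has_weak_deriv_on UNIV v a)"

text \<open>
  The \<open>C\<^sup>1\<close> condition selects the \<open>C\<^sup>1\<close> representative of the \<open>H\<^sup>2\<close> class, for which pointwise
  statements about \<open>\<gamma>\<close> and \<open>\<gamma>'\<close> make sense.
\<close>

definition regular_curve :: "(real \<Rightarrow> complex) \<Rightarrow> bool" where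
  "regular_curve \<gamma> \<longleftrightarrow>
     H2_circle \<gamma> \<and> \<gamma> C1_differentiable_on UNIV \<and>
     (\<forall>t. norm (vector_derivative \<gamma> (at t)) > 0)"

definition arc_length :: "(real \<Rightarrow> complex) \<Rightarrow> real \<Rightarrow> real" where
  "arc_length \<gamma> t = integral {0..t} (\<lambda>u. norm (vector_derivative \<gamma> (at u)))"

definition curve_length :: "(real \<Rightarrow> complex) \<Rightarrow> real" where
  "curve_length \<gamma> = arc_length \<gamma> (2 * pi)"

text \<open>Only the values on \<open>[0, L]\<close>, with \<open>L\<close> the length of \<open>\<gamma>\<close>, are meaningful.\<close>

definition arc_length_param :: "(real \<Rightarrow> complex) \<Rightarrow> real \<Rightarrow> complex" where
  "arc_length_param \<gamma> s = \<gamma> (inv_into {0..2 * pi} (arc_length \<gamma>) s)"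

text \<open>Determined up to a null subset of \<open>U\<close> whenever a second weak derivative exists.\<close>

definition weak_second_deriv :: "real set \<Rightarrow> (real \<Rightarrow> complex) \<Rightarrow> real \<Rightarrow> complex" where
  "weak_second_deriv U f = (SOME a. \<exists>v. has_weak_deriv_on U f v \<and> has_weak_deriv_on U v a)"

text \<open>
  The integrand is integrable for every regular curve, so the convention that a divergent
  Bochner integral is \<open>0\<close> plays no role there.
\<close>

definition bending_energy :: "(real \<Rightarrow> complex) \<Rightarrow> real" where
  "bending_energy \<gamma> =
     (LINT s:{0<..<curve_length \<gamma>}|lebesgue.
        (norm (weak_second_deriv {0<..<curve_length \<gamma>} (arc_length_param \<gamma>) s))\<^sup>2)"

definition parallel :: "complex \<Rightarrow> complex \<Rightarrow> bool" where
  "parallel v w \<longleftrightarrow> (\<exists>k::real. k \<noteq> 0 \<and> v = k *\<^sub>R w)"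

definition admissible_curves :: "complex set \<Rightarrow> (real \<Rightarrow> complex) set" where
  "admissible_curves \<Omega> =
     {\<gamma>. regular_curve \<gamma> \<and> range \<gamma> \<subseteq> closure \<Omega> \<and>
         (\<forall>t\<in>{0..<2 * pi}. \<forall>s\<in>{0..<2 * pi}. t \<noteq> s \<longrightarrow> \<gamma> t = \<gamma> s \<longrightarrow>
            parallel (vector_derivative \<gamma> (at t)) (vector_derivative \<gamma> (at s)))}"

definition minimal_curve :: "complex set \<Rightarrow> (real \<Rightarrow> complex) \<Rightarrow> bool" where
  "minimal_curve \<Omega> \<gamma> \<longleftrightarrow>
     \<gamma> \<in> admissible_curves \<Omega> \<and>
     (\<forall>\<gamma>'\<in>admissible_curves \<Omega>. bending_energy \<gamma> \<le> bending_energy \<gamma>')"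

definition deg :: "real \<Rightarrow> real" where
  "deg a = a * pi / 180"

definition circle_arc :: "complex \<Rightarrow> real \<Rightarrow> real \<Rightarrow> real \<Rightarrow> complex set" where
  "circle_arc z r a b = path_image (part_circlepath z r (deg a) (deg b))"

definition drop_centre :: complex where
  "drop_centre = Complex (- 3 / 2) (- sqrt 6 / 2)"

definition left_drop :: "complex set" where
  "left_drop =
     circle_arc (drop_centre + 2 * Complex (- cos (deg 75)) (sin (deg 75))) 1 225 285 \<union>
     circle_arc drop_centre 1 105 (- 195) \<union>
     circle_arc (drop_centre + 2 * Complex (- cos (deg 15)) (sin (deg 15))) 1 (- 15) 45"

definition right_drop :: "complex set" where
  "right_drop = (\<lambda>z. Complex (- Re z) (Im z)) ` left_drop"

definition linking_arc :: "complex set" where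
  "linking_arc =
     circle_arc (Complex 0 ((3 + sqrt 6) / 2)) (sqrt 2 * ((3 + sqrt 6) / 2)) 225 (- 45)"

definition linked_drops :: "complex set" where
  "linked_drops = left_drop \<union> right_drop \<union> linking_arc"

definition tubular_nbhd :: "complex set \<Rightarrow> real \<Rightarrow> complex set" where
  "tubular_nbhd S \<epsilon> = {x. infdist x S < \<epsilon>}"

end

theory Submission
  imports Defs
begin

text \<open>
  Let \<open>\<gamma>\<close> be minimal and injective on a period. Since \<open>\<Gamma>\<close> carries an admissible curve, the energy of
  \<open>\<gamma>\<close> is bounded independently of \<open>\<epsilon>\<close>, so its unit tangent is uniformly Hoelder continuous with
  exponent \<open>1/2\<close>. It can turn around neither inside the thin neighbourhood nor, by the shape of the
  drops, without running round a drop; hence it passes the top of the linking arc in both directions.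
  There it has two disjoint nearly circular strands, and the inner one does not touch the outer
  boundary. Pushing that strand radially outwards keeps the curve admissible and lowers its
  curvature, hence its energy, contradicting minimality.
\<close>

section \<open>Absolutely continuous functions and weak derivatives\<close>

text \<open>The argument is quantitative throughout: there is no limit of minimal curves and no
  Euler-Lagrange equation. The energy bound \<open>E\<close> fixes the length scale
  \<open>1 / E\<close> on which the tangent hardly turns, and all constants, the threshold for
  \<epsilon> last, depend on \<open>E\<close> alone. The obstacle is that the acceleration
  \<open>a\<close> exists only as an L2 function, so the decrease of energy must be read off from
  integrals. With \<open>w\<close> the position relative to the centre of the linking arc and
  \<open>B\<close> a bump, the strand is moved along \<open>B * w\<close>. For constant
  \<open>B\<close> this is a dilation, which divides the energy by its factor. Derivatives of
  \<open>B\<close> end up, after integration by parts, multiplied by the radial velocity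
  \<open>w \<bullet> T\<close>, which is as small as desired in a thin annulus. What remains is the
  integral of \<open>- B * |a|^2\<close>; it stays away from \<open>0\<close>, because
  \<open>w \<bullet> T\<close> has derivative \<open>1 + w \<bullet> a\<close>, so a nearly
  vanishing radial velocity forces curvature of about \<open>1 / |w|\<close> in the mean. The
  passage over the top comes from extremal points: the highest point of the curve or, if the curve
  stays low on one side, its farthest point along the axis of the drop.\<close>

text \<open>\<open>f\<close> is absolutely continuous on \<open>{x..y}\<close> with derivative \<open>a\<close> almost everywhere.\<close>

definition has_density :: "real \<Rightarrow> real \<Rightarrow> (real \<Rightarrow> 'a::euclidean_space) \<Rightarrow> (real \<Rightarrow> 'a) \<Rightarrow> bool" where
  "has_density x y f a \<longleftrightarrow> a absolutely_integrable_on {x..y} \<and>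
     (\<forall>t\<in>{x..y}. (a has_integral (f t - f x)) {x..t})"

lemma has_density_abs_int: "has_density x y f a \<Longrightarrow> a absolutely_integrable_on {x..y}"
  by (simp add: has_density_def)

lemma has_density_has_integral:
  assumes "has_density x y f a" "x \<le> s" "s \<le> t" "t \<le> y"
  shows "(a has_integral (f t - f s)) {s..t}"
proof -
  have 1: "(a has_integral (f s - f x)) {x..s}" "(a has_integral (f t - f x)) {x..t}"
    using assms by (auto simp: has_density_def)
  have "a integrable_on {s..t}"
    by (rule integrable_on_subinterval[OF has_integral_integrable[OF 1(2)]]) (use assms in auto)
  then have 2: "(a has_integral integral {s..t} a) {s..t}"
    by (rule integrable_integral)
  have "(a has_integral ((f s - f x) + integral {s..t} a)) {x..t}"
    by (rule has_integral_combine[OF assms(2,3) 1(1) 2])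
  with 1(2) have "f t - f x = (f s - f x) + integral {s..t} a"
    by (rule has_integral_unique)
  then have "integral {s..t} a = f t - f s"
    by (simp add: algebra_simps)
  with 2 show ?thesis by simp
qed

lemma has_density_integral:
  assumes "has_density x y f a" "x \<le> s" "s \<le> t" "t \<le> y"
  shows "integral {s..t} a = f t - f s"
  using has_density_has_integral[OF assms] by (rule integral_unique)

lemma has_densityI:
  assumes "a absolutely_integrable_on {x..y}"
    and "\<And>t. x \<le> t \<Longrightarrow> t \<le> y \<Longrightarrow> f t - f x = integral {x..t} a"
  shows "has_density x y f a"
  unfolding has_density_def
proof (intro conjI ballI)
  fix t assume t: "t \<in> {x..y}"
  have "a integrable_on {x..t}"
    by (rule integrable_on_subinterval[OF set_lebesgue_integral_eq_integral(1)[OF assms(1)]])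
       (use t in auto)
  then show "(a has_integral (f t - f x)) {x..t}"
    using assms(2)[of t] t by (simp add: has_integral_integrable_integral)
qed (fact assms)

lemma has_density_subinterval:
  assumes "has_density x y f a" "x \<le> x'" "y' \<le> y"
  shows "has_density x' y' f a"
  unfolding has_density_def
proof (intro conjI ballI)
  show "a absolutely_integrable_on {x'..y'}"
    using has_density_abs_int[OF assms(1)]
    by (rule absolutely_integrable_on_subinterval) (use assms in auto)
  show "(a has_integral (f t - f x')) {x'..t}" if "t \<in> {x'..y'}" for t
    by (rule has_density_has_integral[OF assms(1)]) (use that assms in auto)
qed

lemma has_density_continuous_on:
  assumes "has_density x y f a"
  shows "continuous_on {x..y} f"
proof -
  have "a integrable_on {x..y}"
    using has_density_abs_int[OF assms] by (rule set_lebesgue_integral_eq_integral)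
  then have "continuous_on {x..y} (\<lambda>t. integral {x..t} a + f x)"
    by (intro continuous_intros indefinite_integral_continuous_1)
  then show ?thesis
    by (rule continuous_on_eq) (use has_density_integral[OF assms] in auto)
qed

lemma has_density_norm_diff:
  assumes "has_density x y f a" "x \<le> s" "s \<le> t" "t \<le> y"
  shows "norm (f t - f s) \<le> integral {s..t} (\<lambda>u. norm (a u))"
proof -
  have "a absolutely_integrable_on {s..t}"
    using has_density_subinterval[OF assms(1,2,4)] by (rule has_density_abs_int)
  then have "norm (integral {s..t} a) \<le> integral {s..t} (\<lambda>u. norm (a u))"
    by (intro integral_norm_bound_integral) (auto simp: absolutely_integrable_on_def)
  then show ?thesis
    using has_density_integral[OF assms] by simp
qed

text \<open>
  Subdividing \<open>{x..y}\<close> into \<open>n\<close> equal parts gives \<open>norm (D x y) \<le> e * m x y\<close> for every \<open>e > 0\<close>.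
\<close>

lemma additive_eq_zero:
  fixes D :: "real \<Rightarrow> real \<Rightarrow> 'a::real_normed_vector" and m :: "real \<Rightarrow> real \<Rightarrow> real"
  assumes xy: "x \<le> y"
    and D: "\<And>r s t. x \<le> r \<Longrightarrow> r \<le> s \<Longrightarrow> s \<le> t \<Longrightarrow> t \<le> y \<Longrightarrow> D r t = D r s + D s t"
    and m: "\<And>r s t. x \<le> r \<Longrightarrow> r \<le> s \<Longrightarrow> s \<le> t \<Longrightarrow> t \<le> y \<Longrightarrow> m r t = m r s + m s t"
    and small: "\<And>e. e > 0 \<Longrightarrow> \<exists>d>0. \<forall>s t. x \<le> s \<longrightarrow> s \<le> t \<longrightarrow> t \<le> y \<longrightarrow> t - s < d \<longrightarrow>
                  norm (D s t) \<le> e * m s t"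
  shows "D x y = 0"
proof -
  have "norm (D x y) \<le> e * m x y" if e: "e > 0" for e
  proof -
    obtain d where d: "d > 0"
      "\<And>s t. x \<le> s \<Longrightarrow> s \<le> t \<Longrightarrow> t \<le> y \<Longrightarrow> t - s < d \<Longrightarrow> norm (D s t) \<le> e * m s t"
      using small[OF e] by blast
    obtain n :: nat where n: "n > 0" "(y - x) / n < d"
    proof -
      obtain n :: nat where "(y - x) / d < n" using reals_Archimedean2 by blast
      then have "(y - x) / (Suc n) < d"
        using d(1) by (simp add: field_simps)
      then show ?thesis using that[of "Suc n"] by simp
    qed
    define p where "p k = x + real k * ((y - x) / n)" for k
    have step: "p (Suc k) = p k + (y - x) / n" for k
      using n by (simp add: p_def field_simps)
    have px: "x \<le> p k" for k
      using xy n by (simp add: p_def)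
    have py: "p k \<le> y" if "k \<le> n" for k
    proof -
      have "real k * ((y - x) / n) \<le> real n * ((y - x) / n)"
        by (intro mult_right_mono) (use that xy n in auto)
      then show ?thesis using n by (simp add: p_def)
    qed
    have "k \<le> n \<Longrightarrow> norm (D x (p k)) \<le> e * m x (p k)" for k
    proof (induction k)
      case 0
      show ?case using d(2)[of x x] d(1) xy by (simp add: p_def)
    next
      case (Suc k)
      have le: "x \<le> p k" "p k \<le> p (Suc k)" "p (Suc k) \<le> y"
        using px py[OF Suc.prems] step[of k] xy n by auto
      have "norm (D x (p (Suc k))) \<le> norm (D x (p k)) + norm (D (p k) (p (Suc k)))"
        using D[of x "p k" "p (Suc k)"] le norm_triangle_ineq by fastforce
      also have "\<dots> \<le> e * m x (p k) + e * m (p k) (p (Suc k))"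
        using Suc.IH Suc.prems d(2)[of "p k" "p (Suc k)"] le step[of k] n
        by (intro add_mono) auto
      also have "\<dots> = e * m x (p (Suc k))"
        using m[of x "p k" "p (Suc k)"] le by (simp add: algebra_simps)
      finally show ?case .
    qed
    from this[of n] show ?thesis using n by (simp add: p_def)
  qed
  then have bound: "\<And>e. e > 0 \<Longrightarrow> norm (D x y) \<le> e * m x y" .
  show ?thesis
  proof (rule ccontr)
    assume "D x y \<noteq> 0"
    then have pos: "norm (D x y) > 0" by simp
    have m1: "m x y > 0" using bound[of 1] pos by linarith
    have "norm (D x y) / (2 * m x y) > 0" using pos m1 by simp
    from bound[OF this] m1 pos show False by (simp add: field_simps)
  qed
qed

section \<open>Chain and product rules for absolutely continuous functions\<close>

lemma absolutely_integrable_scaleR_continuous: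
  fixes f :: "real \<Rightarrow> real" and a :: "real \<Rightarrow> 'a::euclidean_space"
  assumes "continuous_on {x..y} f" "a absolutely_integrable_on {x..y}"
  shows "(\<lambda>t. f t *\<^sub>R a t) absolutely_integrable_on {x..y}"
proof (rule absolutely_integrable_bounded_measurable_product[where h="(*\<^sub>R)"])
  show "bilinear ((*\<^sub>R) :: real \<Rightarrow> 'a \<Rightarrow> 'a)"
    by (simp add: bilinear_conv_bounded_bilinear bounded_bilinear_scaleR)
  show "f \<in> borel_measurable (lebesgue_on {x..y})"
    by (rule continuous_imp_measurable_on_sets_lebesgue) (use assms in auto)
  show "bounded (f ` {x..y})"
    using assms by (intro compact_imp_bounded compact_continuous_image) auto
qed (use assms in auto)

lemma absolutely_integrable_inner_continuous:
  fixes f a :: "real \<Rightarrow> 'a::euclidean_space"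
  assumes "continuous_on {x..y} f" "a absolutely_integrable_on {x..y}"
  shows "(\<lambda>t. f t \<bullet> a t) absolutely_integrable_on {x..y}"
proof (rule absolutely_integrable_bounded_measurable_product[where h="(\<bullet>)"])
  show "bilinear ((\<bullet>) :: 'a \<Rightarrow> 'a \<Rightarrow> real)"
    by (simp add: bilinear_conv_bounded_bilinear bounded_bilinear_inner)
  show "f \<in> borel_measurable (lebesgue_on {x..y})"
    by (rule continuous_imp_measurable_on_sets_lebesgue) (use assms in auto)
  show "bounded (f ` {x..y})"
    using assms by (intro compact_imp_bounded compact_continuous_image) auto
qed (use assms in auto)

text \<open>No pointwise derivative of \<open>f\<close> enters. The defect of the formula over a
  subinterval is additive, and freezing \<open>G'\<close> at the left end point bounds it by
  \<open>e\<close> times the integral of \<open>|a|\<close>, because \<open>G'\<close> composed with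
  \<open>f\<close> is uniformly continuous. Then \<open>additive_eq_zero\<close> makes it
  vanish.\<close>

lemma has_density_chain:
  fixes f :: "real \<Rightarrow> real" and G :: "real \<Rightarrow> real"
  assumes f: "has_density x y f a" and S: "is_interval S" and fS: "f ` {x..y} \<subseteq> S"
    and G: "\<And>z. z \<in> S \<Longrightarrow> (G has_real_derivative G' z) (at z within S)"
    and G': "continuous_on S G'"
  shows "has_density x y (\<lambda>t. G (f t)) (\<lambda>t. G' (f t) * a t)"
proof (rule has_densityI)
  have cf: "continuous_on {x..y} f" by (rule has_density_continuous_on[OF f])
  have cG: "continuous_on {x..y} (\<lambda>t. G' (f t))"
    by (rule continuous_on_compose2[OF G' cf fS])
  show int: "(\<lambda>t. G' (f t) * a t) absolutely_integrable_on {x..y}"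
    using absolutely_integrable_scaleR_continuous[OF cG has_density_abs_int[OF f]] by simp
  fix T assume T: "x \<le> T" "T \<le> y"
  have subint: "(\<lambda>t. G' (f t) * a t) integrable_on {s..t}" "a integrable_on {s..t}"
    "(\<lambda>t. \<bar>a t\<bar>) integrable_on {s..t}" if "x \<le> s" "t \<le> y" for s t
  proof -
    show "(\<lambda>t. G' (f t) * a t) integrable_on {s..t}"
      by (rule integrable_on_subinterval[OF set_lebesgue_integral_eq_integral(1)[OF int]])
         (use that in auto)
    have "a absolutely_integrable_on {s..t}"
      using has_density_abs_int[OF f]
      by (rule absolutely_integrable_on_subinterval) (use that in auto)
    then show "a integrable_on {s..t}" "(\<lambda>t. \<bar>a t\<bar>) integrable_on {s..t}"
      by (auto simp: absolutely_integrable_on_def)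
  qed
  have "G (f T) - G (f x) - integral {x..T} (\<lambda>t. G' (f t) * a t) = 0"
  proof (rule additive_eq_zero[where D="\<lambda>s t. G (f t) - G (f s) - integral {s..t} (\<lambda>t. G' (f t) * a t)"
        and m="\<lambda>s t. integral {s..t} (\<lambda>t. \<bar>a t\<bar>)", OF T(1)], goal_cases)
    case (1 r s t)
    have "integral {r..s} (\<lambda>t. G' (f t) * a t) + integral {s..t} (\<lambda>t. G' (f t) * a t) =
          integral {r..t} (\<lambda>t. G' (f t) * a t)"
      by (rule Henstock_Kurzweil_Integration.integral_combine) (use 1 T subint in auto)
    then show ?case by simp
  next
    case (2 r s t)
    have "integral {r..s} (\<lambda>t. \<bar>a t\<bar>) + integral {s..t} (\<lambda>t. \<bar>a t\<bar>) = integral {r..t} (\<lambda>t. \<bar>a t\<bar>)"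
      by (rule Henstock_Kurzweil_Integration.integral_combine) (use 2 T subint in auto)
    then show ?case by simp
  next
    case (3 e)
    have "uniformly_continuous_on {x..y} (\<lambda>t. G' (f t))"
      by (rule compact_uniformly_continuous[OF cG]) auto
    then obtain d where d: "d > 0"
      "\<And>s t. s \<in> {x..y} \<Longrightarrow> t \<in> {x..y} \<Longrightarrow> \<bar>t - s\<bar> < d \<Longrightarrow> \<bar>G' (f t) - G' (f s)\<bar> < e / 2"
      unfolding uniformly_continuous_on_def dist_real_def using 3 by (metis half_gt_zero)
    have "norm (G (f t) - G (f s) - integral {s..t} (\<lambda>t. G' (f t) * a t))
            \<le> e * integral {s..t} (\<lambda>t. \<bar>a t\<bar>)"
      if st: "x \<le> s" "s \<le> t" "t \<le> T" "t - s < d" for s t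
    proof -
      define c where "c = G' (f s)"
      have mvt: "\<bar>G (f t) - G (f s) - c * (f t - f s)\<bar> \<le> e / 2 * \<bar>f t - f s\<bar>"
      proof -
        \<comment> \<open>By the intermediate value property every point between \<open>f s\<close>
          and \<open>f t\<close> is a value \<open>f r\<close> with \<open>r\<close> in
          \<open>{s..t}\<close>, so \<open>G'\<close> differs there from \<open>c\<close> by at most
          \<open>e / 2\<close>.\<close>
        have seg: "closed_segment (f s) (f t) \<subseteq> f ` {s..t}"
        proof -
          have "connected (f ` {s..t})"
            by (intro connected_continuous_image continuous_on_subset[OF cf]) (use st T in auto)
          then have "is_interval (f ` {s..t})" by (simp add: is_interval_connected_1)
          then have "convex (f ` {s..t})" by (rule is_interval_convex)
          then show ?thesis using st by (intro closed_segment_subset) auto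
        qed
        have sub: "f ` {s..t} \<subseteq> S" using fS st T by auto
        have "norm ((\<lambda>z. G z - c * z) (f t) - (\<lambda>z. G z - c * z) (f s)) \<le> e / 2 * norm (f t - f s)"
        proof (rule differentiable_bound[where S="closed_segment (f s) (f t)"
              and f'="\<lambda>z h. (G' z - c) * h"])
          fix z assume z: "z \<in> closed_segment (f s) (f t)"
          have "(G has_real_derivative G' z) (at z within closed_segment (f s) (f t))"
            by (rule DERIV_subset[OF G]) (use z seg sub in auto)
          then have "((\<lambda>z. G z - c * z) has_real_derivative (G' z - c)) (at z within closed_segment (f s) (f t))"
            by (auto intro!: derivative_eq_intros)
          then show "((\<lambda>z. G z - c * z) has_derivative (\<lambda>h. (G' z - c) * h)) (at z within closed_segment (f s) (f t))"
            by (simp add: has_field_derivative_def)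
          obtain r where r: "r \<in> {s..t}" "z = f r" using z seg by auto
          have "\<bar>G' z - c\<bar> \<le> e / 2"
            using d(2)[of s r] r st T by (auto simp: c_def intro!: less_imp_le)
          then show "onorm (\<lambda>h. (G' z - c) * h) \<le> e / 2"
            by (intro onorm_le) (simp only: real_norm_def abs_mult mult_right_mono abs_ge_zero)
        qed auto
        then show ?thesis by (simp add: algebra_simps)
      qed
      have fd: "\<bar>f t - f s\<bar> \<le> integral {s..t} (\<lambda>t. \<bar>a t\<bar>)"
        using has_density_norm_diff[OF f, of s t] st T by simp
      have fi: "f t - f s = integral {s..t} a"
        using has_density_integral[OF f, of s t] st T by simp
      have i1: "(\<lambda>u. (G' (f u) - c) * a u) integrable_on {s..t}"
        using subint[of s t] st T by (auto simp: left_diff_distrib intro!: integrable_diff integrable_on_mult_right)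
      have eq: "integral {s..t} (\<lambda>u. G' (f u) * a u) = c * (f t - f s) + integral {s..t} (\<lambda>u. (G' (f u) - c) * a u)"
        using subint[of s t] st T
        by (simp add: left_diff_distrib fi Henstock_Kurzweil_Integration.integral_diff integrable_on_mult_right)
      have "\<bar>integral {s..t} (\<lambda>u. (G' (f u) - c) * a u)\<bar> \<le> integral {s..t} (\<lambda>u. e / 2 * \<bar>a u\<bar>)"
        unfolding real_norm_def[symmetric]
      proof (rule integral_norm_bound_integral[OF i1])
        show "(\<lambda>u. e / 2 * norm (a u)) integrable_on {s..t}"
          using subint(3)[of s t] st T by (auto intro: integrable_on_mult_right)
        show "norm ((G' (f u) - c) * a u) \<le> e / 2 * norm (a u)" if "u \<in> {s..t}" for u
        proof -
          have "\<bar>G' (f u) - c\<bar> \<le> e / 2"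
            using d(2)[of s u] that st T by (auto simp: c_def intro!: less_imp_le)
          then show ?thesis
            by (simp only: real_norm_def abs_mult mult_right_mono abs_ge_zero)
        qed
      qed
      also have "\<dots> = e / 2 * integral {s..t} (\<lambda>u. \<bar>a u\<bar>)"
        by simp
      finally have "\<bar>G (f t) - G (f s) - integral {s..t} (\<lambda>t. G' (f t) * a t)\<bar>
           \<le> e / 2 * \<bar>f t - f s\<bar> + e / 2 * integral {s..t} (\<lambda>u. \<bar>a u\<bar>)"
        using mvt eq by linarith
      also have "\<dots> \<le> e / 2 * integral {s..t} (\<lambda>u. \<bar>a u\<bar>) + e / 2 * integral {s..t} (\<lambda>u. \<bar>a u\<bar>)"
        using fd 3 by (intro add_mono mult_left_mono) auto
      finally show ?thesis by simp
    qed
    then show ?case using d(1) T by (intro exI[of _ d]) auto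
  qed
  then show "G (f T) - G (f x) = integral {x..T} (\<lambda>t. G' (f t) * a t)"
    by simp
qed

text \<open>The defect over \<open>{s..t}\<close> is the integral of \<open>a u\<close> times
  \<open>g t - g u\<close> plus \<open>f s - f u\<close> times \<open>b u\<close>. Both differences
  are uniformly small on short intervals, so the additive defect vanishes as in the chain
  rule.\<close>

lemma has_density_scaleR:
  fixes f :: "real \<Rightarrow> real" and g :: "real \<Rightarrow> 'a::euclidean_space"
  assumes f: "has_density x y f a" and g: "has_density x y g b"
  shows "has_density x y (\<lambda>t. f t *\<^sub>R g t) (\<lambda>t. a t *\<^sub>R g t + f t *\<^sub>R b t)"
proof (rule has_densityI)
  have cf: "continuous_on {x..y} f" and cg: "continuous_on {x..y} g"
    using f g by (auto intro: has_density_continuous_on)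
  let ?p = "\<lambda>t. a t *\<^sub>R g t + f t *\<^sub>R b t"
  have "(\<lambda>t. a t *\<^sub>R g t) absolutely_integrable_on {x..y}"
  proof (rule absolutely_integrable_bounded_measurable_product[where h="\<lambda>x y. y *\<^sub>R x"])
    show "bilinear (\<lambda>x y. y *\<^sub>R x :: 'a)"
      unfolding bilinear_conv_bounded_bilinear by (rule bounded_bilinear.flip[OF bounded_bilinear_scaleR])
    show "g \<in> borel_measurable (lebesgue_on {x..y})"
      by (rule continuous_imp_measurable_on_sets_lebesgue) (use cg in auto)
    show "bounded (g ` {x..y})"
      using cg by (intro compact_imp_bounded compact_continuous_image) auto
  qed (use has_density_abs_int[OF f] in auto)
  then show int: "?p absolutely_integrable_on {x..y}"
    using absolutely_integrable_scaleR_continuous[OF cf has_density_abs_int[OF g]]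
    by (rule set_integral_add(1))
  fix T assume T: "x \<le> T" "T \<le> y"
  have subint: "?p integrable_on {s..t}" "a integrable_on {s..t}" "b integrable_on {s..t}"
    "(\<lambda>t. \<bar>a t\<bar>) integrable_on {s..t}" "(\<lambda>t. norm (b t)) integrable_on {s..t}" if "x \<le> s" "t \<le> y" for s t
  proof -
    show "?p integrable_on {s..t}"
      by (rule integrable_on_subinterval[OF set_lebesgue_integral_eq_integral(1)[OF int]])
         (use that in auto)
    have "a absolutely_integrable_on {s..t}" "b absolutely_integrable_on {s..t}"
      using absolutely_integrable_on_subinterval[OF has_density_abs_int[OF f], of s t]
        absolutely_integrable_on_subinterval[OF has_density_abs_int[OF g], of s t] that by auto
    then show "a integrable_on {s..t}" "b integrable_on {s..t}"
      "(\<lambda>t. \<bar>a t\<bar>) integrable_on {s..t}" "(\<lambda>t. norm (b t)) integrable_on {s..t}"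
      by (auto simp: absolutely_integrable_on_def)
  qed
  have "f T *\<^sub>R g T - f x *\<^sub>R g x - integral {x..T} ?p = 0"
  proof (rule additive_eq_zero[where D="\<lambda>s t. f t *\<^sub>R g t - f s *\<^sub>R g s - integral {s..t} ?p"
        and m="\<lambda>s t. integral {s..t} (\<lambda>t. \<bar>a t\<bar> + norm (b t))", OF T(1)], goal_cases)
    case (1 r s t)
    have "integral {r..s} ?p + integral {s..t} ?p = integral {r..t} ?p"
      by (rule Henstock_Kurzweil_Integration.integral_combine) (use 1 T subint in auto)
    then show ?case by (simp add: algebra_simps)
  next
    case (2 r s t)
    have "integral {r..s} (\<lambda>t. \<bar>a t\<bar> + norm (b t)) + integral {s..t} (\<lambda>t. \<bar>a t\<bar> + norm (b t)) = integral {r..t} (\<lambda>t. \<bar>a t\<bar> + norm (b t))"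
      by (rule Henstock_Kurzweil_Integration.integral_combine) (use 2 T subint in \<open>auto intro!: integrable_add\<close>)
    then show ?case by simp
  next
    case (3 e)
    have "uniformly_continuous_on {x..y} f" "uniformly_continuous_on {x..y} g"
      using compact_uniformly_continuous cf cg by auto
    then obtain d1 d2 where d1: "d1 > 0"
      "\<And>s t. s \<in> {x..y} \<Longrightarrow> t \<in> {x..y} \<Longrightarrow> \<bar>t - s\<bar> < d1 \<Longrightarrow> \<bar>f t - f s\<bar> < e"
      and d2: "d2 > 0"
      "\<And>s t. s \<in> {x..y} \<Longrightarrow> t \<in> {x..y} \<Longrightarrow> \<bar>t - s\<bar> < d2 \<Longrightarrow> norm (g t - g s) < e"
      unfolding uniformly_continuous_on_def dist_real_def dist_norm using 3 by metis
    have "norm (f t *\<^sub>R g t - f s *\<^sub>R g s - integral {s..t} ?p)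
            \<le> e * integral {s..t} (\<lambda>t. \<bar>a t\<bar> + norm (b t))"
      if st: "x \<le> s" "s \<le> t" "t \<le> T" "t - s < min d1 d2" for s t
    proof -
      let ?q = "\<lambda>u. a u *\<^sub>R (g t - g u) + (f s - f u) *\<^sub>R b u"
      have hp: "(?p has_integral integral {s..t} ?p) {s..t}"
        using subint[of s t] st T by (intro integrable_integral) auto
      have ha: "((\<lambda>u. a u *\<^sub>R g t) has_integral (f t - f s) *\<^sub>R g t) {s..t}"
        by (rule has_integral_scaleR_left, rule has_density_has_integral[OF f]) (use st T in auto)
      have hb: "((\<lambda>u. f s *\<^sub>R b u) has_integral f s *\<^sub>R (g t - g s)) {s..t}"
        by (rule has_integral_cmul, rule has_density_has_integral[OF g]) (use st T in auto)
      have "((\<lambda>u. (a u *\<^sub>R g t + f s *\<^sub>R b u) - ?p u) has_integral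
              ((f t - f s) *\<^sub>R g t + f s *\<^sub>R (g t - g s)) - integral {s..t} ?p) {s..t}"
        by (intro has_integral_diff has_integral_add ha hb hp)
      moreover have "(\<lambda>u. (a u *\<^sub>R g t + f s *\<^sub>R b u) - ?p u) = ?q"
        by (auto simp: algebra_simps)
      moreover have "((f t - f s) *\<^sub>R g t + f s *\<^sub>R (g t - g s)) - integral {s..t} ?p
           = f t *\<^sub>R g t - f s *\<^sub>R g s - integral {s..t} ?p"
        by (simp add: algebra_simps)
      ultimately have q: "(?q has_integral (f t *\<^sub>R g t - f s *\<^sub>R g s - integral {s..t} ?p)) {s..t}"
        by simp
      have "norm (integral {s..t} ?q) \<le> integral {s..t} (\<lambda>u. e * (\<bar>a u\<bar> + norm (b u)))"
      proof (rule integral_norm_bound_integral)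
        show "?q integrable_on {s..t}" using q by blast
        show "(\<lambda>u. e * (\<bar>a u\<bar> + norm (b u))) integrable_on {s..t}"
          using subint[of s t] st T by (intro integrable_on_mult_right integrable_add) auto
        show "norm (?q u) \<le> e * (\<bar>a u\<bar> + norm (b u))" if "u \<in> {s..t}" for u
        proof -
          have "norm (?q u) \<le> \<bar>a u\<bar> * norm (g t - g u) + \<bar>f s - f u\<bar> * norm (b u)"
            by (rule order_trans[OF norm_triangle_ineq]) simp
          also have "\<dots> \<le> \<bar>a u\<bar> * e + e * norm (b u)"
            using d1(2)[of u s] d2(2)[of u t] that st T
            by (intro add_mono mult_left_mono mult_right_mono) (auto intro!: less_imp_le)
          finally show ?thesis by (simp add: algebra_simps)
        qed
      qed
      then show ?thesis using integral_unique[OF q] by simp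
    qed
    then show ?case using d1(1) d2(1) T by (intro exI[of _ "min d1 d2"]) auto
  qed
  then show "f T *\<^sub>R g T - f x *\<^sub>R g x = integral {x..T} ?p"
    by simp
qed

section \<open>Functions determined by their integrals over half-lines\<close>

lemma sigma_finite_lebesgue: "sigma_finite_measure (lebesgue :: real measure)"
proof
  have "(\<Union>n::nat. {- real n..real n}) = UNIV"
  proof (intro equalityI subset_UNIV subsetI)
    fix x :: real
    obtain n :: nat where "\<bar>x\<bar> \<le> n" using real_arch_simple by blast
    then show "x \<in> (\<Union>n::nat. {- real n..real n})" by (auto simp: abs_le_iff intro!: exI[of _ n])
  qed
  then show "\<exists>A. countable A \<and> A \<subseteq> sets (lebesgue :: real measure) \<and>
      \<Union>A = space (lebesgue :: real measure) \<and> (\<forall>a\<in>A. emeasure lebesgue a \<noteq> \<infinity>)"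
    by (intro exI[of _ "range (\<lambda>n::nat. {- real n..real n})"]) auto
qed

text \<open>The half-lines are an intersection-stable generator of the Borel sets, and vanishing of
  the integral passes to complements and disjoint countable unions. A Lebesgue set differs from a
  Borel set by a null set only, so the integral vanishes over every measurable set.\<close>

lemma set_integral_atMost_zero_imp_AE:
  fixes h :: "real \<Rightarrow> 'a::euclidean_space"
  assumes h: "integrable lebesgue h" and z: "\<And>t. (LINT x:{..t}|lebesgue. h x) = 0"
  shows "AE x in lebesgue. h x = 0"
proof (rule sigma_finite_measure.density_zero[OF sigma_finite_lebesgue h])
  have si: "set_integrable lebesgue A h" if "A \<in> sets lebesgue" for A
    unfolding set_integrable_def using h that by (rule integrable_mult_indicator[rotated])
  \<comment> \<open>The integral over the whole line is settled separately, since the complement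
    step below subtracts from it.\<close>
  have whole: "(LINT x|lebesgue. h x) = 0"
  proof -
    have "(\<lambda>n::nat. LINT x:{..real n}|lebesgue. h x) \<longlonglongrightarrow> (LINT x:(\<Union>n::nat. {..real n})|lebesgue. h x)"
      by (rule set_integral_cont_up) (auto simp: incseq_def intro!: si)
    moreover have "(\<Union>n::nat. {..real n}) = UNIV"
      using real_arch_simple by blast
    ultimately have "(LINT x:UNIV|lebesgue. h x) = 0" by (simp only: z LIMSEQ_const_iff)
    then show ?thesis by (simp add: set_lebesgue_integral_def)
  qed
  have meas: "A \<in> sets lebesgue" if "A \<in> sigma_sets UNIV (range (\<lambda>a::real. {..a}))" for A
  proof -
    have "A \<in> sets borel" using that by (simp add: borel_eq_atMost)
    then show ?thesis by simp
  qed
  have borel: "(LINT x:B|lebesgue. h x) = 0" if "B \<in> sets borel" for B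
  proof -
    have Int: "Int_stable (range (\<lambda>a::real. {..a}))"
      by (auto simp: Int_stable_def)
    have Pow: "range (\<lambda>a::real. {..a}) \<subseteq> Pow UNIV" by simp
    have "B \<in> sigma_sets UNIV (range (\<lambda>a::real. {..a}))"
      using that by (simp add: borel_eq_atMost)
    from Int Pow this show ?thesis
    proof (induction rule: sigma_sets_induct_disjoint)
      case (basic A)
      then show ?case using z by auto
    next
      case empty
      then show ?case by (simp add: set_lebesgue_integral_def)
    next
      case (compl A)
      have A: "A \<in> sets lebesgue" using compl(1) by (rule meas)
      have "(LINT x:A \<union> (UNIV - A)|lebesgue. h x) = (LINT x:A|lebesgue. h x) + (LINT x:UNIV - A|lebesgue. h x)"
        by (rule set_integral_Un[OF _ si[OF A] si]) (use A sets.compl_sets[OF A] in auto)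
      then show ?case using compl whole by (simp add: set_lebesgue_integral_def)
    next
      case (union A)
      have A: "A i \<in> sets lebesgue" for i using union(2) by (intro meas) auto
      have "(LINT x:(\<Union>i. A i)|lebesgue. h x) = (\<Sum>i. LINT x:A i|lebesgue. h x)"
        by (rule lebesgue_integral_countable_add) (use A union(1) si in \<open>auto simp: disjoint_family_on_def\<close>)
      then show ?case using union by simp
    qed
  qed
  fix A :: "real set" assume "A \<in> sets lebesgue"
  then obtain S N N' where A: "A = S \<union> N" "N \<subseteq> N'" "N' \<in> null_sets lborel" "S \<in> sets lborel"
    by (rule sets_completionE)
  have N: "N \<in> null_sets lebesgue"
    using A by (auto intro: null_sets_completion_subset null_sets_completionI)
  have "AE x in lebesgue. x \<in> A \<longleftrightarrow> x \<in> S"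
    using AE_not_in[OF N] A by (auto elim: eventually_mono)
  then have "(LINT x:A|lebesgue. h x) = (LINT x:S|lebesgue. h x)"
    using borel_measurable_integrable[OF si[of A, unfolded set_integrable_def]]
      borel_measurable_integrable[OF si[of S, unfolded set_integrable_def]] \<open>A \<in> sets lebesgue\<close> A
    by (intro set_integral_cong_set) (auto simp: set_borel_measurable_def)
  then show "(LINT x:A|lebesgue. h x) = 0" using borel A by simp
qed


section \<open>Test functions built from powers of the positive part\<close>

lemma has_real_derivative_pos_part_power:
  "((\<lambda>s. max 0 s ^ Suc (Suc n)) has_real_derivative real (Suc (Suc n)) * max 0 s ^ Suc n) (at (s::real))"
proof -
  consider "s < 0" | "s > 0" | "s = 0" by linarith
  then show ?thesis
  proof cases
    case 1
    have "((\<lambda>s. 0) has_real_derivative 0) (at s)" by simp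
    then have "((\<lambda>s. max 0 s ^ Suc (Suc n)) has_real_derivative 0) (at s)"
      by (rule DERIV_cong_ev[THEN iffD1, rotated -1])
         (use 1 eventually_nhds_in_open[of "{..<0}" s] in \<open>auto elim!: eventually_mono\<close>)
    then show ?thesis using 1 by simp
  next
    case 2
    have "((\<lambda>s. s ^ Suc (Suc n)) has_real_derivative real (Suc (Suc n)) * s ^ Suc n) (at s)"
      using DERIV_pow[of "Suc (Suc n)" s] by simp
    then have "((\<lambda>s. max 0 s ^ Suc (Suc n)) has_real_derivative real (Suc (Suc n)) * s ^ Suc n) (at s)"
      by (rule DERIV_cong_ev[THEN iffD1, rotated -1])
         (use 2 eventually_nhds_in_open[of "{0<..}" s] in \<open>auto elim!: eventually_mono\<close>)
    then show ?thesis using 2 by simp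
  next
    case 3
    have lim: "((\<lambda>h::real. \<bar>h\<bar> ^ Suc n) \<longlongrightarrow> 0) (at 0)"
      by (auto intro!: tendsto_eq_intros)
    have "((\<lambda>h::real. max 0 h ^ Suc (Suc n) / h) \<longlongrightarrow> 0) (at 0)"
    proof (rule Lim_null_comparison[OF _ lim], rule always_eventually, rule allI)
      fix h :: real
      show "norm (max 0 h ^ Suc (Suc n) / h) \<le> \<bar>h\<bar> ^ Suc n"
        by (cases "h > 0") (auto simp: max_def simp del: power_Suc, simp)
    qed
    then show ?thesis
      by (simp add: 3 DERIV_def)
  qed
qed

text \<open>The primitive of the tent function of height \<open>2\<close> over
  \<open>{0..1}\<close>: a continuously differentiable function rising from \<open>0\<close> to
  \<open>1\<close>.\<close>

definition smooth_step :: "real \<Rightarrow> real" where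
  "smooth_step s = 2 * max 0 s ^ 2 - 4 * max 0 (s - 1 / 2) ^ 2 + 2 * max 0 (s - 1) ^ 2"

definition smooth_step' :: "real \<Rightarrow> real" where
  "smooth_step' s = 4 * max 0 s - 8 * max 0 (s - 1 / 2) + 4 * max 0 (s - 1)"

lemma smooth_step_deriv: "(smooth_step has_real_derivative smooth_step' s) (at s)"
proof -
  have sq: "((\<lambda>s. max 0 s ^ 2) has_real_derivative 2 * max 0 s) (at s)" for s :: real
    using has_real_derivative_pos_part_power[of 0 s] by (simp add: numeral_2_eq_2)
  have shift: "((\<lambda>s. max 0 (s - c) ^ 2) has_real_derivative 2 * max 0 (s - c)) (at s)" for c :: real
  proof -
    have "((\<lambda>s. s - c) has_real_derivative 1) (at s)"
      by (auto intro!: derivative_eq_intros)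
    from DERIV_chain2[where g="\<lambda>s. s - c" and f="\<lambda>s. max 0 s ^ 2", OF sq this] show ?thesis by simp
  qed
  show ?thesis
    unfolding smooth_step_def[abs_def]
    by (rule derivative_eq_intros sq shift refl | simp add: smooth_step'_def)+
qed

lemma smooth_step_affine_deriv [derivative_intros]:
  "((\<lambda>t. smooth_step (k * (t - c))) has_real_derivative k * smooth_step' (k * (t - c))) (at t within S)"
proof -
  have "((\<lambda>t. k * (t - c)) has_real_derivative k) (at t within S)"
    by (auto intro!: derivative_eq_intros)
  from DERIV_chain2[where f=smooth_step and g="\<lambda>t. k * (t - c)", OF smooth_step_deriv this] show ?thesis
    by (simp add: mult.commute)
qed

lemma smooth_step_0: "s \<le> 0 \<Longrightarrow> smooth_step s = 0"
  and smooth_step_1: "s \<ge> 1 \<Longrightarrow> smooth_step s = 1"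
  and smooth_step'_0: "s \<le> 0 \<or> s \<ge> 1 \<Longrightarrow> smooth_step' s = 0"
  by (auto simp: smooth_step_def smooth_step'_def max_def power2_eq_square algebra_simps)

lemma smooth_step'_nonneg: "smooth_step' s \<ge> 0"
  by (auto simp: smooth_step'_def max_def)

lemma smooth_step_mono: "s \<le> t \<Longrightarrow> smooth_step s \<le> smooth_step t"
  by (rule DERIV_nonneg_imp_nondecreasing) (use smooth_step_deriv smooth_step'_nonneg in blast)+

lemma smooth_step_bounds: "0 \<le> smooth_step s" "smooth_step s \<le> 1"
  using smooth_step_mono[of "min s 0" s] smooth_step_mono[of s "max s 1"]
  by (auto simp: smooth_step_0 smooth_step_1)

lemma continuous_smooth_step': "continuous_on A smooth_step'"
  unfolding smooth_step'_def[abs_def] by (intro continuous_intros)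

lemma set_lebesgue_integral_eq_integral_support:
  fixes F :: "real \<Rightarrow> 'a::euclidean_space"
  assumes F: "F absolutely_integrable_on {x..y}" and sub: "{x..y} \<subseteq> U"
    and zero: "\<And>t. t \<in> U \<Longrightarrow> t \<notin> {x..y} \<Longrightarrow> F t = 0"
  shows "set_integrable lebesgue U F" "(LINT t:U|lebesgue. F t) = integral {x..y} F"
proof -
  have eq: "(\<lambda>t. indicator U t *\<^sub>R F t) = (\<lambda>t. indicator {x..y} t *\<^sub>R F t)"
    using sub zero by (auto simp: indicator_def fun_eq_iff)
  show "set_integrable lebesgue U F"
    using F by (simp add: set_integrable_def eq)
  show "(LINT t:U|lebesgue. F t) = integral {x..y} F"
    unfolding set_lebesgue_integral_eq_integral(2)[OF F, symmetric] by (simp add: set_lebesgue_integral_def eq)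
qed

text \<open>The kernel is a nonnegative tent of mass \<open>1\<close> supported in
  \<open>{x..x + 1 / (n + N)}\<close>. It lies entirely to the right of \<open>x\<close>, and
  \<open>N\<close> keeps its support inside \<open>{x..x + d}\<close> for every \<open>n\<close>,
  also for \<open>n = 0\<close>.\<close>

lemma mollifier_tendsto:
  fixes f :: "real \<Rightarrow> 'a::euclidean_space"
  assumes f: "continuous_on {x..x + d} f" and d: "d > 0" "{x..x + d} \<subseteq> U" and N: "N > 0" "1 / N \<le> d"
  shows "set_integrable lebesgue U (\<lambda>t. ((real n + N) * smooth_step' ((real n + N) * (t - x))) *\<^sub>R f t)"
    and "(\<lambda>n. LINT t:U|lebesgue. ((real n + N) * smooth_step' ((real n + N) * (t - x))) *\<^sub>R f t)
           \<longlonglongrightarrow> f x"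
proof -
  let ?k = "\<lambda>n t. (real n + N) * smooth_step' ((real n + N) * (t - x))"
  let ?y = "\<lambda>n. x + 1 / (real n + N)"
  have yd: "1 / (real n + N) \<le> d" for n
    by (rule order_trans[OF _ N(2)]) (use N in \<open>simp add: frac_le\<close>)
  have ck: "continuous_on A (?k n)" for A n
    by (intro continuous_intros continuous_on_compose2[OF continuous_smooth_step'[of UNIV]]) auto
  have cf: "continuous_on {x..?y n} f" for n
    by (rule continuous_on_subset[OF f]) (use yd[of n] in auto)
  have abs: "(\<lambda>t. ?k n t *\<^sub>R f t) absolutely_integrable_on {x..?y n}" for n
    by (intro absolutely_integrable_continuous_real continuous_intros ck cf)
  have sub: "{x..?y n} \<subseteq> U" for n
    using yd[of n] d by auto
  have zero: "?k n t *\<^sub>R f t = 0" if "t \<notin> {x..?y n}" for n t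
  proof -
    have "(real n + N) * (t - x) \<le> 0 \<or> (real n + N) * (t - x) \<ge> 1"
    proof (cases "t < x")
      case True
      then show ?thesis using N by (simp add: mult_le_0_iff)
    next
      case False
      then have "t - x \<ge> 1 / (real n + N)" using that N by auto
      then show ?thesis using N by (simp add: field_simps)
    qed
    then show ?thesis by (simp add: smooth_step'_0)
  qed
  show "set_integrable lebesgue U (\<lambda>t. ?k n t *\<^sub>R f t)"
    using set_lebesgue_integral_eq_integral_support(1)[OF abs sub zero] by simp
  have eq: "(LINT t:U|lebesgue. ?k n t *\<^sub>R f t) = integral {x..?y n} (\<lambda>t. ?k n t *\<^sub>R f t)" for n
    using set_lebesgue_integral_eq_integral_support(2)[OF abs sub zero] by simp
  have one: "(?k n has_integral 1) {x..?y n}" for n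
  proof -
    have "(?k n has_integral (smooth_step ((real n + N) * (?y n - x)) - smooth_step ((real n + N) * (x - x)))) {x..?y n}"
      using N by (intro fundamental_theorem_of_calculus)
       (auto simp: has_real_derivative_iff_has_vector_derivative[symmetric]
          intro!: derivative_eq_intros smooth_step_affine_deriv)
    then show ?thesis using N by (simp add: smooth_step_0 smooth_step_1)
  qed
  show "(\<lambda>n. LINT t:U|lebesgue. ?k n t *\<^sub>R f t) \<longlonglongrightarrow> f x"
    unfolding eq
  proof (rule LIMSEQ_I)
    fix e :: real assume e: "e > 0"
    obtain r where r: "r > 0" "\<And>t. t \<in> {x..x + d} \<Longrightarrow> \<bar>t - x\<bar> < r \<Longrightarrow> norm (f t - f x) < e / 2"
      using f e d unfolding continuous_on_iff dist_norm real_norm_def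
      by (metis atLeastAtMost_iff half_gt_zero less_add_same_cancel1 order_less_le order_refl)
    obtain M :: nat where M: "1 / r < M" using reals_Archimedean2 by blast
    have "norm (integral {x..?y n} (\<lambda>t. ?k n t *\<^sub>R f t) - f x) < e" if n: "n \<ge> M" for n
    proof -
      have "1 / r < real n + N" using M n N by linarith
      then have small: "1 / (real n + N) < r" using r N by (simp add: field_simps)
      have h1: "((\<lambda>t. ?k n t *\<^sub>R f x) has_integral 1 *\<^sub>R f x) {x..?y n}"
        by (rule has_integral_scaleR_left[OF one])
      have h2: "((\<lambda>t. ?k n t *\<^sub>R f t) has_integral integral {x..?y n} (\<lambda>t. ?k n t *\<^sub>R f t)) {x..?y n}"
        using set_lebesgue_integral_eq_integral(1)[OF abs] by (rule integrable_integral)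
      have h3: "((\<lambda>t. ?k n t *\<^sub>R (f t - f x)) has_integral integral {x..?y n} (\<lambda>t. ?k n t *\<^sub>R f t) - f x) {x..?y n}"
        using has_integral_diff[OF h2 h1] by (simp add: scaleR_diff_right)
      have h4: "((\<lambda>t. ?k n t * (e / 2)) has_integral 1 * (e / 2)) {x..?y n}"
        by (rule has_integral_mult_left[OF one])
      have "norm (integral {x..?y n} (\<lambda>t. ?k n t *\<^sub>R (f t - f x))) \<le> integral {x..?y n} (\<lambda>t. ?k n t * (e / 2))"
      proof (rule integral_norm_bound_integral)
        fix t assume t: "t \<in> {x..?y n}"
        have "norm (f t - f x) \<le> e / 2"
          using r(2)[of t] t yd[of n] small by (auto intro!: less_imp_le)
        then show "norm (?k n t *\<^sub>R (f t - f x)) \<le> ?k n t * (e / 2)"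
          using N smooth_step'_nonneg by (simp add: abs_mult mult_left_mono)
      qed (use h3 h4 in auto)
      then show ?thesis using e unfolding integral_unique[OF h3] integral_unique[OF h4] by simp
    qed
    then show "\<exists>M. \<forall>n\<ge>M. norm (integral {x..?y n} (\<lambda>t. ?k n t *\<^sub>R f t) - f x) < e" by blast
  qed
qed

text \<open>\<open>\<phi> n\<close> is the difference of two steps of width
  \<open>1 / (n + N)\<close> that start at \<open>x\<close> and at \<open>y\<close>. A step vanishes
  at its starting point, whence the limit is the indicator of the half-open interval
  \<open>{x<..y}\<close>; the derivative is the difference of two mollifiers, whence the limit
  \<open>f x - f y\<close>.\<close>

lemma test_functions_approximating_interval:
  assumes U: "open U" and xy: "x \<le> y" "{x..y} \<subseteq> U"
  obtains \<phi> :: "nat \<Rightarrow> real \<Rightarrow> real" and z where "{x..z} \<subseteq> U" "y \<le> z"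
    "\<And>n. test_function U (\<phi> n)" "\<And>n t. 0 \<le> \<phi> n t" "\<And>n t. \<phi> n t \<le> 1"
    "\<And>n t. t \<notin> {x..z} \<Longrightarrow> \<phi> n t = 0"
    "\<And>t. (\<lambda>n. \<phi> n t) \<longlonglongrightarrow> indicator {x<..y} t"
    "\<And>f :: real \<Rightarrow> complex. continuous_on U f \<Longrightarrow>
       (\<lambda>n. LINT t:U|lebesgue. deriv (\<phi> n) t *\<^sub>R f t) \<longlonglongrightarrow> f x - f y"
proof -
  have "y \<in> U" using xy by auto
  then obtain d where d: "d > 0" "cball y d \<subseteq> U" using U open_contains_cball by blast
  obtain N0 :: nat where N0: "1 / d < N0" using reals_Archimedean2 by blast
  define N where "N = real N0"
  have N: "N > 0" "1 / N \<le> d"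
  proof -
    show "N > 0" using N0 d unfolding N_def by (smt (verit) divide_pos_pos)
    then show "1 / N \<le> d" using N0 d by (simp add: N_def field_simps)
  qed
  have yz: "{y..y + d} \<subseteq> U" using d by (auto simp: subset_eq dist_real_def)
  then have xz: "{x..y + d} \<subseteq> U" using xy by force
  define \<phi> where "\<phi> n t = smooth_step ((real n + N) * (t - x)) - smooth_step ((real n + N) * (t - y))" for n t
  define \<phi>' where "\<phi>' n t = (real n + N) * smooth_step' ((real n + N) * (t - x)) - (real n + N) * smooth_step' ((real n + N) * (t - y))" for n t
  have le: "(real n + N) * (t - y) \<le> (real n + N) * (t - x)" for n t
    using N xy by (intro mult_left_mono) auto
  have der: "(\<phi> n has_real_derivative \<phi>' n t) (at t)" for n t
    unfolding \<phi>_def[abs_def] \<phi>'_def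
    by (auto intro!: derivative_eq_intros smooth_step_affine_deriv)
  have zero: "\<phi> n t = 0" if t: "t \<notin> {x..y + d}" for n t
  proof (cases "t < x")
    case True
    then have "(real n + N) * (t - x) \<le> 0" "(real n + N) * (t - y) \<le> 0"
      using N xy by (auto simp: mult_le_0_iff)
    then show ?thesis by (simp add: \<phi>_def smooth_step_0)
  next
    case False
    then have "t - y \<ge> 1 / N" using t N by auto
    then have "1 \<le> N * (t - y)" using N by (simp add: field_simps)
    moreover have "0 \<le> real n * (t - y)" using False t d by auto
    ultimately have "1 \<le> (real n + N) * (t - y)" by (simp add: algebra_simps)
    with le[of n t] show ?thesis by (simp add: \<phi>_def smooth_step_1)
  qed
  show ?thesis
  proof (rule that[of "y + d" \<phi>])
    show "{x..y + d} \<subseteq> U" "y \<le> y + d" using xz d by auto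
    show "\<phi> n t = 0" if "t \<notin> {x..y + d}" for n t using zero that by auto
    show "0 \<le> \<phi> n t" for n t
      using smooth_step_mono[OF le[of n t]] by (simp add: \<phi>_def)
    show "\<phi> n t \<le> 1" for n t
      using smooth_step_bounds(2)[of "(real n + N) * (t - x)"] smooth_step_bounds(1)[of "(real n + N) * (t - y)"]
      unfolding \<phi>_def by linarith
    have "\<phi> n C1_differentiable_on UNIV" for n
      unfolding C1_differentiable_on_def
    proof (intro exI conjI ballI)
      show "(\<phi> n has_vector_derivative \<phi>' n t) (at t)" for t
        using der by (simp add: has_real_derivative_iff_has_vector_derivative)
      show "continuous_on UNIV (\<phi>' n)"
        unfolding \<phi>'_def
        by (intro continuous_intros continuous_on_compose2[OF continuous_smooth_step'[of UNIV]]) auto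
    qed
    then show "test_function U (\<phi> n)" for n
      unfolding test_function_def using zero xz by (intro conjI exI[of _ "{x..y + d}"]) auto
    have up: "(\<lambda>n. smooth_step ((real n + N) * c)) \<longlonglongrightarrow> (if c > 0 then 1 else 0)" for c
    proof (cases "c > 0")
      case True
      obtain M :: nat where M: "1 / c < M" using reals_Archimedean2 by blast
      have "smooth_step ((real n + N) * c) = 1" if "n \<ge> M" for n
      proof -
        have "1 / c \<le> real n + N" using M that N by linarith
        then have "1 \<le> (real n + N) * c" using True by (simp add: field_simps)
        then show ?thesis by (rule smooth_step_1)
      qed
      then have "eventually (\<lambda>n. smooth_step ((real n + N) * c) = 1) sequentially"
        by (auto simp: eventually_sequentially)
      then show ?thesis using True by (simp add: tendsto_eventually)
    next
      case False
      then have "(real n + N) * c \<le> 0" for n using N by (auto simp: mult_le_0_iff)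
      then show ?thesis using False by (simp add: smooth_step_0)
    qed
    show "(\<lambda>n. \<phi> n t) \<longlonglongrightarrow> indicator {x<..y} t" for t
    proof -
      have "(\<lambda>n. \<phi> n t) \<longlonglongrightarrow> (if t - x > 0 then 1 else 0) - (if t - y > 0 then 1 else 0)"
        unfolding \<phi>_def by (intro tendsto_diff up)
      also have "(if t - x > 0 then 1 else 0) - (if t - y > 0 then 1 else 0) = (indicator {x<..y} t :: real)"
        using xy by (auto simp: indicator_def)
      finally show ?thesis .
    qed
    show "(\<lambda>n. LINT t:U|lebesgue. deriv (\<phi> n) t *\<^sub>R f t) \<longlonglongrightarrow> f x - f y"
      if f: "continuous_on U f" for f :: "real \<Rightarrow> complex"
    proof -
      have fx: "continuous_on {x..x + d} f" and fy: "continuous_on {y..y + d} f"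
        using xz xy d by (auto intro!: continuous_on_subset[OF f])
      have xd: "{x..x + d} \<subseteq> U" using xz xy by auto
      have dphi: "deriv (\<phi> n) t = \<phi>' n t" for n t using der by (rule DERIV_imp_deriv)
      have "(LINT t:U|lebesgue. deriv (\<phi> n) t *\<^sub>R f t) =
        (LINT t:U|lebesgue. ((real n + N) * smooth_step' ((real n + N) * (t - x))) *\<^sub>R f t) -
        (LINT t:U|lebesgue. ((real n + N) * smooth_step' ((real n + N) * (t - y))) *\<^sub>R f t)" for n
        unfolding dphi \<phi>'_def scaleR_left_diff_distrib
        by (rule set_integral_diff(2)) (rule mollifier_tendsto(1)[OF fx d(1) xd N] mollifier_tendsto(1)[OF fy d(1) yz N])+
      then show ?thesis
        using tendsto_diff[OF mollifier_tendsto(2)[OF fx d(1) xd N] mollifier_tendsto(2)[OF fy d(1) yz N]]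
        by simp
    qed
  qed
qed

section \<open>Weak derivatives and absolutely continuous representatives\<close>

lemma test_function_deriv:
  assumes "test_function U \<phi>"
  obtains K where "compact K" "K \<subseteq> U" "\<And>x. x \<notin> K \<Longrightarrow> \<phi> x = 0" "\<And>x. x \<notin> K \<Longrightarrow> deriv \<phi> x = 0"
    "\<And>x. (\<phi> has_real_derivative deriv \<phi> x) (at x)" "continuous_on UNIV (deriv \<phi>)" "continuous_on UNIV \<phi>"
proof -
  obtain K \<phi>' where K: "compact K" "K \<subseteq> U" "\<And>x. x \<notin> K \<Longrightarrow> \<phi> x = 0"
    and \<phi>': "\<And>x. (\<phi> has_vector_derivative \<phi>' x) (at x)" "continuous_on UNIV \<phi>'"
    using assms unfolding test_function_def C1_differentiable_on_def by auto
  have der: "(\<phi> has_real_derivative \<phi>' x) (at x)" for x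
    using \<phi>'(1) by (simp add: has_real_derivative_iff_has_vector_derivative)
  have eq: "deriv \<phi> = \<phi>'" using DERIV_imp_deriv[OF der] by auto
  have "deriv \<phi> x = 0" if "x \<notin> K" for x
  proof -
    have "open (- K)" using K compact_imp_closed by blast
    then have "eventually (\<lambda>y. y \<in> - K) (nhds x)" using that by (intro eventually_nhds_in_open) auto
    then have "eventually (\<lambda>y. \<phi> y = (\<lambda>y. 0) y) (nhds x)" by (rule eventually_mono) (use K in auto)
    then have "deriv \<phi> x = deriv (\<lambda>y. 0) x" by (intro deriv_cong_ev) auto
    then show ?thesis by simp
  qed
  moreover have "continuous_on UNIV \<phi>"
    using der by (intro DERIV_continuous_on[of UNIV]) auto
  ultimately show ?thesis using that[of K] K der \<phi>'(2) eq by simp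
qed

lemma set_integrable_compactly_supported_mult:
  fixes h :: "real \<Rightarrow> complex" and f :: "real \<Rightarrow> real"
  assumes h: "locally_integrable_on U h" and K: "compact K" "K \<subseteq> U" "\<And>x. x \<notin> K \<Longrightarrow> f x = 0"
    and f: "continuous_on UNIV f" and U: "open U"
  shows "set_integrable lebesgue U (\<lambda>x. f x *\<^sub>R h x)"
proof -
  have hK: "set_integrable lebesgue K h" using h K by (auto simp: locally_integrable_on_def)
  have "(\<lambda>x. f x *\<^sub>R h x) absolutely_integrable_on K"
  proof (rule absolutely_integrable_bounded_measurable_product[where h="(*\<^sub>R)"])
    show "bilinear ((*\<^sub>R) :: real \<Rightarrow> complex \<Rightarrow> complex)"
      by (simp add: bilinear_conv_bounded_bilinear bounded_bilinear_scaleR)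
    show "f \<in> borel_measurable (lebesgue_on K)"
      by (rule continuous_imp_measurable_on_sets_lebesgue)
         (use K in \<open>auto intro: continuous_on_subset[OF f] lmeasurable_compact fmeasurableD\<close>)
    show "bounded (f ` K)"
      using K by (intro compact_imp_bounded compact_continuous_image continuous_on_subset[OF f]) auto
  qed (use hK K in \<open>auto intro: lmeasurable_compact fmeasurableD\<close>)
  moreover have "(\<lambda>x. indicat_real U x *\<^sub>R f x *\<^sub>R h x) = (\<lambda>x. indicat_real K x *\<^sub>R f x *\<^sub>R h x)"
    using K by (auto simp: indicator_def fun_eq_iff)
  ultimately show ?thesis by (simp add: set_integrable_def)
qed

text \<open>Integration by parts: the product rule is applied on a compact interval that encloses
  the support of the test function and lies in \<open>U\<close>, which exists because
  \<open>U\<close> is an open interval. The boundary terms vanish.\<close>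

lemma density_imp_weak_deriv:
  fixes f :: "real \<Rightarrow> complex"
  assumes U: "open U" "is_interval U"
    and f: "\<And>x y. x \<le> y \<Longrightarrow> {x..y} \<subseteq> U \<Longrightarrow> has_density x y f a"
  shows "has_weak_deriv_on U f a"
proof -
  have enclose: "\<exists>x y. x \<le> y \<and> {x..y} \<subseteq> U \<and> K \<subseteq> {x<..<y}" if K: "compact K" "K \<subseteq> U" "U \<noteq> {}" for K
  proof -
    obtain u where u: "u \<in> U" using K by auto
    let ?K = "insert u K"
    have c: "compact ?K" "?K \<noteq> {}" using K by auto
    obtain p where p: "p \<in> ?K" "\<And>t. t \<in> ?K \<Longrightarrow> p \<le> t" using compact_attains_inf[OF c] by auto
    obtain q where q: "q \<in> ?K" "\<And>t. t \<in> ?K \<Longrightarrow> t \<le> q" using compact_attains_sup[OF c] by auto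
    have pq: "p \<in> U" "q \<in> U" using p q u K by auto
    obtain d e where d: "d > 0" "cball p d \<subseteq> U" and e: "e > 0" "cball q e \<subseteq> U"
      using U pq open_contains_cball by metis
    have mem: "p - d \<in> U" "q + e \<in> U" using d e by (auto simp: subset_eq dist_real_def)
    have "{p - d..q + e} \<subseteq> U"
      using U(2) mem unfolding is_interval_1 by (metis atLeastAtMost_iff subsetI)
    moreover have "?K \<subseteq> {p - d<..<q + e}" using p q d e by (auto simp: less_le_not_le) (smt (verit))+
    moreover have "p - d \<le> q + e" using p(2)[OF q(1)] d e by linarith
    ultimately show ?thesis by blast
  qed
  have loc: "locally_integrable_on U f" "locally_integrable_on U a"
  proof -
    have "set_integrable lebesgue K f \<and> set_integrable lebesgue K a" if K: "compact K" "K \<subseteq> U" for K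
    proof (cases "U = {}")
      case True
      then show ?thesis using K by (simp add: set_integrable_def)
    next
      case False
      then obtain x y where xy: "x \<le> y" "{x..y} \<subseteq> U" "K \<subseteq> {x<..<y}" using enclose K by metis
      have sub: "K \<subseteq> {x..y}" using xy by force
      have "K \<in> sets lebesgue" using K by (simp add: lmeasurable_compact fmeasurableD)
      moreover have "f absolutely_integrable_on {x..y}" "a absolutely_integrable_on {x..y}"
        using f[OF xy(1,2)] by (auto intro: absolutely_integrable_continuous_real has_density_continuous_on has_density_abs_int)
      ultimately show ?thesis using sub by (auto intro: set_integrable_subset)
    qed
    then show "locally_integrable_on U f" "locally_integrable_on U a"
      by (auto simp: locally_integrable_on_def)
  qed
  have "(LINT x:U|lebesgue. deriv \<phi> x *\<^sub>R f x) = - (LINT x:U|lebesgue. \<phi> x *\<^sub>R a x)"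
    if \<phi>: "test_function U \<phi>" for \<phi>
  proof (cases "U = {}")
    case True
    then show ?thesis by (simp add: set_lebesgue_integral_def)
  next
    case False
    obtain K where K: "compact K" "K \<subseteq> U" "\<And>x. x \<notin> K \<Longrightarrow> \<phi> x = 0" "\<And>x. x \<notin> K \<Longrightarrow> deriv \<phi> x = 0"
      "\<And>x. (\<phi> has_real_derivative deriv \<phi> x) (at x)" "continuous_on UNIV (deriv \<phi>)" "continuous_on UNIV \<phi>"
      by (rule test_function_deriv[OF \<phi>]) (rule that; assumption)
    obtain x y where xy: "x \<le> y" "{x..y} \<subseteq> U" "K \<subseteq> {x<..<y}" using enclose K(1,2) False by metis
    have "has_density x y \<phi> (deriv \<phi>)"
    proof (rule has_densityI)
      show "deriv \<phi> absolutely_integrable_on {x..y}"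
        by (rule absolutely_integrable_continuous_real) (rule continuous_on_subset[OF K(6)], simp)
      show "\<phi> t - \<phi> x = integral {x..t} (deriv \<phi>)" if "x \<le> t" for t
        by (rule integral_unique[symmetric], rule fundamental_theorem_of_calculus[OF that])
           (use K(5) in \<open>auto simp: has_real_derivative_iff_has_vector_derivative intro: has_vector_derivative_at_within\<close>)
    qed
    from has_density_scaleR[OF this f[OF xy(1,2)]]
    have "integral {x..y} (\<lambda>t. deriv \<phi> t *\<^sub>R f t + \<phi> t *\<^sub>R a t) = \<phi> y *\<^sub>R f y - \<phi> x *\<^sub>R f x"
      by (rule has_density_integral) (use xy in auto)
    moreover have "x \<notin> K" "y \<notin> K" using xy(3) by auto
    then have "\<phi> x = 0" "\<phi> y = 0" by (auto intro: K(3))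
    moreover have int: "(\<lambda>t. deriv \<phi> t *\<^sub>R f t) absolutely_integrable_on {x..y}"
      "(\<lambda>t. \<phi> t *\<^sub>R a t) absolutely_integrable_on {x..y}"
    proof -
      show "(\<lambda>t. deriv \<phi> t *\<^sub>R f t) absolutely_integrable_on {x..y}"
        by (intro absolutely_integrable_continuous_real continuous_on_scaleR
            has_density_continuous_on[OF f[OF xy(1,2)]] continuous_on_subset[OF K(6)]) auto
      show "(\<lambda>t. \<phi> t *\<^sub>R a t) absolutely_integrable_on {x..y}"
        by (intro absolutely_integrable_scaleR_continuous
            has_density_abs_int[OF f[OF xy(1,2)]] continuous_on_subset[OF K(7)]) auto
    qed
    ultimately have "integral {x..y} (\<lambda>t. deriv \<phi> t *\<^sub>R f t) + integral {x..y} (\<lambda>t. \<phi> t *\<^sub>R a t) = 0"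
      by (simp add: Henstock_Kurzweil_Integration.integral_add set_lebesgue_integral_eq_integral(1))
    moreover have "(LINT x:U|lebesgue. deriv \<phi> x *\<^sub>R f x) = integral {x..y} (\<lambda>t. deriv \<phi> t *\<^sub>R f t)"
      by (rule set_lebesgue_integral_eq_integral_support(2)[OF int(1) xy(2)])
         (use xy(3) in \<open>auto intro!: K(4)\<close>)
    moreover have "(LINT x:U|lebesgue. \<phi> x *\<^sub>R a x) = integral {x..y} (\<lambda>t. \<phi> t *\<^sub>R a t)"
      by (rule set_lebesgue_integral_eq_integral_support(2)[OF int(2) xy(2)])
         (use xy(3) in \<open>auto intro!: K(3)\<close>)
    ultimately show ?thesis by (simp add: add_eq_0_iff2)
  qed
  then show ?thesis using loc by (auto simp: has_weak_deriv_on_def)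
qed

lemma test_functions_integral_tendsto:
  fixes h :: "real \<Rightarrow> complex"
  assumes h: "locally_integrable_on U h" and U: "open U" and xz: "{x..z} \<subseteq> U" "y \<le> z"
    and \<phi>: "\<And>n. test_function U (\<phi> n)" "\<And>n t. 0 \<le> \<phi> n t" "\<And>n t. \<phi> n t \<le> 1"
    "\<And>n t. t \<notin> {x..z} \<Longrightarrow> \<phi> n t = 0" "\<And>t. (\<lambda>n. \<phi> n t) \<longlonglongrightarrow> indicator {x<..y} t"
  shows "(\<lambda>n. LINT t:U|lebesgue. \<phi> n t *\<^sub>R h t) \<longlonglongrightarrow> (LINT t:{x<..y}|lebesgue. h t)"
  unfolding set_lebesgue_integral_def
proof (rule integral_dominated_convergence[where w="\<lambda>t. norm (indicat_real {x..z} t *\<^sub>R h t)"])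
  have hK: "set_integrable lebesgue {x..z} h"
    using h xz by (auto simp: locally_integrable_on_def)
  then show "integrable lebesgue (\<lambda>t. norm (indicat_real {x..z} t *\<^sub>R h t))"
    unfolding set_integrable_def by (rule integrable_norm)
  have "set_integrable lebesgue {x<..y} h"
    using hK by (rule set_integrable_subset) (use xz in auto)
  then show "(\<lambda>t. indicat_real {x<..y} t *\<^sub>R h t) \<in> borel_measurable lebesgue"
    by (auto simp: set_integrable_def)
  show "(\<lambda>t. indicat_real U t *\<^sub>R \<phi> n t *\<^sub>R h t) \<in> borel_measurable lebesgue" for n
  proof -
    obtain K where K: "compact K" "K \<subseteq> U" "\<And>x. x \<notin> K \<Longrightarrow> (\<phi> n) x = 0" "\<And>x. x \<notin> K \<Longrightarrow> deriv (\<phi> n) x = 0"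
      "\<And>x. ((\<phi> n) has_real_derivative deriv (\<phi> n) x) (at x)" "continuous_on UNIV (deriv (\<phi> n))" "continuous_on UNIV (\<phi> n)"
      by (rule test_function_deriv[OF \<phi>(1)[of n]]) (rule that; assumption)
    show ?thesis
      using set_integrable_compactly_supported_mult[OF h K(1-3,7) U] by (auto simp: set_integrable_def)
  qed
  show "AE t in lebesgue. (\<lambda>n. indicat_real U t *\<^sub>R \<phi> n t *\<^sub>R h t) \<longlonglongrightarrow> indicat_real {x<..y} t *\<^sub>R h t"
  proof (rule AE_I2)
    fix t
    have "(\<lambda>n. indicat_real U t *\<^sub>R \<phi> n t *\<^sub>R h t) \<longlonglongrightarrow> indicat_real U t *\<^sub>R indicat_real {x<..y} t *\<^sub>R h t"
      by (intro tendsto_intros \<phi>(5))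
    moreover have "indicat_real U t *\<^sub>R indicat_real {x<..y} t *\<^sub>R h t = indicat_real {x<..y} t *\<^sub>R h t"
      using xz by (auto simp: indicator_def)
    ultimately show "(\<lambda>n. indicat_real U t *\<^sub>R \<phi> n t *\<^sub>R h t) \<longlonglongrightarrow> indicat_real {x<..y} t *\<^sub>R h t"
      by (simp only:)
  qed
  show "AE t in lebesgue. norm (indicat_real U t *\<^sub>R \<phi> n t *\<^sub>R h t) \<le> norm (indicat_real {x..z} t *\<^sub>R h t)" for n
  proof (rule AE_I2)
    fix t
    show "norm (indicat_real U t *\<^sub>R \<phi> n t *\<^sub>R h t) \<le> norm (indicat_real {x..z} t *\<^sub>R h t)"
      using \<phi>(2)[of n t] \<phi>(3)[of n t] \<phi>(4)[of t n] by (auto simp: indicator_def mult_left_le_one_le)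
  qed
qed

text \<open>Testing with functions that tend to the indicator of \<open>{x<..t}\<close> turns the
  weak equation into the fundamental theorem of calculus. Continuity of \<open>f\<close> gives the
  point values a meaning.\<close>

lemma weak_deriv_continuous_imp_density:
  fixes f :: "real \<Rightarrow> complex"
  assumes f: "continuous_on U f" and fa: "has_weak_deriv_on U f a" and U: "open U" "{x..y} \<subseteq> U"
  shows "has_density x y f a"
proof (rule has_densityI)
  have loc: "locally_integrable_on U a" using fa by (simp add: has_weak_deriv_on_def)
  then show "a absolutely_integrable_on {x..y}"
    using U by (auto simp: locally_integrable_on_def)
  fix t assume t: "x \<le> t" "t \<le> y"
  then have sub: "{x..t} \<subseteq> U" using U by auto
  obtain \<phi> :: "nat \<Rightarrow> real \<Rightarrow> real" and z where \<phi>: "{x..z} \<subseteq> U" "t \<le> z"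
    "\<And>n. test_function U (\<phi> n)" "\<And>n t. 0 \<le> \<phi> n t" "\<And>n t. \<phi> n t \<le> 1"
    "\<And>n t. t \<notin> {x..z} \<Longrightarrow> \<phi> n t = 0"
    "\<And>s. (\<lambda>n. \<phi> n s) \<longlonglongrightarrow> indicator {x<..t} s"
    "\<And>f :: real \<Rightarrow> complex. continuous_on U f \<Longrightarrow>
       (\<lambda>n. LINT t:U|lebesgue. deriv (\<phi> n) t *\<^sub>R f t) \<longlonglongrightarrow> f x - f t"
    by (rule test_functions_approximating_interval[OF U(1) t(1) sub]) (rule that; assumption)
  have "(\<lambda>n. LINT t:U|lebesgue. deriv (\<phi> n) t *\<^sub>R f t) \<longlonglongrightarrow> - (LINT s:{x<..t}|lebesgue. a s)"
    using tendsto_minus[OF test_functions_integral_tendsto[OF loc U(1) \<phi>(1-7)]] fa \<phi>(3)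
    by (simp add: has_weak_deriv_on_def)
  with \<phi>(8)[OF f] have "f x - f t = - (LINT s:{x<..t}|lebesgue. a s)"
    by (rule LIMSEQ_unique)
  moreover have "a absolutely_integrable_on {x<..t}"
    using loc sub by (auto simp: locally_integrable_on_def intro: set_integrable_subset[of lebesgue "{x..t}"])
  then have "(LINT s:{x<..t}|lebesgue. a s) = integral {x<..t} a"
    by (rule set_lebesgue_integral_eq_integral(2))
  moreover have "integral {x<..t} a = integral {x..t} a"
    by (rule integral_spike_set) (auto intro: negligible_subset[of "{x}"])
  ultimately show "f t - f x = integral {x..t} a" by (simp add: algebra_simps)
qed

lemma test_function_integral_cong:
  fixes f1 f2 :: "real \<Rightarrow> complex"
  assumes U: "open U" and \<phi>: "test_function U \<phi>"
    and loc: "locally_integrable_on U f1" "locally_integrable_on U f2"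
    and f: "AE x in lebesgue. x \<in> U \<longrightarrow> f1 x = f2 x"
  shows "(LINT t:U|lebesgue. deriv \<phi> t *\<^sub>R f1 t) = (LINT t:U|lebesgue. deriv \<phi> t *\<^sub>R f2 t)"
proof -
  obtain K where K: "compact K" "K \<subseteq> U" "\<And>x. x \<notin> K \<Longrightarrow> \<phi> x = 0" "\<And>x. x \<notin> K \<Longrightarrow> deriv \<phi> x = 0"
    "\<And>x. (\<phi> has_real_derivative deriv \<phi> x) (at x)" "continuous_on UNIV (deriv \<phi>)" "continuous_on UNIV \<phi>"
    by (rule test_function_deriv[OF \<phi>]) (rule that; assumption)
  show ?thesis
    unfolding set_lebesgue_integral_def
  proof (rule integral_cong_AE)
    show "(\<lambda>t. indicat_real U t *\<^sub>R deriv \<phi> t *\<^sub>R f1 t) \<in> borel_measurable lebesgue"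
      using set_integrable_compactly_supported_mult[OF loc(1) K(1,2,4,6) U] by (auto simp: set_integrable_def)
    show "(\<lambda>t. indicat_real U t *\<^sub>R deriv \<phi> t *\<^sub>R f2 t) \<in> borel_measurable lebesgue"
      using set_integrable_compactly_supported_mult[OF loc(2) K(1,2,4,6) U] by (auto simp: set_integrable_def)
  qed (use f in \<open>auto simp: indicator_def elim!: eventually_mono\<close>)
qed

lemma weak_deriv_cong:
  fixes f1 f2 :: "real \<Rightarrow> complex"
  assumes "open U" "has_weak_deriv_on U f1 g" "locally_integrable_on U f2"
    and "AE x in lebesgue. x \<in> U \<longrightarrow> f1 x = f2 x"
  shows "has_weak_deriv_on U f2 g"
  using assms test_function_integral_cong[OF assms(1) _ _ assms(3,4)]
  by (simp add: has_weak_deriv_on_def)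

text \<open>The difference of the two derivatives has integral zero over every half-open interval
  with closure in \<open>U\<close>, hence vanishes almost everywhere on each of them. Countably many
  intervals with rational end points cover \<open>U\<close>.\<close>

lemma weak_deriv_unique:
  fixes f :: "real \<Rightarrow> complex"
  assumes U: "open U" and 1: "has_weak_deriv_on U f1 g1" and 2: "has_weak_deriv_on U f2 g2"
    and f: "AE x in lebesgue. x \<in> U \<longrightarrow> f1 x = f2 x"
  shows "AE x in lebesgue. x \<in> U \<longrightarrow> g1 x = g2 x"
proof -
  let ?h = "\<lambda>x. g1 x - g2 x"
  have loc: "locally_integrable_on U f1" "locally_integrable_on U f2" "locally_integrable_on U g1" "locally_integrable_on U g2"
    using 1 2 by (auto simp: has_weak_deriv_on_def)
  have loch: "locally_integrable_on U ?h"
    using loc(3,4) by (auto simp: locally_integrable_on_def intro: set_integral_diff(1))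
  have test: "(LINT t:U|lebesgue. \<phi> t *\<^sub>R ?h t) = 0" if \<phi>: "test_function U \<phi>" for \<phi>
  proof -
    obtain K where K: "compact K" "K \<subseteq> U" "\<And>x. x \<notin> K \<Longrightarrow> \<phi> x = 0" "continuous_on UNIV \<phi>"
      by (rule test_function_deriv[OF \<phi>]) (rule that; assumption)
    have "(LINT t:U|lebesgue. deriv \<phi> t *\<^sub>R f1 t) = (LINT t:U|lebesgue. deriv \<phi> t *\<^sub>R f2 t)"
      by (rule test_function_integral_cong[OF U \<phi> loc(1,2) f])
    then have "(LINT t:U|lebesgue. \<phi> t *\<^sub>R g1 t) = (LINT t:U|lebesgue. \<phi> t *\<^sub>R g2 t)"
      using 1 2 \<phi> by (simp add: has_weak_deriv_on_def)
    moreover have "(LINT t:U|lebesgue. \<phi> t *\<^sub>R g1 t - \<phi> t *\<^sub>R g2 t) = (LINT t:U|lebesgue. \<phi> t *\<^sub>R g1 t) - (LINT t:U|lebesgue. \<phi> t *\<^sub>R g2 t)"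
      by (rule set_integral_diff(2); rule set_integrable_compactly_supported_mult[OF _ K U]) (use loc in auto)
    ultimately show ?thesis by (simp add: scaleR_diff_right)
  qed
  have zero: "(LINT t:{x<..y}|lebesgue. ?h t) = 0" if xy: "x \<le> y" "{x..y} \<subseteq> U" for x y
  proof -
    obtain \<phi> :: "nat \<Rightarrow> real \<Rightarrow> real" and z where \<phi>: "{x..z} \<subseteq> U" "y \<le> z"
      "\<And>n. test_function U (\<phi> n)" "\<And>n t. 0 \<le> \<phi> n t" "\<And>n t. \<phi> n t \<le> 1"
      "\<And>n t. t \<notin> {x..z} \<Longrightarrow> \<phi> n t = 0"
      "\<And>s. (\<lambda>n. \<phi> n s) \<longlonglongrightarrow> indicator {x<..y} s"
      by (rule test_functions_approximating_interval[OF U xy]) (rule that; assumption)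
    have "(\<lambda>n. LINT t:U|lebesgue. \<phi> n t *\<^sub>R ?h t) \<longlonglongrightarrow> (LINT t:{x<..y}|lebesgue. ?h t)"
      by (rule test_functions_integral_tendsto[OF loch U \<phi>])
    then show ?thesis using test[OF \<phi>(3)] by (simp add: LIMSEQ_const_iff)
  qed
  have ae: "AE t in lebesgue. t \<in> {x<..y} \<longrightarrow> ?h t = 0" if xy: "x \<le> y" "{x..y} \<subseteq> U" for x y
  proof -
    have int: "set_integrable lebesgue {x..y} ?h" using loch xy by (auto simp: locally_integrable_on_def)
    have "AE t in lebesgue. indicat_real {x<..y} t *\<^sub>R ?h t = 0"
    proof (rule set_integral_atMost_zero_imp_AE)
      show "integrable lebesgue (\<lambda>t. indicat_real {x<..y} t *\<^sub>R ?h t)"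
        using set_integrable_subset[OF int, of "{x<..y}"] unfolding set_integrable_def by force
      fix t
      have "(LINT s:{..t}|lebesgue. indicat_real {x<..y} s *\<^sub>R ?h s) = (LINT s:{x<..min y t}|lebesgue. ?h s)"
        unfolding set_lebesgue_integral_def by (intro Bochner_Integration.integral_cong) (auto simp: indicator_def)
      also have "\<dots> = 0"
      proof (cases "x \<le> t")
        case True
        have "{x..min y t} \<subseteq> U" by (rule subset_trans[OF _ xy(2)]) auto
        then show ?thesis using zero[of x "min y t"] xy(1) True by simp
      next
        case False
        then have "{x<..min y t} = {}" by simp
        show ?thesis unfolding \<open>{x<..min y t} = {}\<close> by (simp add: set_lebesgue_integral_def)
      qed
      finally show "(LINT s:{..t}|lebesgue. indicat_real {x<..y} s *\<^sub>R ?h s) = 0" .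
    qed
    then show ?thesis by (rule eventually_mono) (auto simp: indicator_def)
  qed
  let ?C = "{(q, r). q \<in> \<rat> \<and> r \<in> \<rat> \<and> q \<le> r \<and> {q..r} \<subseteq> U}"
  have "countable ?C"
    by (rule countable_subset[of _ "\<rat> \<times> \<rat>"]) (auto intro: countable_rat)
  then have "AE t in lebesgue. \<forall>p\<in>?C. t \<in> {fst p<..snd p} \<longrightarrow> ?h t = 0"
    using ae by (subst AE_ball_countable) auto
  then show ?thesis
  proof (rule eventually_mono, intro impI)
    fix t assume h: "\<forall>p\<in>?C. t \<in> {fst p<..snd p} \<longrightarrow> ?h t = 0" and t: "t \<in> U"
    obtain d where d: "d > 0" "cball t d \<subseteq> U" using U t open_contains_cball by blast
    obtain q where q: "q \<in> \<rat>" "t - d < q" "q < t" using Rats_dense_in_real[of "t - d" t] d by auto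
    obtain r where r: "r \<in> \<rat>" "t < r" "r < t + d" using Rats_dense_in_real[of t "t + d"] d by auto
    have "{q..r} \<subseteq> U" using d q r by (auto simp: subset_eq dist_real_def)
    then have "(q, r) \<in> ?C" using q r by auto
    from h[rule_format, OF this] have "?h t = 0" using q r by simp
    then show "g1 t = g2 t" by simp
  qed
qed

section \<open>Regular curves and their arc-length parametrization\<close>

text \<open>\<open>u\<close> is the velocity and \<open>a\<close> the acceleration of
  \<open>g\<close>, the latter in the sense of \<open>has_density\<close>. The period
  \<open>L\<close> is arbitrary so that circle parametrizations and arc-length parametrizations are
  treated alike, and \<open>a\<close> is periodic at every point, so that shifts and rescalings
  produce no exceptional sets.\<close>

definition h2_data :: "real \<Rightarrow> (real \<Rightarrow> complex) \<Rightarrow> (real \<Rightarrow> complex) \<Rightarrow> (real \<Rightarrow> complex) \<Rightarrow> bool" where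
  "h2_data L g u a \<longleftrightarrow> L > 0 \<and> (\<forall>s. (g has_vector_derivative u s) (at s)) \<and> (\<forall>s. g (s + L) = g s) \<and>
     (\<forall>s. a (s + L) = a s) \<and> (\<forall>s. u s \<noteq> 0) \<and> (\<forall>x y. has_density x y u a) \<and>
     (\<lambda>s. (norm (a s))\<^sup>2) integrable_on {0..L}"

lemma has_density_of_derivative:
  fixes f :: "real \<Rightarrow> 'a::euclidean_space"
  assumes "\<And>t. t \<in> {x..y} \<Longrightarrow> (f has_vector_derivative f' t) (at t within {x..y})" "continuous_on {x..y} f'"
  shows "has_density x y f f'"
proof (rule has_densityI)
  show "f' absolutely_integrable_on {x..y}"
    by (rule absolutely_integrable_continuous_real[OF assms(2)])
  show "f t - f x = integral {x..t} f'" if "x \<le> t" "t \<le> y" for t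
    by (rule integral_unique[symmetric], rule fundamental_theorem_of_calculus[OF that(1)])
       (use that in \<open>auto intro: has_vector_derivative_within_subset[OF assms(1)]\<close>)
qed

lemma borel_measurable_locally_integrable:
  fixes f :: "real \<Rightarrow> complex"
  assumes "\<And>x y. p < x \<Longrightarrow> y < q \<Longrightarrow> set_integrable lebesgue {x..y} f"
  shows "(\<lambda>x. indicat_real {p<..<q} x *\<^sub>R f x) \<in> borel_measurable lebesgue"
proof (rule borel_measurable_LIMSEQ_metric)
  let ?I = "\<lambda>n. {p + 1 / real (Suc n)..q - 1 / real (Suc n)}"
  show "(\<lambda>x. indicat_real (?I n) x *\<^sub>R f x) \<in> borel_measurable lebesgue" for n
    using assms[of "p + 1 / real (Suc n)" "q - 1 / real (Suc n)"] by (auto simp: set_integrable_def)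
  show "(\<lambda>n. indicat_real (?I n) x *\<^sub>R f x) \<longlonglongrightarrow> indicat_real {p<..<q} x *\<^sub>R f x" for x
  proof (cases "x \<in> {p<..<q}")
    case True
    obtain N :: nat where N: "1 / real (Suc N) < min (x - p) (q - x)"
      using nat_approx_posE[of "min (x - p) (q - x)"] True by auto
    have "x \<in> ?I n" if "n \<ge> N" for n
    proof -
      have "1 / real (Suc n) \<le> 1 / real (Suc N)" using that by (intro divide_left_mono) auto
      then show ?thesis using N by auto
    qed
    then have "eventually (\<lambda>n. indicat_real (?I n) x *\<^sub>R f x = f x) sequentially"
      unfolding eventually_sequentially by (intro exI[of _ N]) auto
    then show ?thesis using True by (simp add: tendsto_eventually)
  next
    case False
    have "x \<notin> ?I n" for n
    proof -
      have "1 / real (Suc n) > 0" by simp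
      with False show ?thesis unfolding atLeastAtMost_iff greaterThanLessThan_iff by linarith
    qed
    then show ?thesis using False by simp
  qed
qed

lemma borel_measurable_abs_int:
  fixes f :: "real \<Rightarrow> complex"
  assumes "\<And>x y. f absolutely_integrable_on {x..y}"
  shows "f \<in> borel_measurable lebesgue"
proof (rule borel_measurable_LIMSEQ_metric)
  show "(\<lambda>x. indicat_real {- real n<..<real n} x *\<^sub>R f x) \<in> borel_measurable lebesgue" for n
    by (rule borel_measurable_locally_integrable[OF assms])
  fix x :: real
  obtain N :: nat where N: "\<bar>x\<bar> < real N" by (meson reals_Archimedean2)
  have "x \<in> {- real n<..<real n}" if "n \<ge> N" for n
  proof -
    have "real N \<le> real n" using that by simp
    then show ?thesis using N unfolding greaterThanLessThan_iff by linarith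
  qed
  then have "eventually (\<lambda>n. indicat_real {- real n<..<real n} x *\<^sub>R f x = f x) sequentially"
    unfolding eventually_sequentially by (metis indicator_simps(1) scaleR_one)
  then show "(\<lambda>n. indicat_real {- real n<..<real n} x *\<^sub>R f x) \<longlonglongrightarrow> f x"
    by (rule tendsto_eventually)
qed

lemma h2_data_pos: "h2_data L g u a \<Longrightarrow> L > 0"
  and h2_data_deriv: "h2_data L g u a \<Longrightarrow> (g has_vector_derivative u s) (at s)"
  and h2_data_periodic: "h2_data L g u a \<Longrightarrow> g (s + L) = g s"
  and h2_data_periodic'': "h2_data L g u a \<Longrightarrow> a (s + L) = a s"
  and h2_data_nz: "h2_data L g u a \<Longrightarrow> u s \<noteq> 0"
  and h2_data_density: "h2_data L g u a \<Longrightarrow> has_density x y u a"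
  and h2_data_integrable: "h2_data L g u a \<Longrightarrow> (\<lambda>s. (norm (a s))\<^sup>2) integrable_on {0..L}"
  by (simp_all add: h2_data_def)

lemma h2_data_periodic':
  assumes "h2_data L g u a"
  shows "u (s + L) = u s"
proof -
  have "((\<lambda>s. g (s + L)) has_vector_derivative 1 *\<^sub>R u (s + L)) (at s)"
    unfolding o_def[of g "\<lambda>s. s + L", symmetric]
    by (rule vector_diff_chain_at[OF _ h2_data_deriv[OF assms]]) (auto intro!: derivative_eq_intros)
  then have "(g has_vector_derivative u (s + L)) (at s)"
    by (simp add: h2_data_periodic[OF assms])
  then show ?thesis using h2_data_deriv[OF assms] vector_derivative_unique_at by blast
qed

lemma continuous_on_all_intervals:
  fixes f :: "real \<Rightarrow> 'a::topological_space"
  assumes "\<And>x y. continuous_on {x..y} f"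
  shows "continuous_on A f"
proof -
  have "isCont f t" for t
    by (rule continuous_on_interior[OF assms[of "t - 1" "t + 1"]]) simp
  then show ?thesis by (simp add: continuous_at_imp_continuous_on)
qed

lemma h2_data_continuous:
  assumes "h2_data L g u a"
  shows "continuous_on A u" "continuous_on A g"
proof -
  show "continuous_on A u"
    using has_density_continuous_on[OF h2_data_density[OF assms]] by (rule continuous_on_all_intervals)
  show "continuous_on A g"
    by (intro continuous_at_imp_continuous_on ballI has_vector_derivative_continuous[OF h2_data_deriv[OF assms]])
qed

lemma h2_data_g_density:
  assumes "h2_data L g u a"
  shows "has_density x y g u"
  by (rule has_density_of_derivative)
     (use h2_data_deriv[OF assms] h2_data_continuous[OF assms] in \<open>auto intro: has_vector_derivative_at_within\<close>)

lemma h2_data_measurable: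
  assumes "h2_data L g u a"
  shows "a \<in> borel_measurable lebesgue"
  by (rule borel_measurable_abs_int) (rule has_density_abs_int[OF h2_data_density[OF assms]])

lemma L2_circle_continuous:
  assumes "continuous_on UNIV f" "\<And>t. f (t + 2 * pi) = f t"
  shows "L2_circle f"
proof -
  have "f \<in> borel_measurable borel" using assms(1) by (rule borel_measurable_continuous_onI)
  then have "f \<in> borel_measurable lebesgue" by (simp add: measurable_completion)
  moreover have "(\<lambda>t. (norm (f t))\<^sup>2) absolutely_integrable_on {0..2 * pi}"
    by (intro absolutely_integrable_continuous_real continuous_intros continuous_on_subset[OF assms(1)]) auto
  ultimately show ?thesis using assms(2) by (simp add: L2_circle_def)
qed

lemma h2_data_imp_regular_curve:
  assumes h: "h2_data (2 * pi) g u a"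
  shows "regular_curve g"
proof -
  have "L2_circle g" "L2_circle u"
    using h2_data_continuous[OF h] h2_data_periodic[OF h] h2_data_periodic'[OF h]
    by (auto intro!: L2_circle_continuous)
  moreover have "L2_circle a"
    unfolding L2_circle_def using h2_data_periodic''[OF h] h2_data_measurable[OF h] h2_data_integrable[OF h]
    by (auto intro!: nonnegative_absolutely_integrable_1)
  moreover have "has_weak_deriv_on UNIV g u"
    by (rule density_imp_weak_deriv) (use h2_data_g_density[OF h] in auto)
  moreover have "has_weak_deriv_on UNIV u a"
    by (rule density_imp_weak_deriv) (use h2_data_density[OF h] in auto)
  moreover have "g C1_differentiable_on UNIV"
    unfolding C1_differentiable_on_def using h2_data_deriv[OF h] h2_data_continuous[OF h] by blast
  moreover have "vector_derivative g (at t) = u t" for t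
    using h2_data_deriv[OF h] by (rule vector_derivative_at)
  ultimately show ?thesis
    using h2_data_nz[OF h] by (auto simp: regular_curve_def H2_circle_def)
qed

text \<open>The weak derivative supplied by \<open>H2_circle\<close> agrees almost everywhere with
  the classical velocity. Hence \<open>a\<close> is a weak derivative of the classical velocity too,
  and continuity of the latter upgrades this to a density.\<close>

lemma regular_curve_imp_h2_data:
  assumes "regular_curve g"
  obtains a where "h2_data (2 * pi) g (\<lambda>t. vector_derivative g (at t)) a"
proof -
  obtain v a where g: "L2_circle g" and a: "L2_circle a" and gv: "has_weak_deriv_on UNIV g v"
    and va: "has_weak_deriv_on UNIV v a"
    using assms unfolding regular_curve_def H2_circle_def by blast
  define u where "u t = vector_derivative g (at t)" for t
  obtain u' where u': "\<And>t. (g has_vector_derivative u' t) (at t)" "continuous_on UNIV u'"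
    using assms unfolding regular_curve_def C1_differentiable_on_def by auto
  have uu': "u = u'" using u'(1) vector_derivative_at by (fastforce simp: u_def)
  have der: "(g has_vector_derivative u t) (at t)" for t using u' uu' by simp
  have cu: "continuous_on A u" for A using u'(2) uu' continuous_on_subset by blast
  have "has_density x y g u" for x y
    by (rule has_density_of_derivative) (use der cu in \<open>auto intro: has_vector_derivative_at_within\<close>)
  then have gu: "has_weak_deriv_on UNIV g u"
    by (intro density_imp_weak_deriv) auto
  have "AE x in lebesgue. x \<in> UNIV \<longrightarrow> v x = u x"
    by (rule weak_deriv_unique[OF _ gv gu]) auto
  then have ua: "has_weak_deriv_on UNIV u a"
    using gu by (intro weak_deriv_cong[OF open_UNIV va]) (auto simp: has_weak_deriv_on_def)
  have ud: "has_density x y u a" for x y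
    by (rule weak_deriv_continuous_imp_density[OF cu ua]) auto
  have "h2_data (2 * pi) g u a"
    unfolding h2_data_def
  proof (intro conjI allI)
    show "u s \<noteq> 0" for s using assms by (simp add: regular_curve_def u_def)
    show "(\<lambda>s. (norm (a s))\<^sup>2) integrable_on {0..2 * pi}"
      using a set_lebesgue_integral_eq_integral(1) unfolding L2_circle_def by blast
  qed (use g a der ud in \<open>simp_all add: L2_circle_def\<close>)
  then show thesis using that by (simp add: u_def[abs_def])
qed

text \<open>Since \<open>\<phi>' \<ge> 0\<close>, the map \<open>\<phi>\<close> is monotone and
  carries \<open>{x..t}\<close> onto \<open>{\<phi> x..\<phi> t}\<close>; on each of these intervals
  the claim is the change of variables formula.\<close>

lemma has_density_compose:
  fixes f :: "real \<Rightarrow> 'a::euclidean_space"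
  assumes f: "has_density (\<phi> x) (\<phi> y) f a"
    and \<phi>: "\<And>t. t \<in> {x..y} \<Longrightarrow> (\<phi> has_real_derivative \<phi>' t) (at t within {x..y})"
    and pos: "\<And>t. t \<in> {x..y} \<Longrightarrow> \<phi>' t \<ge> 0" and inj: "inj_on \<phi> {x..y}"
  shows "has_density x y (\<lambda>t. f (\<phi> t)) (\<lambda>t. \<phi>' t *\<^sub>R a (\<phi> t))"
proof -
  have cont: "continuous_on {x..y} \<phi>"
    using \<phi> by (rule DERIV_continuous_on)
  have mono: "\<phi> s \<le> \<phi> t" if "x \<le> s" "s \<le> t" "t \<le> y" for s t
  proof (rule DERIV_nonneg_imp_increasing_open[OF that(2)])
    show "\<exists>z. (\<phi> has_real_derivative z) (at r) \<and> 0 \<le> z" if r: "s < r" "r < t" for r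
    proof -
      have "r \<in> {x..y}" "r \<in> interior {x..y}" using r \<open>x \<le> s\<close> \<open>t \<le> y\<close> by auto
      then have "(\<phi> has_real_derivative \<phi>' r) (at r)"
        using \<phi>[of r] at_within_interior[of r "{x..y}"] by simp
      then show ?thesis using pos[of r] \<open>r \<in> {x..y}\<close> by blast
    qed
    show "continuous_on {s..t} \<phi>" by (rule continuous_on_subset[OF cont]) (use that in auto)
  qed
  have img: "\<phi> ` {x..t} = {\<phi> x..\<phi> t}" if t: "x \<le> t" "t \<le> y" for t
  proof
    show "\<phi> ` {x..t} \<subseteq> {\<phi> x..\<phi> t}" using mono t by auto
    show "{\<phi> x..\<phi> t} \<subseteq> \<phi> ` {x..t}"
    proof
      fix z assume "z \<in> {\<phi> x..\<phi> t}"
      then obtain r where "x \<le> r" "r \<le> t" "\<phi> r = z"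
        using IVT'[of \<phi> x z t] continuous_on_subset[OF cont, of "{x..t}"] t by auto
      then show "z \<in> \<phi> ` {x..t}" by auto
    qed
  qed
  have cov: "(\<lambda>s. \<phi>' s *\<^sub>R a (\<phi> s)) absolutely_integrable_on {x..t} \<and>
      integral {x..t} (\<lambda>s. \<phi>' s *\<^sub>R a (\<phi> s)) = f (\<phi> t) - f (\<phi> x)" if t: "x \<le> t" "t \<le> y" for t
  proof -
    have "has_density (\<phi> x) (\<phi> t) f a"
      by (rule has_density_subinterval[OF f]) (use mono t in auto)
    then have "a absolutely_integrable_on \<phi> ` {x..t} \<and> integral (\<phi> ` {x..t}) a = f (\<phi> t) - f (\<phi> x)"
      using has_density_integral[of "\<phi> x" "\<phi> t" f a "\<phi> x" "\<phi> t"] mono t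
      by (simp add: img has_density_abs_int)
    moreover have "(\<lambda>s. \<bar>\<phi>' s\<bar> *\<^sub>R a (\<phi> s)) absolutely_integrable_on {x..t} \<and>
          integral {x..t} (\<lambda>s. \<bar>\<phi>' s\<bar> *\<^sub>R a (\<phi> s)) = f (\<phi> t) - f (\<phi> x)
        \<longleftrightarrow> a absolutely_integrable_on \<phi> ` {x..t} \<and> integral (\<phi> ` {x..t}) a = f (\<phi> t) - f (\<phi> x)"
      by (rule has_absolute_integral_change_of_variables_real)
         (use t in \<open>auto intro: DERIV_subset[OF \<phi>] inj_on_subset[OF inj]\<close>)
    moreover have "(\<lambda>s. \<bar>\<phi>' s\<bar> *\<^sub>R a (\<phi> s)) absolutely_integrable_on {x..t} \<longleftrightarrow> (\<lambda>s. \<phi>' s *\<^sub>R a (\<phi> s)) absolutely_integrable_on {x..t}"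
      by (rule set_integrable_cong) (use pos t in auto)
    moreover have "integral {x..t} (\<lambda>s. \<bar>\<phi>' s\<bar> *\<^sub>R a (\<phi> s)) = integral {x..t} (\<lambda>s. \<phi>' s *\<^sub>R a (\<phi> s))"
      by (rule integral_cong) (use pos t in auto)
    ultimately show ?thesis by simp
  qed
  show ?thesis
  proof (cases "x \<le> y")
    case True
    then show ?thesis using cov by (intro has_densityI) auto
  next
    case False
    then show ?thesis by (simp add: has_density_def)
  qed
qed

lemma has_density_linear:
  fixes f :: "real \<Rightarrow> 'a::euclidean_space" and h :: "'a \<Rightarrow> 'b::euclidean_space"
  assumes f: "has_density x y f a" and h: "bounded_linear h"
  shows "has_density x y (\<lambda>t. h (f t)) (\<lambda>t. h (a t))"
proof -
  have "(\<lambda>t. h (a t)) absolutely_integrable_on {x..y}"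
    using absolutely_integrable_linear[OF has_density_abs_int[OF f] h] by (simp add: o_def)
  moreover have "((\<lambda>t. h (a t)) has_integral h (f t) - h (f x)) {x..t}" if "t \<in> {x..y}" for t
    using has_integral_linear[OF has_density_has_integral[OF f, of x t] h] that
    by (simp add: o_def linear_diff bounded_linear.linear[OF h])
  ultimately show ?thesis by (simp add: has_density_def)
qed

lemma has_density_add:
  assumes f: "has_density x y f a" and g: "has_density x y g b"
  shows "has_density x y (\<lambda>t. f t + g t) (\<lambda>t. a t + b t)"
proof -
  have "(\<lambda>t. a t + b t) absolutely_integrable_on {x..y}"
    using has_density_abs_int[OF f] has_density_abs_int[OF g] by (rule set_integral_add(1))
  moreover have "((\<lambda>t. a t + b t) has_integral (f t + g t) - (f x + g x)) {x..t}" if "t \<in> {x..y}" for t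
    using has_integral_add[OF has_density_has_integral[OF f, of x t] has_density_has_integral[OF g, of x t]] that
    by (simp add: algebra_simps)
  ultimately show ?thesis by (simp add: has_density_def)
qed

lemma has_density_inner:
  fixes f g :: "real \<Rightarrow> complex"
  assumes f: "has_density x y f a" and g: "has_density x y g b"
  shows "has_density x y (\<lambda>t. f t \<bullet> g t) (\<lambda>t. a t \<bullet> g t + f t \<bullet> b t)"
proof -
  note lin = has_density_linear[OF _ bounded_linear_Re] has_density_linear[OF _ bounded_linear_Im]
  from has_density_add[OF has_density_scaleR[OF lin(1)[OF f] lin(1)[OF g]] has_density_scaleR[OF lin(2)[OF f] lin(2)[OF g]]]
  show ?thesis by (simp add: inner_complex_def algebra_simps)
qed

lemma integral_substitution_increasing:
  fixes F :: "real \<Rightarrow> 'a::euclidean_space"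
  assumes F: "F absolutely_integrable_on {\<phi> x..\<phi> y}" and xy: "x \<le> y" "\<phi> x \<le> \<phi> y"
    and \<phi>: "\<And>t. t \<in> {x..y} \<Longrightarrow> (\<phi> has_real_derivative \<phi>' t) (at t within {x..y})"
    and pos: "\<And>t. t \<in> {x..y} \<Longrightarrow> \<phi>' t \<ge> 0" and inj: "inj_on \<phi> {x..y}"
  shows "(\<lambda>t. \<phi>' t *\<^sub>R F (\<phi> t)) absolutely_integrable_on {x..y}"
    and "integral {x..y} (\<lambda>t. \<phi>' t *\<^sub>R F (\<phi> t)) = integral {\<phi> x..\<phi> y} F"
proof -
  have "has_density (\<phi> x) (\<phi> y) (\<lambda>t. integral {\<phi> x..t} F) F"
    by (rule has_densityI[OF F]) simp
  then have "has_density x y (\<lambda>t. integral {\<phi> x..\<phi> t} F) (\<lambda>t. \<phi>' t *\<^sub>R F (\<phi> t))"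
    by (rule has_density_compose[OF _ \<phi> pos inj])
  then show "(\<lambda>t. \<phi>' t *\<^sub>R F (\<phi> t)) absolutely_integrable_on {x..y}"
    "integral {x..y} (\<lambda>t. \<phi>' t *\<^sub>R F (\<phi> t)) = integral {\<phi> x..\<phi> y} F"
    using has_density_integral[of x y "\<lambda>t. integral {\<phi> x..\<phi> t} F" _ x y] xy(1)
    by (auto simp: has_density_abs_int)
qed

lemma h2_data_energy_integrable:
  assumes "h2_data L g u a"
  shows "(\<lambda>s. (norm (a s))\<^sup>2 / norm (u s) ^ 3) absolutely_integrable_on {0..L}"
proof -
  have "(\<lambda>s. (norm (a s))\<^sup>2) absolutely_integrable_on {0..L}"
    using h2_data_integrable[OF assms] by (intro nonnegative_absolutely_integrable_1) auto
  moreover have "continuous_on {0..L} (\<lambda>s. 1 / norm (u s) ^ 3)"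
    using h2_data_nz[OF assms] by (intro continuous_intros h2_data_continuous[OF assms]) auto
  ultimately have "(\<lambda>s. (1 / norm (u s) ^ 3) *\<^sub>R (norm (a s))\<^sup>2) absolutely_integrable_on {0..L}"
    by (rule absolutely_integrable_scaleR_continuous[rotated])
  then show ?thesis by simp
qed

text \<open>In \<open>|a|^2 / |u|^3\<close> the numerator gains \<open>c^4\<close> and the
  denominator \<open>c^3\<close>, which leaves exactly the factor \<open>c\<close> of the
  substitution. This integral serves as a bound for the energy of curves that do not have unit
  speed.\<close>

lemma h2_data_rescale:
  assumes h: "h2_data L g u a" and c: "c > 0"
  shows "h2_data (L / c) (\<lambda>t. g (c * t)) (\<lambda>t. c *\<^sub>R u (c * t)) (\<lambda>t. c\<^sup>2 *\<^sub>R a (c * t))"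
    and "integral {0..L / c} (\<lambda>t. (norm (c\<^sup>2 *\<^sub>R a (c * t)))\<^sup>2 / norm (c *\<^sub>R u (c * t)) ^ 3) =
         integral {0..L} (\<lambda>s. (norm (a s))\<^sup>2 / norm (u s) ^ 3)"
proof -
  have der: "((*) c has_real_derivative c) (at t within S)" for t S
    by (auto intro!: derivative_eq_intros)
  have inj: "inj_on ((*) c) S" for S using c by (auto simp: inj_on_def)
  have L: "L > 0" using h by (rule h2_data_pos)
  have period: "c * (t + L / c) = c * t + L" for t using c by (simp add: field_simps)
  have nn: "(\<lambda>s. (norm (a s))\<^sup>2) absolutely_integrable_on {0..L}"
    using h2_data_integrable[OF h] by (intro nonnegative_absolutely_integrable_1) auto
  show "h2_data (L / c) (\<lambda>t. g (c * t)) (\<lambda>t. c *\<^sub>R u (c * t)) (\<lambda>t. c\<^sup>2 *\<^sub>R a (c * t))"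
    unfolding h2_data_def
  proof (intro conjI allI)
    show "L / c > 0" using L c by simp
    show "((\<lambda>t. g (c * t)) has_vector_derivative c *\<^sub>R u (c * t)) (at t)" for t
    proof -
      have "((g \<circ> (*) c) has_vector_derivative c *\<^sub>R u (c * t)) (at t)"
        by (rule vector_diff_chain_at[OF _ h2_data_deriv[OF h]])
           (use der in \<open>simp add: has_real_derivative_iff_has_vector_derivative\<close>)
      then show ?thesis by (simp add: o_def)
    qed
    show "g (c * (t + L / c)) = g (c * t)" for t unfolding period by (rule h2_data_periodic[OF h])
    show "c\<^sup>2 *\<^sub>R a (c * (t + L / c)) = c\<^sup>2 *\<^sub>R a (c * t)" for t
      unfolding period by (simp add: h2_data_periodic''[OF h])
    show "c *\<^sub>R u (c * t) \<noteq> 0" for t using c h2_data_nz[OF h] by simp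
    show "has_density x y (\<lambda>t. c *\<^sub>R u (c * t)) (\<lambda>t. c\<^sup>2 *\<^sub>R a (c * t))" for x y
    proof -
      have "has_density x y (\<lambda>t. u (c * t)) (\<lambda>t. c *\<^sub>R a (c * t))"
        by (rule has_density_compose[OF h2_data_density[OF h] der _ inj]) (use c in auto)
      from has_density_linear[OF this bounded_linear_scaleR_right[of c]]
      show ?thesis by (simp add: power2_eq_square)
    qed
    have "(\<lambda>t. c *\<^sub>R (norm (a (c * t)))\<^sup>2) absolutely_integrable_on {0..L / c}"
      by (rule integral_substitution_increasing(1)[OF _ _ _ der _ inj]) (use nn c L in auto)
    then have "(\<lambda>t. c * (norm (a (c * t)))\<^sup>2) integrable_on {0..L / c}"
      using set_lebesgue_integral_eq_integral(1) by fastforce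
    then have "(\<lambda>t. c ^ 3 * (c * (norm (a (c * t)))\<^sup>2)) integrable_on {0..L / c}"
      by (rule integrable_on_mult_right)
    then show "(\<lambda>t. (norm (c\<^sup>2 *\<^sub>R a (c * t)))\<^sup>2) integrable_on {0..L / c}"
      by (rule back_subst[where P="\<lambda>f. f integrable_on _"])
         (use c in \<open>simp add: power_mult_distrib power2_eq_square power3_eq_cube fun_eq_iff mult.assoc\<close>)
  qed
  let ?F = "\<lambda>s. (norm (a s))\<^sup>2 / norm (u s) ^ 3"
  have "integral {0..L / c} (\<lambda>t. c *\<^sub>R ?F (c * t)) = integral {c * 0..c * (L / c)} ?F"
    by (rule integral_substitution_increasing(2)[OF _ _ _ der _ inj])
       (use h2_data_energy_integrable[OF h] c L in auto)
  moreover have "(norm (c\<^sup>2 *\<^sub>R a (c * t)))\<^sup>2 / norm (c *\<^sub>R u (c * t)) ^ 3 = c *\<^sub>R ?F (c * t)" for t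
    using c h2_data_nz[OF h]
    by (simp add: power_mult_distrib power2_eq_square power3_eq_cube field_simps)
  ultimately show "integral {0..L / c} (\<lambda>t. (norm (c\<^sup>2 *\<^sub>R a (c * t)))\<^sup>2 / norm (c *\<^sub>R u (c * t)) ^ 3) =
         integral {0..L} ?F"
    using c by simp
qed

section \<open>Arc-length parametrization and bending energy\<close>

lemma has_density_unit_tangent:
  fixes u :: "real \<Rightarrow> complex"
  assumes u: "has_density x y u a" and nz: "\<And>t. u t \<noteq> 0"
  shows "has_density x y (\<lambda>t. u t /\<^sub>R norm (u t))
           (\<lambda>t. a t /\<^sub>R norm (u t) - ((u t \<bullet> a t) / norm (u t) ^ 3) *\<^sub>R u t)"
proof -
  have q: "has_density x y (\<lambda>t. u t \<bullet> u t) (\<lambda>t. a t \<bullet> u t + u t \<bullet> a t)"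
    by (rule has_density_inner[OF u u])
  have "has_density x y (\<lambda>t. 1 / sqrt (u t \<bullet> u t))
          (\<lambda>t. - (1 / (2 * (u t \<bullet> u t) * sqrt (u t \<bullet> u t))) * (a t \<bullet> u t + u t \<bullet> a t))"
  proof (rule has_density_chain[OF q, of "{0<..}"])
    show "((\<lambda>z. 1 / sqrt z) has_real_derivative - (1 / (2 * z * sqrt z))) (at z within {0<..})"
      if "z \<in> {0<..}" for z :: real
      using that by (auto intro!: derivative_eq_intros simp: field_simps)
    show "continuous_on {0<..} (\<lambda>z::real. - (1 / (2 * z * sqrt z)))"
      by (intro continuous_intros) auto
  qed (use nz in auto)
  from has_density_scaleR[OF this u]
  have *: "has_density x y (\<lambda>t. (1 / sqrt (u t \<bullet> u t)) *\<^sub>R u t)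
    (\<lambda>t. (- (1 / (2 * (u t \<bullet> u t) * sqrt (u t \<bullet> u t))) * (a t \<bullet> u t + u t \<bullet> a t)) *\<^sub>R u t + (1 / sqrt (u t \<bullet> u t)) *\<^sub>R a t)" .
  have 1: "(\<lambda>t. (1 / sqrt (u t \<bullet> u t)) *\<^sub>R u t) = (\<lambda>t. u t /\<^sub>R norm (u t))"
    by (simp add: norm_eq_sqrt_inner divide_inverse)
  have 2: "(\<lambda>t. (- (1 / (2 * (u t \<bullet> u t) * sqrt (u t \<bullet> u t))) * (a t \<bullet> u t + u t \<bullet> a t)) *\<^sub>R u t + (1 / sqrt (u t \<bullet> u t)) *\<^sub>R a t)
     = (\<lambda>t. a t /\<^sub>R norm (u t) - ((u t \<bullet> a t) / norm (u t) ^ 3) *\<^sub>R u t)"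
  proof
    fix t
    have n: "u t \<bullet> u t = norm (u t) ^ 2" by (rule power2_norm_eq_inner[symmetric])
    have s: "sqrt (u t \<bullet> u t) = norm (u t)" by (rule norm_eq_sqrt_inner[symmetric])
    have c: "- (1 / (2 * (u t \<bullet> u t) * sqrt (u t \<bullet> u t))) * (a t \<bullet> u t + u t \<bullet> a t) = - ((u t \<bullet> a t) / norm (u t) ^ 3)"
      unfolding s unfolding n using nz[of t]
      by (simp add: inner_commute[of "a t" "u t"] power2_eq_square power3_eq_cube)
    show "(- (1 / (2 * (u t \<bullet> u t) * sqrt (u t \<bullet> u t))) * (a t \<bullet> u t + u t \<bullet> a t)) *\<^sub>R u t + (1 / sqrt (u t \<bullet> u t)) *\<^sub>R a t
       = a t /\<^sub>R norm (u t) - ((u t \<bullet> a t) / norm (u t) ^ 3) *\<^sub>R u t"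
      unfolding c unfolding s by (simp only: inverse_eq_divide scaleR_minus_left add.commute[of "- _"] diff_conv_add_uminus)
  qed
  show ?thesis using * unfolding 1 2 .
qed

text \<open>Up to the factor \<open>1 / |u|\<close>, the vector on the left is the component of
  \<open>a\<close> orthogonal to \<open>u\<close>.\<close>

lemma norm_unit_tangent_density_le:
  fixes u a :: complex
  assumes "u \<noteq> 0"
  shows "(norm (a /\<^sub>R norm u - ((u \<bullet> a) / norm u ^ 3) *\<^sub>R u))\<^sup>2 \<le> (norm a)\<^sup>2 / (norm u)\<^sup>2"
proof -
  define n p where "n = norm u" and "p = u \<bullet> a"
  have n: "n > 0" using assms by (simp add: n_def)
  have uu: "u \<bullet> u = n\<^sup>2" unfolding n_def by (rule power2_norm_eq_inner[symmetric])
  have "(norm (a /\<^sub>R n - (p / n ^ 3) *\<^sub>R u))\<^sup>2 = (a \<bullet> a) / n\<^sup>2 - 2 * (p / n ^ 3) * p / n + (p / n ^ 3)\<^sup>2 * n\<^sup>2"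
    unfolding power2_norm_eq_inner inner_diff_left inner_diff_right inner_scaleR_left inner_scaleR_right uu
    by (simp add: p_def inner_commute[of a u] power2_eq_square divide_inverse algebra_simps)
  also have "\<dots> = (a \<bullet> a) / n\<^sup>2 - p\<^sup>2 / n ^ 4"
    using n by (simp add: field_simps power2_eq_square power3_eq_cube power4_eq_xxxx)
  also have "\<dots> \<le> (norm a)\<^sup>2 / n\<^sup>2" unfolding power2_norm_eq_inner by simp
  finally show ?thesis by (simp add: n_def p_def)
qed

text \<open>\<sigma> is the antiderivative of the speed on the whole line. As the speed is periodic,
  \<open>\<sigma> (t + P) - \<sigma> t\<close> is constant, and this linear growth makes \<sigma>
  surjective; the inverse function theorem gives the derivative of \<tau>.\<close>

lemma h2_data_arc_length_inverse:
  assumes h: "h2_data P g u a"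
  obtains \<sigma> \<tau> L where "L > 0" "\<And>t. (\<sigma> has_real_derivative norm (u t)) (at t)" "\<sigma> 0 = 0"
    "\<And>t. \<sigma> (t + P) = \<sigma> t + L" "\<And>t. \<tau> (\<sigma> t) = t" "\<And>s. \<sigma> (\<tau> s) = s" "strict_mono \<sigma>"
    "\<And>s. (\<tau> has_real_derivative 1 / norm (u (\<tau> s))) (at s)"
proof -
  have P: "P > 0" using h by (rule h2_data_pos)
  have "\<exists>F. \<forall>t. - \<infinity> < ereal t \<longrightarrow> ereal t < \<infinity> \<longrightarrow> (F has_vector_derivative norm (u t)) (at t)"
    by (rule einterval_antiderivative)
       (use h2_data_continuous(1)[OF h, of UNIV] in \<open>auto intro!: continuous_intros simp: continuous_on_eq_continuous_at\<close>)
  then obtain F where F: "\<And>t. (F has_vector_derivative norm (u t)) (at t)" by auto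
  define \<sigma> where "\<sigma> t = F t - F 0" for t
  have der: "(\<sigma> has_real_derivative norm (u t)) (at t)" for t
    unfolding \<sigma>_def[abs_def] using F[of t]
    by (auto intro!: derivative_eq_intros simp: has_real_derivative_iff_has_vector_derivative)
  have pos: "norm (u t) > 0" for t using h2_data_nz[OF h] by simp
  have mono: "strict_mono \<sigma>"
    by (rule strict_monoI, rule DERIV_pos_imp_increasing) (use der pos in blast)+
  define L where "L = \<sigma> P"
  have s0: "\<sigma> 0 = 0" by (simp add: \<sigma>_def)
  have L: "L > 0" using strict_monoD[OF mono P] by (simp add: L_def s0)
  have per: "\<sigma> (t + P) = \<sigma> t + L" for t
  proof -
    have "((\<lambda>t. \<sigma> (t + P) - \<sigma> t) has_real_derivative norm (u (t + P)) * 1 - norm (u t)) (at t)" for t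
      by (intro DERIV_diff der DERIV_chain2[OF der]) (auto intro!: derivative_eq_intros)
    then have "\<forall>t. ((\<lambda>t. \<sigma> (t + P) - \<sigma> t) has_real_derivative 0) (at t)"
      by (simp add: h2_data_periodic'[OF h])
    from DERIV_isconst_all[OF this, of t 0] show ?thesis by (simp add: L_def s0)
  qed
  have cont: "continuous_on A \<sigma>" for A
    using der by (intro continuous_at_imp_continuous_on) (auto intro: DERIV_isCont)
  have mult: "\<sigma> (real n * P) = real n * L \<and> \<sigma> (- (real n * P)) = - (real n * L)" for n
  proof (induction n)
    case (Suc n)
    have "\<sigma> (real (Suc n) * P) = \<sigma> (real n * P) + L"
      using per[of "real n * P"] by (simp add: algebra_simps)
    moreover have "\<sigma> (- (real n * P)) = \<sigma> (- (real (Suc n) * P)) + L"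
      using per[of "- (real (Suc n) * P)"] by (simp add: algebra_simps)
    ultimately show ?case using Suc by (simp add: algebra_simps)
  qed (simp add: s0)
  have surj: "surj \<sigma>"
    unfolding surj_def
  proof
    fix y
    obtain n :: nat where n: "\<bar>y\<bar> / L \<le> real n" by (meson real_arch_simple)
    then have y: "\<bar>y\<bar> \<le> real n * L" using L by (simp add: field_simps)
    have "\<exists>t\<ge>- (real n * P). t \<le> real n * P \<and> \<sigma> t = y"
      by (rule IVT') (use y mult[of n] P cont in auto)
    then show "\<exists>t. y = \<sigma> t" by blast
  qed
  define \<tau> where "\<tau> = inv \<sigma>"
  have inj: "inj \<sigma>" using mono by (rule strict_mono_imp_inj_on)
  have ts: "\<tau> (\<sigma> t) = t" for t using inj by (simp add: \<tau>_def)
  have st: "\<sigma> (\<tau> s) = s" for s using surj by (simp add: \<tau>_def surj_f_inv_f)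
  have dert: "(\<tau> has_real_derivative 1 / norm (u (\<tau> s))) (at s)" for s
  proof -
    have "isCont \<tau> (\<sigma> (\<tau> s))"
      by (rule isCont_inverse_function[of 1]) (use ts der in \<open>auto intro: DERIV_isCont\<close>)
    then have "isCont \<tau> s" by (simp add: st)
    then have "(\<tau> has_real_derivative inverse (norm (u (\<tau> s)))) (at s)"
      by (intro DERIV_inverse_function[of \<sigma> _ \<tau> s "s - 1" "s + 1"]) (use der pos st in auto)
    then show ?thesis by (simp add: inverse_eq_divide)
  qed
  show thesis by (rule that[OF L der s0 per ts st mono dert])
qed

text \<open>This replaces the bending energy, defined through an arbitrarily chosen weak second
  derivative, by a plain integral over the unit-speed parametrization. The final inequality drops
  the tangential part of the acceleration; through it competitors can be estimated in any
  parametrization.\<close>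

lemma h2_data_unit_speed:
  assumes h: "h2_data (2 * pi) \<gamma> u a"
  obtains L g T a' \<sigma> where "h2_data L g T a'" "\<And>s. norm (T s) = 1" "\<And>t. \<gamma> t = g (\<sigma> t)"
    "strict_mono \<sigma>" "surj \<sigma>" "\<And>t. \<sigma> (t + 2 * pi) = \<sigma> t + L" "\<sigma> 0 = 0"
    "bending_energy \<gamma> = integral {0..L} (\<lambda>s. (norm (a' s))\<^sup>2)"
    "integral {0..L} (\<lambda>s. (norm (a' s))\<^sup>2) \<le> integral {0..2 * pi} (\<lambda>t. (norm (a t))\<^sup>2 / norm (u t) ^ 3)"
proof -
  obtain \<sigma> \<tau> L where L: "L > 0" and \<sigma>: "\<And>t. (\<sigma> has_real_derivative norm (u t)) (at t)" "\<sigma> 0 = 0"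
    "\<And>t. \<sigma> (t + 2 * pi) = \<sigma> t + L" and inv: "\<And>t. \<tau> (\<sigma> t) = t" "\<And>s. \<sigma> (\<tau> s) = s"
    and mono: "strict_mono \<sigma>" and \<tau>: "\<And>s. (\<tau> has_real_derivative 1 / norm (u (\<tau> s))) (at s)"
    by (rule h2_data_arc_length_inverse[OF h]) (rule that; assumption)
  have nz: "u t \<noteq> 0" for t by (rule h2_data_nz[OF h])
  define u0 where "u0 t = u t /\<^sub>R norm (u t)" for t
  define b where "b t = a t /\<^sub>R norm (u t) - ((u t \<bullet> a t) / norm (u t) ^ 3) *\<^sub>R u t" for t
  define g where "g s = \<gamma> (\<tau> s)" for s
  define T where "T s = u0 (\<tau> s)" for s
  define a' where "a' s = (1 / norm (u (\<tau> s))) *\<^sub>R b (\<tau> s)" for s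
  have dens0: "has_density x y u0 b" for x y
    unfolding u0_def[abs_def] b_def[abs_def] by (rule has_density_unit_tangent[OF h2_data_density[OF h] nz])
  have per: "\<tau> (s + L) = \<tau> s + 2 * pi" for s
    using inv(1)[of "\<tau> s + 2 * pi"] \<sigma>(3)[of "\<tau> s"] by (simp add: inv(2))
  have ends: "\<tau> 0 = 0" "\<tau> L = 2 * pi" "\<sigma> (2 * pi) = L"
    using inv(1)[of 0] per[of 0] \<sigma>(3)[of 0] by (auto simp: \<sigma>(2))
  have uper: "u (t + 2 * pi) = u t" "a (t + 2 * pi) = a t" for t
    using h2_data_periodic'[OF h] h2_data_periodic''[OF h] by auto
  have inj: "inj_on \<tau> S" for S by (metis inj_onI inv(2))
  have der: "(\<tau> has_real_derivative 1 / norm (u (\<tau> s))) (at s within S)" for s S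
    using \<tau>[of s] by (rule has_field_derivative_at_within)
  have dens: "has_density x y T a'" for x y
    unfolding T_def[abs_def] a'_def[abs_def]
    by (rule has_density_compose[OF dens0 der _ inj]) simp
  have gder: "(g has_vector_derivative T s) (at s)" for s
  proof -
    have "((\<gamma> \<circ> \<tau>) has_vector_derivative (1 / norm (u (\<tau> s))) *\<^sub>R u (\<tau> s)) (at s)"
      by (rule vector_diff_chain_at[OF _ h2_data_deriv[OF h]])
         (use \<tau> in \<open>simp add: has_real_derivative_iff_has_vector_derivative\<close>)
    then show ?thesis by (simp add: o_def g_def[abs_def] T_def u0_def inverse_eq_divide)
  qed
  let ?F = "\<lambda>t. (norm (b t))\<^sup>2 / norm (u t)"
  let ?G = "\<lambda>t. (norm (a t))\<^sup>2 / norm (u t) ^ 3"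
  have FG: "?F t \<le> ?G t" for t
  proof -
    have "(norm (b t))\<^sup>2 \<le> (norm (a t))\<^sup>2 / (norm (u t))\<^sup>2"
      unfolding b_def by (rule norm_unit_tangent_density_le[OF nz])
    then have "?F t \<le> (norm (a t))\<^sup>2 / (norm (u t))\<^sup>2 / norm (u t)"
      by (intro divide_right_mono) auto
    then show ?thesis by (simp add: power2_eq_square power3_eq_cube)
  qed
  have Gint: "?G absolutely_integrable_on {0..2 * pi}" by (rule h2_data_energy_integrable[OF h])
  have Fint: "?F absolutely_integrable_on {0..2 * pi}"
  proof (rule measurable_bounded_by_integrable_imp_absolutely_integrable)
    have [measurable]: "b \<in> borel_measurable lebesgue"
      by (rule borel_measurable_abs_int) (rule has_density_abs_int[OF dens0])
    have "u \<in> borel_measurable borel"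
      using h2_data_continuous(1)[OF h] by (rule borel_measurable_continuous_onI)
    then have [measurable]: "u \<in> borel_measurable lebesgue" by (simp add: measurable_completion)
    have "?F \<in> borel_measurable lebesgue" by measurable
    then show "?F \<in> borel_measurable (lebesgue_on {0..2 * pi})" by (rule measurable_restrict_space1)
    show "?G integrable_on {0..2 * pi}" using Gint by (rule set_lebesgue_integral_eq_integral(1))
    show "norm (?F t) \<le> ?G t" for t using FG[of t] by simp
  qed auto
  have a'F: "(1 / norm (u (\<tau> s))) *\<^sub>R ?F (\<tau> s) = (norm (a' s))\<^sup>2" for s
    by (simp add: a'_def power_divide power2_eq_square)
  have sub: "(\<lambda>s. (norm (a' s))\<^sup>2) absolutely_integrable_on {0..L}"
    "integral {0..L} (\<lambda>s. (norm (a' s))\<^sup>2) = integral {0..2 * pi} ?F"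
    using integral_substitution_increasing[where F="?F" and \<phi>=\<tau> and x=0 and y=L, OF _ _ _ der _ inj]
      Fint L unfolding ends a'F by auto
  have data: "h2_data L g T a'"
    unfolding h2_data_def
  proof (intro conjI allI)
    show "g (s + L) = g s" for s by (simp add: g_def per h2_data_periodic[OF h])
    show "a' (s + L) = a' s" for s by (simp add: a'_def b_def per uper)
    show "T s \<noteq> 0" for s by (simp add: T_def u0_def nz)
    show "(\<lambda>s. (norm (a' s))\<^sup>2) integrable_on {0..L}"
      using sub(1) by (rule set_lebesgue_integral_eq_integral(1))
  qed (use L gder dens in auto)
  have vd: "vector_derivative \<gamma> (at t) = u t" for t
    using h2_data_deriv[OF h] by (rule vector_derivative_at)
  have al: "arc_length \<gamma> t = \<sigma> t" if "t \<ge> 0" for t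
  proof -
    have "((\<lambda>t. norm (u t)) has_integral (\<sigma> t - \<sigma> 0)) {0..t}"
      by (rule fundamental_theorem_of_calculus[OF that])
         (use \<sigma>(1) in \<open>auto simp: has_real_derivative_iff_has_vector_derivative[symmetric] intro: has_field_derivative_at_within\<close>)
    then show ?thesis by (simp add: arc_length_def vd \<sigma>(2) integral_unique)
  qed
  have cl: "curve_length \<gamma> = L" by (simp add: curve_length_def al ends)
  have alp: "arc_length_param \<gamma> s = g s" if s: "s \<in> {0..L}" for s
  proof -
    have ts: "\<tau> s \<in> {0..2 * pi}"
    proof -
      have "\<sigma> 0 \<le> \<sigma> (\<tau> s)" "\<sigma> (\<tau> s) \<le> \<sigma> (2 * pi)" using s by (auto simp: inv \<sigma>(2) ends)
      then show ?thesis using mono by (simp add: strict_mono_less_eq)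
    qed
    have "inj_on (arc_length \<gamma>) {0..2 * pi}"
      by (rule inj_onI) (metis al atLeastAtMost_iff inv(1))
    then have "inv_into {0..2 * pi} (arc_length \<gamma>) (arc_length \<gamma> (\<tau> s)) = \<tau> s"
      using ts by (rule inv_into_f_f)
    moreover have "arc_length \<gamma> (\<tau> s) = s" using al ts inv(2) by simp
    ultimately show ?thesis by (simp add: arc_length_param_def g_def)
  qed
  let ?U = "{0<..<L}"
  have w1: "has_weak_deriv_on ?U (arc_length_param \<gamma>) T"
  proof (rule density_imp_weak_deriv)
    fix x y assume xy: "x \<le> y" "{x..y} \<subseteq> ?U"
    have "has_density x y g T" by (rule h2_data_g_density[OF data])
    moreover have "arc_length_param \<gamma> t = g t" if "t \<in> {x..y}" for t
      by (rule alp) (use that xy in \<open>auto dest!: subsetD[OF xy(2)]\<close>)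
    ultimately show "has_density x y (arc_length_param \<gamma>) T"
      using xy(1) by (simp add: has_density_def)
  qed auto
  have w2: "has_weak_deriv_on ?U T a'"
    by (rule density_imp_weak_deriv) (use dens in auto)
  \<comment> \<open>Whatever \<open>SOME\<close> selects, uniqueness of weak derivatives, applied
    twice, identifies it with \<open>a'\<close> almost everywhere.\<close>
  define A where "A = weak_second_deriv ?U (arc_length_param \<gamma>)"
  have "\<exists>v. has_weak_deriv_on ?U (arc_length_param \<gamma>) v \<and> has_weak_deriv_on ?U v A"
    unfolding A_def weak_second_deriv_def 
    by (rule someI_ex[where P="\<lambda>A. \<exists>v. has_weak_deriv_on ?U (arc_length_param \<gamma>) v \<and> has_weak_deriv_on ?U v A"])
       (use w1 w2 in blast)
  then obtain v where v: "has_weak_deriv_on ?U (arc_length_param \<gamma>) v" "has_weak_deriv_on ?U v A" by blast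
  have "AE s in lebesgue. s \<in> ?U \<longrightarrow> v s = T s"
    by (rule weak_deriv_unique[OF _ v(1) w1]) auto
  then have AE: "AE s in lebesgue. s \<in> ?U \<longrightarrow> A s = a' s"
    by (intro weak_deriv_unique[OF _ v(2) w2]) auto
  have meas: "(\<lambda>s. indicat_real ?U s *\<^sub>R (norm (f s))\<^sup>2) \<in> borel_measurable lebesgue"
    if "locally_integrable_on ?U f" for f :: "real \<Rightarrow> complex"
  proof -
    have "set_integrable lebesgue {x..y} f" if "0 < x" "y < L" for x y
    proof -
      have "{x..y} \<subseteq> ?U" using that by auto
      then show ?thesis using \<open>locally_integrable_on ?U f\<close> by (simp add: locally_integrable_on_def)
    qed
    then have [measurable]: "(\<lambda>s. indicat_real ?U s *\<^sub>R f s) \<in> borel_measurable lebesgue"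
      by (rule borel_measurable_locally_integrable)
    have "(\<lambda>s. (norm (indicat_real ?U s *\<^sub>R f s))\<^sup>2) \<in> borel_measurable lebesgue" by measurable
    moreover have "(\<lambda>s. (norm (indicat_real ?U s *\<^sub>R f s))\<^sup>2) = (\<lambda>s. indicat_real ?U s *\<^sub>R (norm (f s))\<^sup>2)"
      by (auto simp: indicator_def fun_eq_iff)
    ultimately show ?thesis by simp
  qed
  have "bending_energy \<gamma> = (LINT s:?U|lebesgue. (norm (A s))\<^sup>2)"
    by (simp add: bending_energy_def cl A_def)
  also have "\<dots> = (LINT s:?U|lebesgue. (norm (a' s))\<^sup>2)"
    unfolding set_lebesgue_integral_def
  proof (rule integral_cong_AE)
    show "AE s in lebesgue. indicat_real ?U s *\<^sub>R (norm (A s))\<^sup>2 = indicat_real ?U s *\<^sub>R (norm (a' s))\<^sup>2"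
      using AE by (rule eventually_mono) (simp add: indicator_def)
  qed (use v(2) w2 in \<open>auto intro!: meas[unfolded real_scaleR_def] simp: has_weak_deriv_on_def\<close>)
  also have "\<dots> = integral ?U (\<lambda>s. (norm (a' s))\<^sup>2)"
    by (rule set_lebesgue_integral_eq_integral(2), rule set_integrable_subset[OF sub(1)]) auto
  also have "\<dots> = integral {0..L} (\<lambda>s. (norm (a' s))\<^sup>2)"
    by (rule integral_open_interval_real[symmetric])
  finally have bend: "bending_energy \<gamma> = integral {0..L} (\<lambda>s. (norm (a' s))\<^sup>2)" .
  have le: "integral {0..L} (\<lambda>s. (norm (a' s))\<^sup>2) \<le> integral {0..2 * pi} ?G"
    unfolding sub(2)
    by (rule integral_le) (use Fint Gint FG set_lebesgue_integral_eq_integral(1) in \<open>blast+\<close>)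
  have nT: "norm (T s) = 1" for s by (simp add: T_def u0_def nz)
  have gs: "\<gamma> t = g (\<sigma> t)" for t by (simp add: g_def inv)
  have surj: "surj \<sigma>" using inv(2) by (rule surjI)
  show thesis by (rule that[OF data nT gs mono surj \<sigma>(3) \<sigma>(2) bend le])
qed

section \<open>Gluing and periodic extension\<close>

lemma has_density_combine:
  fixes f :: "real \<Rightarrow> 'a::euclidean_space"
  assumes 1: "has_density x y f a" and 2: "has_density y z f a" and le: "x \<le> y" "y \<le> z"
  shows "has_density x z f a"
  unfolding has_density_def
proof (intro conjI ballI)
  have "a absolutely_integrable_on ({x..y} \<union> {y..z})"
    using has_density_abs_int[OF 1] has_density_abs_int[OF 2] by (rule set_integrable_Un) auto
  then show "a absolutely_integrable_on {x..z}" using le by (simp add: ivl_disj_un_two_touch)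
  fix t assume t: "t \<in> {x..z}"
  show "(a has_integral f t - f x) {x..t}"
  proof (cases "t \<le> y")
    case True
    then show ?thesis using has_density_has_integral[OF 1, of x t] t by simp
  next
    case False
    have "(a has_integral (f y - f x) + (f t - f y)) {x..t}"
      by (rule has_integral_combine[of x y t])
         (use has_density_has_integral[OF 1, of x y] has_density_has_integral[OF 2, of y t] t le False in auto)
    then show ?thesis by simp
  qed
qed

lemma has_density_cong:
  fixes f :: "real \<Rightarrow> 'a::euclidean_space"
  assumes f: "has_density x y f a" and eq: "\<And>t. t \<in> {x..y} \<Longrightarrow> f' t = f t"
    and S: "finite S" "\<And>t. t \<in> {x..y} - S \<Longrightarrow> a' t = a t"
  shows "has_density x y f' a'"
proof -
  have neg: "negligible S" using S(1) by (rule negligible_finite)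
  have "a' absolutely_integrable_on {x..y}"
    by (rule absolutely_integrable_spike[OF has_density_abs_int[OF f] neg]) (use S in auto)
  moreover have "(a' has_integral f' t - f' x) {x..t}" if t: "t \<in> {x..y}" for t
  proof -
    have "(a has_integral f' t - f' x) {x..t}"
      using has_density_has_integral[OF f, of x t] t eq[of t] eq[of x] by simp
    then show ?thesis
      by (rule has_integral_spike[OF neg, rotated]) (use S t in auto)
  qed
  ultimately show ?thesis by (simp add: has_density_def)
qed

definition periodic_rem :: "real \<Rightarrow> real \<Rightarrow> real" where
  "periodic_rem L s = s - L * of_int \<lfloor>s / L\<rfloor>"

lemma periodic_rem_bounds:
  assumes "L > 0"
  shows "0 \<le> periodic_rem L s" "periodic_rem L s < L"
proof -
  have "of_int \<lfloor>s / L\<rfloor> \<le> s / L" "s / L < of_int \<lfloor>s / L\<rfloor> + 1" by linarith+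
  then show "0 \<le> periodic_rem L s" "periodic_rem L s < L"
    using assms pos_le_divide_eq[OF assms] pos_divide_less_eq[OF assms]
    by (simp_all add: periodic_rem_def algebra_simps)
qed

lemma periodic_rem_eq:
  assumes "L > 0" "of_int k * L \<le> s" "s < (of_int k + 1) * L"
  shows "periodic_rem L s = s - of_int k * L"
proof -
  have "\<lfloor>s / L\<rfloor> = k" using assms by (simp add: floor_unique field_simps)
  then show ?thesis by (simp add: periodic_rem_def)
qed

lemma periodic_rem_add:
  assumes "L > 0"
  shows "periodic_rem L (s + L) = periodic_rem L s"
  using assms by (simp add: periodic_rem_def add_divide_distrib algebra_simps)

lemma periodic_rem_periodic:
  assumes "\<And>s. f (s + L) = f s"
  shows "f (periodic_rem L s) = f s"
proof -
  have nat: "f (s + real n * L) = f s" for s n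
  proof (induction n)
    case (Suc n)
    then show ?case using assms[of "s + real n * L"] by (simp add: algebra_simps)
  qed simp
  have "f (s + of_int k * L) = f s" for k s
  proof (cases k)
    case (nonneg n)
    then show ?thesis using nat by simp
  next
    case (neg n)
    then have "(of_int k :: real) = - real (Suc n)" by simp
    then have "of_int k * L = - (real (Suc n) * L)" by (simp only: mult_minus_left)
    then have "s + of_int k * L + real (Suc n) * L = s" by linarith
    then show ?thesis using nat[of "s + of_int k * L" "Suc n"] by (simp only:)
  qed
  from this[of s "- \<lfloor>s / L\<rfloor>"] show ?thesis by (simp add: periodic_rem_def algebra_simps)
qed

text \<open>On each cell the extension is a translate of \<open>f\<close>, except at the right end
  point, where the remainder jumps back to \<open>0\<close>. There \<open>f L = f 0\<close> keeps
  the values right, and the density changes at a single point only. Finitely many cells are then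
  glued.\<close>

lemma has_density_periodic:
  fixes f :: "real \<Rightarrow> 'a::euclidean_space"
  assumes f: "has_density 0 L f a" and L: "L > 0" and per: "f L = f 0"
  shows "has_density x y (\<lambda>s. f (periodic_rem L s)) (\<lambda>s. a (periodic_rem L s))"
proof -
  let ?f = "\<lambda>s. f (periodic_rem L s)" and ?a = "\<lambda>s. a (periodic_rem L s)"
  have cell: "has_density (of_int k * L) ((of_int k + 1) * L) ?f ?a" for k
  proof -
    let ?\<phi> = "\<lambda>s. s - of_int k * L"
    have "has_density (of_int k * L) ((of_int k + 1) * L) (\<lambda>s. f (?\<phi> s)) (\<lambda>s. 1 *\<^sub>R a (?\<phi> s))"
      by (rule has_density_compose) (use f in \<open>auto intro!: derivative_eq_intros simp: algebra_simps\<close>)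
    then have "has_density (of_int k * L) ((of_int k + 1) * L) (\<lambda>s. f (?\<phi> s)) (\<lambda>s. a (?\<phi> s))" by simp
    then show ?thesis
    proof (rule has_density_cong[where S="{(of_int k + 1) * L}"])
      fix t assume t: "t \<in> {of_int k * L..(of_int k + 1) * L}"
      show "?f t = f (?\<phi> t)"
      proof (cases "t = (of_int k + 1) * L")
        case True
        have "periodic_rem L t = t - of_int (k + 1) * L"
          by (rule periodic_rem_eq) (use True L in \<open>auto simp: algebra_simps\<close>)
        then show ?thesis using True per by (simp add: algebra_simps)
      next
        case False
        then show ?thesis using periodic_rem_eq[OF L, of k t] t by simp
      qed
    next
      fix t assume "t \<in> {of_int k * L..(of_int k + 1) * L} - {(of_int k + 1) * L}"
      then show "?a t = a (?\<phi> t)" using periodic_rem_eq[OF L, of k t] by auto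
    qed auto
  qed
  have cells: "has_density (of_int k * L) ((of_int k + real n) * L) ?f ?a" for k n
  proof (induction n)
    case 0
    show ?case using cell[of k] L
      by (intro has_density_subinterval[OF cell[of k]]) (auto simp: algebra_simps)
  next
    case (Suc n)
    have "has_density ((of_int k + real n) * L) ((of_int k + real (Suc n)) * L) ?f ?a"
      using cell[of "k + int n"] by (simp add: algebra_simps)
    with Suc show ?case
      by (rule has_density_combine) (use L in \<open>auto intro!: mult_right_mono\<close>)
  qed
  define k where "k = \<lfloor>x / L\<rfloor>"
  obtain n :: nat where n: "y / L - of_int k \<le> real n" by (meson real_arch_simple)
  show ?thesis
  proof (rule has_density_subinterval[OF cells[of k n]])
    have "of_int k \<le> x / L" by (simp add: k_def)
    then show "of_int k * L \<le> x" using L by (simp add: field_simps)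
    show "y \<le> (of_int k + real n) * L" using n L by (simp add: field_simps)
  qed
qed

lemma h2_data_periodic_extension:
  assumes L: "L > 0" and g: "has_density 0 L g u" "g L = g 0" and u: "has_density 0 L u a" "u L = u 0"
    and nz: "\<And>s. 0 \<le> s \<Longrightarrow> s < L \<Longrightarrow> u s \<noteq> 0" and a: "(\<lambda>s. (norm (a s))\<^sup>2) integrable_on {0..L}"
  shows "h2_data L (\<lambda>s. g (periodic_rem L s)) (\<lambda>s. u (periodic_rem L s)) (\<lambda>s. a (periodic_rem L s))"
  unfolding h2_data_def
proof (intro conjI allI)
  let ?g = "\<lambda>s. g (periodic_rem L s)" and ?u = "\<lambda>s. u (periodic_rem L s)"
  have gd: "has_density x y ?g ?u" for x y by (rule has_density_periodic[OF g(1) L g(2)])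
  show ud: "has_density x y ?u (\<lambda>s. a (periodic_rem L s))" for x y by (rule has_density_periodic[OF u(1) L u(2)])
  have cont: "continuous_on {x..y} ?u" for x y using ud by (rule has_density_continuous_on)
  show "(?g has_vector_derivative ?u s) (at s)" for s
  proof -
    \<comment> \<open>The extended velocity is continuous because \<open>u L = u 0\<close>, so its
      indefinite integral is differentiable everywhere and the density becomes a classical
      derivative.\<close>
    have "((\<lambda>t. ?g (s - 1) + integral {s - 1..t} ?u) has_vector_derivative 0 + ?u s) (at s within {s - 1..s + 1})"
      by (intro has_vector_derivative_add has_vector_derivative_const integral_has_vector_derivative[OF cont]) auto
    from this[unfolded add_0]
    have "(?g has_vector_derivative ?u s) (at s within {s - 1..s + 1})"
      by (rule has_vector_derivative_transform[rotated 2])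
         (use has_density_integral[OF gd[of "s - 1" "s + 1"]] in auto)
    then show ?thesis using at_within_interior[of s "{s - 1..s + 1}"] by simp
  qed
  show "?u s \<noteq> 0" for s using nz periodic_rem_bounds[OF L] by simp
  show "(\<lambda>s. (norm (a (periodic_rem L s)))\<^sup>2) integrable_on {0..L}"
  proof (rule integrable_spike_finite[OF _ _ a, of "{L}"])
    fix s assume "s \<in> {0..L} - {L}"
    then show "(norm (a (periodic_rem L s)))\<^sup>2 = (norm (a s))\<^sup>2"
      using periodic_rem_eq[OF L, of 0 s] by auto
  qed auto
qed (simp_all add: L periodic_rem_add)

text \<open>Competitors are produced here: a closed path given on one period, of any length and any
  nonvanishing speed, is extended periodically and rescaled to period \<open>2 * pi\<close>. The
  scale-invariant integrand \<open>|a|^2 / |u|^3\<close> carries the energy bound through.\<close>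

lemma closed_path_admissible:
  assumes L: "L > 0" and g: "has_density 0 L g u" "g L = g 0" and u: "has_density 0 L u a" "u L = u 0"
    and nz: "\<And>s. 0 \<le> s \<Longrightarrow> s < L \<Longrightarrow> u s \<noteq> 0" and a: "(\<lambda>s. (norm (a s))\<^sup>2) integrable_on {0..L}"
    and ran: "\<And>s. 0 \<le> s \<Longrightarrow> s < L \<Longrightarrow> g s \<in> closure \<Omega>"
    and par: "\<And>s t. 0 \<le> s \<Longrightarrow> s < L \<Longrightarrow> 0 \<le> t \<Longrightarrow> t < L \<Longrightarrow> s \<noteq> t \<Longrightarrow> g s = g t \<Longrightarrow> parallel (u s) (u t)"
  obtains \<gamma> where "\<gamma> \<in> admissible_curves \<Omega>"
    "bending_energy \<gamma> \<le> integral {0..L} (\<lambda>s. (norm (a s))\<^sup>2 / norm (u s) ^ 3)"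
proof -
  let ?r = "periodic_rem L"
  define c where "c = L / (2 * pi)"
  have c: "c > 0" "L / c = 2 * pi" using L by (auto simp: c_def)
  have h0: "h2_data L (\<lambda>s. g (?r s)) (\<lambda>s. u (?r s)) (\<lambda>s. a (?r s))"
    by (rule h2_data_periodic_extension[OF L g u nz a])
  define \<gamma> where "\<gamma> t = g (?r (c * t))" for t
  define v where "v t = c *\<^sub>R u (?r (c * t))" for t
  define b where "b t = c\<^sup>2 *\<^sub>R a (?r (c * t))" for t
  have h: "h2_data (2 * pi) \<gamma> v b"
    using h2_data_rescale(1)[OF h0 c(1)] by (simp add: c \<gamma>_def[abs_def] v_def[abs_def] b_def[abs_def])
  have vd: "vector_derivative \<gamma> (at t) = v t" for t
    using h2_data_deriv[OF h] by (rule vector_derivative_at)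
  have rem: "?r (c * t) = c * t" "0 \<le> c * t" "c * t < L" if "t \<in> {0..<2 * pi}" for t
  proof -
    show "0 \<le> c * t" using that c by auto
    have "c * t < c * (2 * pi)" using that c by (intro mult_strict_left_mono) auto
    also have "\<dots> = L" by (simp add: c_def)
    finally show "c * t < L" .
    then show "?r (c * t) = c * t" using periodic_rem_eq[OF L, of 0 "c * t"] \<open>0 \<le> c * t\<close> by simp
  qed
  have "\<gamma> \<in> admissible_curves \<Omega>"
    unfolding admissible_curves_def
  proof (intro CollectI conjI ballI impI)
    show "regular_curve \<gamma>" using h by (rule h2_data_imp_regular_curve)
    show "range \<gamma> \<subseteq> closure \<Omega>" using ran periodic_rem_bounds[OF L] by (auto simp: \<gamma>_def)
    fix t s assume ts: "t \<in> {0..<2 * pi}" "s \<in> {0..<2 * pi}" "t \<noteq> s" "\<gamma> t = \<gamma> s"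
    have "parallel (u (c * t)) (u (c * s))"
      using par[of "c * t" "c * s"] ts rem[OF ts(1)] rem[OF ts(2)] c by (simp add: \<gamma>_def)
    then show "parallel (vector_derivative \<gamma> (at t)) (vector_derivative \<gamma> (at s))"
      unfolding vd v_def rem(1)[OF ts(1)] rem(1)[OF ts(2)] parallel_def by (auto simp: mult.commute)
  qed
  moreover have "bending_energy \<gamma> \<le> integral {0..2 * pi} (\<lambda>t. (norm (b t))\<^sup>2 / norm (v t) ^ 3)"
    by (rule h2_data_unit_speed[OF h]) linarith
  moreover have "integral {0..2 * pi} (\<lambda>t. (norm (b t))\<^sup>2 / norm (v t) ^ 3)
      = integral {0..L} (\<lambda>s. (norm (a (?r s)))\<^sup>2 / norm (u (?r s)) ^ 3)"
    using h2_data_rescale(2)[OF h0 c(1)] by (simp add: c b_def v_def)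
  moreover have "\<dots> = integral {0..L} (\<lambda>s. (norm (a s))\<^sup>2 / norm (u s) ^ 3)"
    by (rule integral_spike[of "{L}"]) (use periodic_rem_eq[OF L, of 0] in auto)
  ultimately show thesis using that by simp
qed

section \<open>Integrals over a period and the modulus of continuity of the tangent\<close>

lemma integrable_translate:
  fixes f :: "real \<Rightarrow> real"
  assumes "f absolutely_integrable_on {x + c..y + c}"
  shows "(\<lambda>t. f (t + c)) absolutely_integrable_on {x..y}"
    and "integral {x..y} (\<lambda>t. f (t + c)) = integral {x + c..y + c} f"
proof -
  have "(\<lambda>t. f (t + c)) absolutely_integrable_on {x..y} \<and> integral {x..y} (\<lambda>t. f (t + c)) = integral {x + c..y + c} f"
  proof (cases "x \<le> y")
    case True
    have der: "((\<lambda>t. t + c) has_real_derivative 1) (at t within S)" for t S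
      by (auto intro!: derivative_eq_intros)
    show ?thesis
      using integral_substitution_increasing[where \<phi>="\<lambda>t. t + c" and \<phi>'="\<lambda>_. 1" and x=x and y=y and F=f, OF _ True _ der] assms True
      by (simp add: inj_on_def)
  next
    case False
    then show ?thesis by simp
  qed
  then show "(\<lambda>t. f (t + c)) absolutely_integrable_on {x..y}"
    "integral {x..y} (\<lambda>t. f (t + c)) = integral {x + c..y + c} f" by auto
qed

lemma integral_over_period:
  fixes f :: "real \<Rightarrow> real"
  assumes per: "\<And>s. f (s + L) = f s" and L: "L > 0" and int: "\<And>x y. f absolutely_integrable_on {x..y}"
  shows "integral {x..x + L} f = integral {0..L} f"
proof -
  have step: "integral {x..y} f = integral {x + L..y + L} f" for x y
    using integrable_translate(2)[OF int, of x y L] by (simp add: per)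
  have iint: "f integrable_on {x..y}" for x y
    using int by (rule set_lebesgue_integral_eq_integral(1))
  have cell: "integral {x + real n * L..y + real n * L} f = integral {x..y} f" for x y n
  proof (induction n)
    case (Suc n)
    then show ?case using step[of "x + real n * L" "y + real n * L"] by (simp add: algebra_simps)
  qed simp
  have pos: "integral {x..x + L} f = integral {0..L} f" if x: "0 \<le> x" for x
  proof -
    have "integral {0..L} f + integral {L..x + L} f = integral {0..x + L} f"
      using L x by (intro Henstock_Kurzweil_Integration.integral_combine iint) auto
    moreover have "integral {0..x} f + integral {x..x + L} f = integral {0..x + L} f"
      using L x by (intro Henstock_Kurzweil_Integration.integral_combine iint) auto
    ultimately show ?thesis using step[of 0 x] by simp
  qed
  obtain n :: nat where n: "- x / L \<le> real n" by (meson real_arch_simple)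
  then have "0 \<le> x + real n * L" using L by (simp add: field_simps)
  from pos[OF this] cell[of x n "x + L"] show ?thesis by (simp add: algebra_simps)
qed

lemma h2_data_square_integrable:
  assumes h: "h2_data L g u a"
  shows "(\<lambda>s. (norm (a s))\<^sup>2) absolutely_integrable_on {x..y}"
proof -
  let ?f = "\<lambda>s. (norm (a s))\<^sup>2"
  have L: "L > 0" using h by (rule h2_data_pos)
  have per: "?f (s + L) = ?f s" for s by (simp add: h2_data_periodic''[OF h])
  have "?f absolutely_integrable_on {0..L}"
    using h2_data_integrable[OF h] by (intro nonnegative_absolutely_integrable_1) auto
  \<comment> \<open>Subtracting the mean gives the primitive equal values at \<open>0\<close> and
    \<open>L\<close>, as \<open>has_density_periodic\<close> demands; the mean is added back
    below.\<close>
  then have "has_density 0 L (\<lambda>t. integral {0..t} ?f - t / L * integral {0..L} ?f) (\<lambda>t. ?f t - 1 / L * integral {0..L} ?f)"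
  proof (intro has_densityI)
    assume i: "?f absolutely_integrable_on {0..L}"
    then show "(\<lambda>t. ?f t - 1 / L * integral {0..L} ?f) absolutely_integrable_on {0..L}"
      by (intro set_integral_diff absolutely_integrable_on_const) auto
    fix t assume t: "0 \<le> t" "t \<le> L"
    have "?f integrable_on {0..t}"
      by (rule integrable_on_subinterval[OF set_lebesgue_integral_eq_integral(1)[OF i]]) (use t in auto)
    then have "integral {0..t} (\<lambda>t. ?f t - 1 / L * integral {0..L} ?f) = integral {0..t} ?f - integral {0..t} (\<lambda>_. 1 / L * integral {0..L} ?f)"
      by (intro Henstock_Kurzweil_Integration.integral_diff) auto
    then show "integral {0..t} ?f - t / L * integral {0..L} ?f - (integral {0..0} ?f - 0 / L * integral {0..L} ?f) =
      integral {0..t} (\<lambda>t. ?f t - 1 / L * integral {0..L} ?f)"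
      using t by simp
  qed
  from has_density_periodic[OF this L]
  have "has_density x y (\<lambda>s. integral {0..periodic_rem L s} ?f - periodic_rem L s / L * integral {0..L} ?f)
      (\<lambda>s. ?f (periodic_rem L s) - 1 / L * integral {0..L} ?f)"
    using L by simp
  from has_density_abs_int[OF this]
  have "(\<lambda>s. (?f (periodic_rem L s) - 1 / L * integral {0..L} ?f) + 1 / L * integral {0..L} ?f) absolutely_integrable_on {x..y}"
    by (intro set_integral_add absolutely_integrable_on_const) auto
  moreover have "?f (periodic_rem L s) = ?f s" for s
    by (rule periodic_rem_periodic) (rule per)
  ultimately show ?thesis by simp
qed

text \<open>By Cauchy-Schwarz the increment of \<open>u\<close> is at most the square root of the
  length times the energy on the interval. An interval no longer than \<open>L\<close> carries at
  most the energy of one period.\<close>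

lemma h2_data_holder:
  assumes h: "h2_data L g u a" and E: "integral {0..L} (\<lambda>s. (norm (a s))\<^sup>2) \<le> E" and xy: "\<bar>x - y\<bar> \<le> L"
  shows "(norm (u x - u y))\<^sup>2 \<le> E * \<bar>x - y\<bar>"
proof -
  let ?f = "\<lambda>s. (norm (a s))\<^sup>2"
  have L: "L > 0" using h by (rule h2_data_pos)
  have main: "(norm (u y - u x))\<^sup>2 \<le> E * (y - x)" if xy: "x < y" "y \<le> x + L" for x y
  proof -
    define A where "A = integral {x..y} (\<lambda>s. norm (a s))"
    have i1: "(\<lambda>s. norm (a s)) integrable_on {x..y}"
      using has_density_abs_int[OF h2_data_density[OF h]] by (simp add: absolutely_integrable_on_def)
    have i2: "?f integrable_on {p..q}" for p q
      using h2_data_square_integrable[OF h] by (rule set_lebesgue_integral_eq_integral(1))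
    have "norm (u y - u x) \<le> A"
      unfolding A_def by (rule has_density_norm_diff[OF h2_data_density[OF h, of x y]]) (use xy in auto)
    then have 1: "(norm (u y - u x))\<^sup>2 \<le> A\<^sup>2" by (rule power_mono) simp
    \<comment> \<open>With \<open>c\<close> the mean of \<open>|a|\<close>, the integral of the
      nonnegative function \<open>(|a| - c)^2\<close> is the Cauchy-Schwarz inequality.\<close>
    define c where "c = A / (y - x)"
    have hi: "((\<lambda>s. ?f s - 2 * c * norm (a s) + c\<^sup>2) has_integral integral {x..y} ?f - 2 * c * A + (y - x) * c\<^sup>2) {x..y}"
      using has_integral_const_real[of "c\<^sup>2" x y] xy unfolding A_def
      by (intro has_integral_add has_integral_diff has_integral_mult_right integrable_integral i1 i2) auto
    have "0 \<le> integral {x..y} ?f - 2 * c * A + (y - x) * c\<^sup>2"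
    proof (rule has_integral_nonneg[OF hi])
      fix s
      have "0 \<le> (norm (a s) - c)\<^sup>2" by simp
      then show "0 \<le> ?f s - 2 * c * norm (a s) + c\<^sup>2" by (simp add: power2_diff algebra_simps)
    qed
    also have "\<dots> = integral {x..y} ?f - A\<^sup>2 / (y - x)"
    proof -
      have "(y - x) * c = A" using xy by (simp add: c_def)
      then have "(y - x) * c\<^sup>2 = A * c" by (simp add: power2_eq_square mult.assoc[symmetric])
      moreover have "A * c = A\<^sup>2 / (y - x)" by (simp add: c_def power2_eq_square)
      ultimately show ?thesis by (simp add: mult.commute mult.left_commute)
    qed
    finally have "A\<^sup>2 \<le> integral {x..y} ?f * (y - x)" using xy by (simp add: field_simps)
    also have "\<dots> \<le> E * (y - x)"
    proof (intro mult_right_mono)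
      have "integral {x..y} ?f \<le> integral {x..x + L} ?f"
        by (rule integral_subset_le) (use xy i2 in auto)
      also have "\<dots> = integral {0..L} ?f"
        by (rule integral_over_period[OF _ L h2_data_square_integrable[OF h]]) (simp add: h2_data_periodic''[OF h])
      finally show "integral {x..y} ?f \<le> E" using E by simp
    qed (use xy in simp)
    finally show ?thesis using 1 by simp
  qed
  consider "x < y" | "x = y" | "y < x" by linarith
  then show ?thesis
  proof cases
    case 1
    then show ?thesis using main[of x y] xy by (simp add: norm_minus_commute)
  next
    case 3
    then show ?thesis using main[of y x] xy by simp
  qed simp
qed

lemma minimal_curve_unit_speed:
  assumes \<gamma>: "minimal_curve \<Omega> \<gamma>"
    and inj: "\<And>t s. t \<in> {0..<2 * pi} \<Longrightarrow> s \<in> {0..<2 * pi} \<Longrightarrow> t \<noteq> s \<Longrightarrow> \<gamma> t \<noteq> \<gamma> s"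
  obtains L g T a where "h2_data L g T a" "\<And>s. norm (T s) = 1" "range g \<subseteq> closure \<Omega>" "inj_on g {0..<L}"
    "\<And>\<gamma>'. \<gamma>' \<in> admissible_curves \<Omega> \<Longrightarrow> integral {0..L} (\<lambda>s. (norm (a s))\<^sup>2) \<le> bending_energy \<gamma>'"
proof -
  have reg: "regular_curve \<gamma>" and ran: "range \<gamma> \<subseteq> closure \<Omega>"
    and min: "\<And>\<gamma>'. \<gamma>' \<in> admissible_curves \<Omega> \<Longrightarrow> bending_energy \<gamma> \<le> bending_energy \<gamma>'"
    using \<gamma> by (auto simp: minimal_curve_def admissible_curves_def)
  obtain a0 where h0: "h2_data (2 * pi) \<gamma> (\<lambda>t. vector_derivative \<gamma> (at t)) a0"
    using regular_curve_imp_h2_data[OF reg] .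
  obtain L g T a \<sigma> where h: "h2_data L g T a" "\<And>s. norm (T s) = 1" "\<And>t. \<gamma> t = g (\<sigma> t)"
    "strict_mono \<sigma>" "surj \<sigma>" "\<And>t. \<sigma> (t + 2 * pi) = \<sigma> t + L" "\<sigma> 0 = 0"
    "bending_energy \<gamma> = integral {0..L} (\<lambda>s. (norm (a s))\<^sup>2)"
    by (rule h2_data_unit_speed[OF h0]) (rule that; assumption)
  have "range g \<subseteq> closure \<Omega>"
  proof (rule image_subsetI)
    fix s
    obtain t where "s = \<sigma> t" using h(5) by (auto simp: surj_def)
    then have "g s = \<gamma> t" by (simp add: h(3))
    then show "g s \<in> closure \<Omega>" using ran by auto
  qed
  moreover have "inj_on g {0..<L}"
  proof (rule inj_onI)
    fix x y assume xy: "x \<in> {0..<L}" "y \<in> {0..<L}" "g x = g y"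
    obtain t s where ts: "x = \<sigma> t" "y = \<sigma> s" using h(5) by (metis surjD)
    have L: "\<sigma> (2 * pi) = L" using h(6)[of 0] h(7) by simp
    have "t \<in> {0..<2 * pi}" "s \<in> {0..<2 * pi}"
      using xy(1,2) strict_mono_less_eq[OF h(4), of 0] strict_mono_less[OF h(4), of _ "2 * pi"]
      unfolding ts L h(7) by auto
    moreover have "\<gamma> t = \<gamma> s" using xy(3) by (simp add: ts h(3))
    ultimately have "t = s" using inj[of t s] by blast
    then show "x = y" by (simp add: ts)
  qed
  ultimately show thesis using that[of L g T a] h min by simp
qed

section \<open>Geometry of the linked drops\<close>

text \<open>Both the height of the centre of the linking arc and the distance of the two cusps from
  the vertical axis.\<close>

definition arc_height :: real where "arc_height = (3 + sqrt 6) / 2"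
definition arc_radius :: real where "arc_radius = sqrt 2 * arc_height"
definition arc_centre :: complex where "arc_centre = Complex 0 arc_height"

lemma sqrt_bounds:
  "2449 / 1000 < sqrt 6" "sqrt 6 < 245 / 100" "1414 / 1000 < sqrt 2" "sqrt 2 < 1415 / 1000"
  "1732 / 1000 < sqrt 3" "sqrt 3 < 1733 / 1000"
  by ((rule real_less_rsqrt real_less_lsqrt; simp add: power2_eq_square)+)

lemma arc_height_bounds: "2724 / 1000 < arc_height" "arc_height < 2725 / 1000"
  using sqrt_bounds by (auto simp: arc_height_def)

lemma arc_radius_bounds: "385 / 100 < arc_radius" "arc_radius < 386 / 100"
proof -
  have "1414 / 1000 * (2724 / 1000) < sqrt 2 * arc_height"
    by (rule mult_strict_mono) (use sqrt_bounds arc_height_bounds in auto)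
  then show "385 / 100 < arc_radius" by (simp add: arc_radius_def)
  have "sqrt 2 * arc_height < 1415 / 1000 * (2725 / 1000)"
    by (rule mult_strict_mono) (use sqrt_bounds arc_height_bounds in auto)
  then show "arc_radius < 386 / 100" by (simp add: arc_radius_def)
qed

lemma circle_arc_eq:
  "circle_arc z r a b = (\<lambda>\<theta>. z + of_real r * cis \<theta>) ` closed_segment (deg a) (deg b)"
  by (simp add: circle_arc_def path_image_part_circlepath' cis_conv_exp)

lemma circle_arcE:
  assumes "q \<in> circle_arc z r a b"
  obtains \<theta> where "q = z + of_real r * cis \<theta>" "min (deg a) (deg b) \<le> \<theta>" "\<theta> \<le> max (deg a) (deg b)"
proof -
  obtain \<theta> where "q = z + of_real r * cis \<theta>" "\<theta> \<in> closed_segment (deg a) (deg b)"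
    using assms unfolding circle_arc_eq by blast
  then show thesis using that[of \<theta>] by (auto simp: closed_segment_eq_real_ivl split: if_splits)
qed

text \<open>Measured from the top, the polar angle runs through
  \<open>{- 3 * pi / 4..3 * pi / 4}\<close>, which means that its cosine is at least
  \<open>- sqrt 2 / 2\<close>. As \<open>arc_height = arc_radius * (sqrt 2 / 2)\<close>, this is the
  condition \<open>Im q \<ge> 0\<close>.\<close>

lemma linking_arc_eq: "linking_arc = {q. norm (q - arc_centre) = arc_radius \<and> Im q \<ge> 0}"
proof (intro equalityI subsetI)
  have c34: "cos (3 * pi / 4) = - sqrt 2 / 2"
    using cos_add[of "pi / 2" "pi / 4"] by (simp add: sin_45)
  have deg: "deg 225 = 5 * pi / 4" "deg (- 45) = - pi / 4" by (simp_all add: deg_def)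
  have R: "arc_radius > 0" using arc_radius_bounds by simp
  have hR: "arc_height = arc_radius * (sqrt 2 / 2)"
    by (simp add: arc_radius_def)
  {
    fix q assume "q \<in> linking_arc"
    then obtain \<theta> where \<theta>: "q = Complex 0 arc_height + of_real arc_radius * cis \<theta>" "- pi / 4 \<le> \<theta>" "\<theta> \<le> 5 * pi / 4"
      unfolding linking_arc_def arc_height_def[symmetric] arc_radius_def[symmetric]
      by (elim circle_arcE) (auto simp: deg)
    have "\<bar>\<theta> - pi / 2\<bar> \<le> 3 * pi / 4" unfolding abs_le_iff using \<theta> by linarith
    then have "cos (3 * pi / 4) \<le> cos \<bar>\<theta> - pi / 2\<bar>"
      by (intro cos_monotone_0_pi_le) auto
    then have "- sqrt 2 / 2 \<le> sin \<theta>"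
      by (simp add: c34 cos_diff)
    then have "arc_radius * (- sqrt 2 / 2) \<le> arc_radius * sin \<theta>"
      using R by (intro mult_left_mono) auto
    then have "0 \<le> Im q" using \<theta>(1) hR by simp
    then show "q \<in> {q. norm (q - arc_centre) = arc_radius \<and> Im q \<ge> 0}"
      using \<theta>(1) R by (simp add: arc_centre_def norm_mult)
  next
    fix q assume "q \<in> {q. norm (q - arc_centre) = arc_radius \<and> Im q \<ge> 0}"
    then have q: "norm (q - arc_centre) = arc_radius" "Im q \<ge> 0" by auto
    define v where "v = (q - arc_centre) / (of_real arc_radius * \<i>)"
    have v: "norm v = 1" using q R by (simp add: v_def norm_divide norm_mult)
    then have "v \<noteq> 0" by auto
    define \<alpha> where "\<alpha> = Arg v"
    have va: "v = cis \<alpha>" using cis_Arg[OF \<open>v \<noteq> 0\<close>] v by (simp add: \<alpha>_def sgn_div_norm)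
    have ab: "- pi < \<alpha>" "\<alpha> \<le> pi" using mpi_less_Arg[of v] Arg_le_pi[of v] by (auto simp: \<alpha>_def)
    have qv: "q = arc_centre + of_real arc_radius * (\<i> * v)"
      using R by (simp add: v_def)
    have "Im q = arc_height + arc_radius * cos \<alpha>"
      by (simp add: qv va arc_centre_def)
    then have "arc_radius * (- sqrt 2 / 2) \<le> arc_radius * cos \<alpha>"
      using q(2) hR by simp
    then have "- sqrt 2 / 2 \<le> cos \<alpha>" using R mult_le_cancel_left_pos by blast
    then have "cos (3 * pi / 4) \<le> cos \<bar>\<alpha>\<bar>" unfolding c34 by simp
    then have "\<bar>\<alpha>\<bar> \<le> 3 * pi / 4"
      using ab by (subst (asm) cos_mono_le_eq) (auto simp: abs_le_iff)
    then have "- pi / 4 \<le> \<alpha> + pi / 2" "\<alpha> + pi / 2 \<le> 5 * pi / 4" by linarith+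
    moreover have "\<not> 5 * pi / 4 \<le> - pi / 4" using pi_gt_zero by linarith
    ultimately have "\<alpha> + pi / 2 \<in> closed_segment (deg 225) (deg (- 45))"
      unfolding deg closed_segment_eq_real_ivl by simp
    moreover have "q = Complex 0 arc_height + of_real arc_radius * cis (\<alpha> + pi / 2)"
      unfolding qv va arc_centre_def by (simp add: cis_mult[symmetric] mult.commute)
    ultimately show "q \<in> linking_arc"
      unfolding linking_arc_def arc_height_def[symmetric] arc_radius_def[symmetric] circle_arc_eq by blast
  }
qed

text \<open>
  Coordinates centred at the drop, with the real axis pointing from the drop to its cusp \<open>sqrt 3\<close>:
  there the three arcs lie on the unit circles centred at \<open>sqrt 3 - \<i>\<close>, \<open>0\<close> and \<open>sqrt 3 + \<i>\<close>.
\<close>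

definition drop_frame :: "complex \<Rightarrow> complex" where
  "drop_frame q = (q - drop_centre) * cis (- (3 * pi / 4))"

lemma cis_m34: "cis (- (3 * pi / 4)) = Complex (- sqrt 2 / 2) (- sqrt 2 / 2)"
proof -
  have "cos (3 * pi / 4) = - sqrt 2 / 2" "sin (3 * pi / 4) = sqrt 2 / 2"
    using cos_add[of "pi / 2" "pi / 4"] sin_add[of "pi / 2" "pi / 4"] by (simp_all add: sin_45 cos_45)
  then show ?thesis by (simp add: complex_eq_iff)
qed

lemma Re_drop_frame: "Re (drop_frame q) = (sqrt 2 / 2) * (Im q - Re q + sqrt 6 / 2 - 3 / 2)"
  and Im_drop_frame: "Im (drop_frame q) = (sqrt 2 / 2) * (- Im q - Re q - sqrt 6 / 2 - 3 / 2)"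
  unfolding drop_frame_def cis_m34 by (simp_all add: drop_centre_def algebra_simps)

lemma sqrt2_half_sq: "(sqrt 2 / 2) * ((sqrt 2 / 2) * x) = x / (2 :: real)"
  by (simp add: power2_eq_square[symmetric] mult.assoc[symmetric] power_divide)

lemma Re_of_drop_frame: "Re q = - 3 / 2 - (sqrt 2 / 2) * (Re (drop_frame q) + Im (drop_frame q))"
  and Im_of_drop_frame: "Im q = - sqrt 6 / 2 + (sqrt 2 / 2) * (Re (drop_frame q) - Im (drop_frame q))"
proof -
  have "(sqrt 2 / 2) * (Re (drop_frame q) + Im (drop_frame q)) = - Re q - 3 / 2"
    unfolding Re_drop_frame Im_drop_frame distrib_left[symmetric] sqrt2_half_sq by simp
  then show "Re q = - 3 / 2 - (sqrt 2 / 2) * (Re (drop_frame q) + Im (drop_frame q))" by linarith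
  have "(sqrt 2 / 2) * (Re (drop_frame q) - Im (drop_frame q)) = Im q + sqrt 6 / 2"
    unfolding Re_drop_frame Im_drop_frame right_diff_distrib[symmetric] sqrt2_half_sq by simp
  then show "Im q = - sqrt 6 / 2 + (sqrt 2 / 2) * (Re (drop_frame q) - Im (drop_frame q))" by linarith
qed

lemma drop_frame_diff: "drop_frame p - drop_frame q = (p - q) * cis (- (3 * pi / 4))"
  by (simp add: drop_frame_def algebra_simps)

lemma norm_drop_frame_diff: "norm (drop_frame p - drop_frame q) = norm (p - q)"
  by (simp add: drop_frame_diff norm_mult)

text \<open>In the coordinates of the drop, the arcs described by \<open>arc_A\<close> and
  \<open>arc_C\<close> run from the cusp \<open>sqrt 3\<close> to the points of abscissa
  \<open>sqrt 3 / 2\<close> on the unit circle, where \<open>arc_B\<close> takes over. The bounds on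
  both coordinates keep the first two away from their vertical tangents.\<close>

definition arc_A :: "complex \<Rightarrow> bool" where
  "arc_A \<zeta> \<longleftrightarrow> (Re \<zeta> - sqrt 3)\<^sup>2 + (Im \<zeta> + 1)\<^sup>2 = 1 \<and> - sqrt 3 / 2 \<le> Re \<zeta> - sqrt 3 \<and> Re \<zeta> \<le> sqrt 3 \<and>
     1 / 2 \<le> Im \<zeta> + 1 \<and> Im \<zeta> \<le> 0"

definition arc_B :: "complex \<Rightarrow> bool" where
  "arc_B \<zeta> \<longleftrightarrow> (Re \<zeta>)\<^sup>2 + (Im \<zeta>)\<^sup>2 = 1 \<and> Re \<zeta> \<le> sqrt 3 / 2"

definition arc_C :: "complex \<Rightarrow> bool" where
  "arc_C \<zeta> \<longleftrightarrow> (Re \<zeta> - sqrt 3)\<^sup>2 + (Im \<zeta> - 1)\<^sup>2 = 1 \<and> - sqrt 3 / 2 \<le> Re \<zeta> - sqrt 3 \<and> Re \<zeta> \<le> sqrt 3 \<and>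
     Im \<zeta> - 1 \<le> - 1 / 2 \<and> 0 \<le> Im \<zeta>"

lemma cis_frame_sum:
  assumes "q = drop_centre + 2 * cis \<beta> + cis \<theta>"
  shows "drop_frame q = 2 * cis (\<beta> - 3 * pi / 4) + cis (\<theta> - 3 * pi / 4)"
  using assms by (simp add: drop_frame_def distrib_right cis_mult mult.assoc)

lemma left_drop_eq:
  "left_drop = circle_arc (drop_centre + 2 * cis (7 * pi / 12)) 1 225 285 \<union> circle_arc drop_centre 1 105 (- 195) \<union>
     circle_arc (drop_centre + 2 * cis (11 * pi / 12)) 1 (- 15) 45"
proof -
  have *: "7 * pi / 12 = pi - deg 75" "11 * pi / 12 = pi - deg 15" by (simp_all add: deg_def field_simps)
  have "Complex (- cos (deg 75)) (sin (deg 75)) = cis (7 * pi / 12)"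
    "Complex (- cos (deg 15)) (sin (deg 15)) = cis (11 * pi / 12)"
    unfolding * by (simp_all add: complex_eq_iff)
  then show ?thesis by (simp add: left_drop_def)
qed

lemma drop_arc_A:
  assumes "q \<in> circle_arc (drop_centre + 2 * cis (7 * pi / 12)) 1 225 285"
  shows "arc_A (drop_frame q)"
proof -
  have c30: "cos (pi / 6) = sqrt 3 / 2" "sin (pi / 6) = 1 / 2" by (simp_all add: cos_30 sin_30)
  obtain \<theta> where \<theta>: "q = drop_centre + 2 * cis (7 * pi / 12) + cis \<theta>" "deg 225 \<le> \<theta>" "\<theta> \<le> deg 285"
    using assms by (elim circle_arcE) (auto simp: deg_def)
  \<comment> \<open>The angle traversed from the cusp, where \<theta> is 225 degrees.\<close>
  define \<alpha> where "\<alpha> = \<theta> - 3 * pi / 4 - pi / 2"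
  have \<alpha>: "0 \<le> \<alpha>" "\<alpha> \<le> pi / 3" using \<theta> by (auto simp: \<alpha>_def deg_def)
  have "7 * pi / 12 - 3 * pi / 4 = - (pi / 6)" "\<theta> - 3 * pi / 4 = \<alpha> + pi / 2" by (simp_all add: \<alpha>_def)
  then have f: "drop_frame q = 2 * cis (- (pi / 6)) + cis (\<alpha> + pi / 2)"
    using cis_frame_sum[OF \<theta>(1)] by simp
  have re: "Re (drop_frame q) - sqrt 3 = - sin \<alpha>" and im: "Im (drop_frame q) + 1 = cos \<alpha>"
    by (simp_all add: f c30 cos_add sin_add)
  have s: "0 \<le> sin \<alpha>" "sin \<alpha> \<le> sin (pi / 3)"
    using \<alpha> by (auto intro!: sin_ge_zero sin_monotone_2pi_le)
  have c: "cos (pi / 3) \<le> cos \<alpha>" using \<alpha> by (intro cos_monotone_0_pi_le) auto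
  have "Im (drop_frame q) \<le> 0" using im cos_le_one[of \<alpha>] by linarith
  then show ?thesis
    unfolding arc_A_def re im using s c im re by (simp add: sin_60 cos_60)
qed

lemma drop_arc_B:
  assumes "q \<in> circle_arc drop_centre 1 105 (- 195)"
  shows "arc_B (drop_frame q)"
proof -
  obtain \<theta> where \<theta>: "q = drop_centre + cis \<theta>" "deg (- 195) \<le> \<theta>" "\<theta> \<le> deg 105"
    using assms by (elim circle_arcE) (auto simp: deg_def)
  have f: "drop_frame q = cis (\<theta> - 3 * pi / 4)"
    using \<theta>(1) by (simp add: drop_frame_def cis_mult)
  \<comment> \<open>Measured from the point opposite to the cusp, so that the arc becomes symmetric:
    150 degrees to either side.\<close>
  define \<alpha> where "\<alpha> = \<theta> - 3 * pi / 4 + pi"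
  have \<alpha>: "- (5 * pi / 6) \<le> \<alpha>" "\<alpha> \<le> 5 * pi / 6" using \<theta> by (auto simp: \<alpha>_def deg_def field_simps)
  have "cos (5 * pi / 6) \<le> cos \<bar>\<alpha>\<bar>"
    by (rule cos_monotone_0_pi_le) (use \<alpha> in \<open>auto simp: abs_le_iff\<close>)
  moreover have "cos (5 * pi / 6) = - (sqrt 3 / 2)"
  proof -
    have *: "5 * pi / 6 = pi - pi / 6" by simp
    show ?thesis unfolding * cos_pi_minus cos_30 ..
  qed
  moreover have "cos \<alpha> = - Re (drop_frame q)" by (simp only: f \<alpha>_def cos_periodic_pi cis.sel)
  ultimately have "Re (drop_frame q) \<le> sqrt 3 / 2" by simp
  then show ?thesis by (simp add: arc_B_def f)
qed

lemma drop_arc_C: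
  assumes "q \<in> circle_arc (drop_centre + 2 * cis (11 * pi / 12)) 1 (- 15) 45"
  shows "arc_C (drop_frame q)"
proof -
  have c30: "cos (pi / 6) = sqrt 3 / 2" "sin (pi / 6) = 1 / 2" by (simp_all add: cos_30 sin_30)
  have "deg (- 15) \<le> deg 45" unfolding deg_def using pi_gt_zero by linarith
  then obtain \<theta> where \<theta>: "q = drop_centre + 2 * cis (11 * pi / 12) + cis \<theta>" "deg (- 15) \<le> \<theta>" "\<theta> \<le> deg 45"
    using assms by (elim circle_arcE) (auto simp: min_def max_def)
  define \<alpha> where "\<alpha> = pi / 4 - \<theta>"
  have \<alpha>: "0 \<le> \<alpha>" "\<alpha> \<le> pi / 3" using \<theta> by (auto simp: \<alpha>_def deg_def)
  have "11 * pi / 12 - 3 * pi / 4 = pi / 6" "\<theta> - 3 * pi / 4 = - (\<alpha> + pi / 2)" by (simp_all add: \<alpha>_def)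
  then have f: "drop_frame q = 2 * cis (pi / 6) + cis (- (\<alpha> + pi / 2))"
    using cis_frame_sum[OF \<theta>(1)] by simp
  have re: "Re (drop_frame q) - sqrt 3 = - sin \<alpha>" and im: "Im (drop_frame q) - 1 = - cos \<alpha>"
    by (simp_all add: f c30 cos_add sin_add del: minus_add_distrib)
  have s: "0 \<le> sin \<alpha>" "sin \<alpha> \<le> sin (pi / 3)"
    using \<alpha> by (auto intro!: sin_ge_zero sin_monotone_2pi_le)
  have c: "cos (pi / 3) \<le> cos \<alpha>" using \<alpha> by (intro cos_monotone_0_pi_le) auto
  have "0 \<le> Im (drop_frame q)" using im cos_le_one[of \<alpha>] by linarith
  then show ?thesis
    unfolding arc_C_def re im using s c im re by (simp add: sin_60 cos_60)
qed

lemma left_drop_cases: "q \<in> left_drop \<Longrightarrow> arc_A (drop_frame q) \<or> arc_B (drop_frame q) \<or> arc_C (drop_frame q)"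
  unfolding left_drop_eq using drop_arc_A drop_arc_B drop_arc_C by blast

text \<open>In the rotated coordinates the claims read \<open>X - Y \<le> sqrt 3\<close> and
  \<open>X + Y \<ge> - sqrt 2\<close>. The delicate case is the first bound on \<open>arc_A\<close>,
  which is attained at the cusp: there \<open>a^2 + b^2 = 1\<close> with nonnegative
  \<open>a\<close> and \<open>b\<close> gives \<open>a + b \<ge> 1\<close>. The bounds separate the
  drops from the linking arc and from each other.\<close>

lemma left_drop_bounds:
  assumes "q \<in> left_drop"
  shows "Im q \<le> 0" "Re q \<le> - 1 / 2"
proof -
  define X Y where "X = Re (drop_frame q)" and "Y = Im (drop_frame q)"
  have cases: "arc_A (Complex X Y) \<or> arc_B (Complex X Y) \<or> arc_C (Complex X Y)"
    using left_drop_cases[OF assms] by (simp add: X_def Y_def)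
  have "X - Y \<le> sqrt 3 \<and> - sqrt 2 \<le> X + Y"
    using cases
  proof (elim disjE)
    assume "arc_A (Complex X Y)"
    then have A: "(X - sqrt 3)\<^sup>2 + (Y + 1)\<^sup>2 = 1" "- sqrt 3 / 2 \<le> X - sqrt 3" "X \<le> sqrt 3" "1 / 2 \<le> Y + 1" "Y \<le> 0"
      by (auto simp: arc_A_def)
    define a b where "a = sqrt 3 - X" and "b = Y + 1"
    have ab: "a\<^sup>2 + b\<^sup>2 = 1" "0 \<le> a" "1 / 2 \<le> b"
      using A by (auto simp: a_def b_def power2_commute)
    have "1\<^sup>2 \<le> (a + b)\<^sup>2" using ab mult_nonneg_nonneg[of a b] by (simp add: power2_sum)
    then have "1 \<le> a + b" by (rule power2_le_imp_le) (use ab in auto)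
    moreover have "- sqrt 2 \<le> X + Y" using A sqrt_bounds by linarith
    ultimately show ?thesis by (simp add: a_def b_def)
  next
    assume "arc_C (Complex X Y)"
    then have "X \<le> sqrt 3" "- sqrt 3 / 2 \<le> X - sqrt 3" "0 \<le> Y" by (auto simp: arc_C_def)
    then show ?thesis using sqrt_bounds by linarith
  next
    assume "arc_B (Complex X Y)"
    then have B: "X\<^sup>2 + Y\<^sup>2 = 1" by (simp add: arc_B_def)
    have "(X - Y)\<^sup>2 \<le> (sqrt 2)\<^sup>2" "(X + Y)\<^sup>2 \<le> (sqrt 2)\<^sup>2"
      using B zero_le_power2[of "X + Y"] zero_le_power2[of "X - Y"] by (auto simp: power2_sum power2_diff)
    then have "\<bar>X - Y\<bar> \<le> sqrt 2" "\<bar>X + Y\<bar> \<le> sqrt 2"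
      by (auto simp flip: abs_le_square_iff intro: abs_le_square_iff[THEN iffD2] power2_le_imp_le)
    then show ?thesis using sqrt_bounds by linarith
  qed
  then have 1: "(sqrt 2 / 2) * (X - Y) \<le> (sqrt 2 / 2) * sqrt 3" "(sqrt 2 / 2) * (- sqrt 2) \<le> (sqrt 2 / 2) * (X + Y)"
    by (intro mult_left_mono; simp)+
  have "sqrt 6 = sqrt 2 * sqrt 3" by (simp flip: real_sqrt_mult)
  then show "Im q \<le> 0" "Re q \<le> - 1 / 2"
    using 1 Im_of_drop_frame[of q] Re_of_drop_frame[of q] by (auto simp: X_def[symmetric] Y_def[symmetric])
qed

section \<open>Reflection in the vertical axis\<close>

definition mirror :: "complex \<Rightarrow> complex" where "mirror z = Complex (- Re z) (Im z)"

lemma mirror_simps [simp]: "Re (mirror z) = - Re z" "Im (mirror z) = Im z" "mirror (mirror z) = z"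
  by (auto simp: mirror_def)

lemma right_drop_eq: "right_drop = mirror ` left_drop"
  by (simp add: right_drop_def mirror_def)

lemma right_drop_bounds:
  assumes "q \<in> right_drop"
  shows "Im q \<le> 0" "Re q \<ge> 1 / 2"
proof -
  obtain p where "p \<in> left_drop" "q = mirror p" using assms by (auto simp: right_drop_eq)
  then show "Im q \<le> 0" "Re q \<ge> 1 / 2" using left_drop_bounds[of p] by auto
qed

lemma norm_mirror_diff: "norm (mirror p - mirror q) = norm (p - q)"
  by (simp add: cmod_def power2_commute)

lemma mirror_linked_drops: "q \<in> linked_drops \<Longrightarrow> mirror q \<in> linked_drops"
proof -
  have "mirror q \<in> linking_arc" if "q \<in> linking_arc"
  proof -
    have "mirror arc_centre = arc_centre" by (simp add: mirror_def arc_centre_def)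
    then show ?thesis using that norm_mirror_diff[of q arc_centre] by (simp add: linking_arc_eq)
  qed
  then show "q \<in> linked_drops \<Longrightarrow> mirror q \<in> linked_drops"
    by (auto simp: linked_drops_def right_drop_eq)
qed

text \<open>Subtracting the two circle equations gives
  \<open>(y - y') * (y + y') = - (x - x') * (x + x')\<close>, where
  \<open>|y + y'| \<ge> 2 * \<kappa>\<close> and \<open>|x + x'| \<le> 2 * r\<close>.\<close>

lemma circle_arc_lipschitz:
  fixes x y x' y' :: real
  assumes "x\<^sup>2 + y\<^sup>2 = r\<^sup>2" "x'\<^sup>2 + y'\<^sup>2 = r\<^sup>2" "r > 0" "\<kappa> > 0"
    and "\<kappa> \<le> y \<and> \<kappa> \<le> y' \<or> \<kappa> \<le> - y \<and> \<kappa> \<le> - y'"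
  shows "\<bar>y - y'\<bar> \<le> r / \<kappa> * \<bar>x - x'\<bar>"
proof -
  have x: "\<bar>x\<bar> \<le> r" "\<bar>x'\<bar> \<le> r"
  proof -
    have "x\<^sup>2 \<le> r\<^sup>2" "x'\<^sup>2 \<le> r\<^sup>2"
      using assms(1,2) zero_le_power2[of y] zero_le_power2[of y'] by linarith+
    then show "\<bar>x\<bar> \<le> r" "\<bar>x'\<bar> \<le> r"
      using assms(3) abs_le_square_iff[of x r] abs_le_square_iff[of x' r] by auto
  qed
  have "(y - y') * (y + y') = - ((x - x') * (x + x'))"
    using assms(1,2) by (simp add: power2_eq_square algebra_simps)
  then have "\<bar>y - y'\<bar> * \<bar>y + y'\<bar> = \<bar>x - x'\<bar> * \<bar>x + x'\<bar>"
    by (metis abs_minus_cancel abs_mult)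
  also have "\<dots> \<le> \<bar>x - x'\<bar> * (2 * r)"
    by (rule mult_left_mono) (use x in auto)
  finally have "\<bar>y - y'\<bar> * \<bar>y + y'\<bar> \<le> \<bar>x - x'\<bar> * (2 * r)" .
  moreover have "\<bar>y - y'\<bar> * (2 * \<kappa>) \<le> \<bar>y - y'\<bar> * \<bar>y + y'\<bar>"
    by (rule mult_left_mono) (use assms in auto)
  ultimately have "\<bar>y - y'\<bar> * \<kappa> \<le> \<bar>x - x'\<bar> * r" by linarith
  then show ?thesis using assms by (simp add: field_simps)
qed

text \<open>The five labels are the linking arc, \<open>arc_A\<close>, \<open>arc_C\<close>, and the
  upper and lower half of \<open>arc_B\<close>. Each piece is a graph over the axis of the drop, and
  the slope is worst near abscissa \<open>- 1\<close>, where the unit circle becomes vertical; the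
  margin \<tau> bounds it by \<open>1 / sqrt \<tau>\<close>.\<close>

lemma lower_left_pieces:
  assumes \<tau>: "0 < \<tau>" "\<tau> \<le> 1 / 25"
  obtains pc :: "complex \<Rightarrow> nat" where
    "\<And>q. q \<in> linked_drops \<Longrightarrow> Re q \<le> 1 / 10 \<Longrightarrow> Im q \<le> 13 / 10 \<Longrightarrow> Re (drop_frame q) \<ge> - 1 + \<tau> \<Longrightarrow> pc q < 5"
    "\<And>q q'. q \<in> linked_drops \<Longrightarrow> Re q \<le> 1 / 10 \<Longrightarrow> Im q \<le> 13 / 10 \<Longrightarrow> Re (drop_frame q) \<ge> - 1 + \<tau> \<Longrightarrow>
       q' \<in> linked_drops \<Longrightarrow> Re q' \<le> 1 / 10 \<Longrightarrow> Im q' \<le> 13 / 10 \<Longrightarrow> Re (drop_frame q') \<ge> - 1 + \<tau> \<Longrightarrow>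
       pc q = pc q' \<Longrightarrow>
       \<bar>Im (drop_frame q) - Im (drop_frame q')\<bar> \<le> 1 / sqrt \<tau> * \<bar>Re (drop_frame q) - Re (drop_frame q')\<bar>"
proof -
  let ?S = "{q \<in> linked_drops. Re q \<le> 1 / 10 \<and> Im q \<le> 13 / 10 \<and> Re (drop_frame q) \<ge> - 1 + \<tau>}"
  define pc :: "complex \<Rightarrow> nat" where "pc q = (if q \<in> linking_arc then 0 else if arc_A (drop_frame q) then 1
     else if arc_C (drop_frame q) then 2 else if Im (drop_frame q) \<ge> 0 then 3 else 4)" for q
  have st: "sqrt \<tau> \<le> 1 / 5"
    using \<tau> by (intro real_le_lsqrt) (auto simp: power2_eq_square)
  have st0: "sqrt \<tau> > 0" using \<tau> by simp
  have five: "5 \<le> 1 / sqrt \<tau>" using st st0 by (simp add: field_simps)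
  have lip: "\<bar>Im (drop_frame q) - Im (drop_frame q')\<bar> \<le> 1 / sqrt \<tau> * \<bar>Re (drop_frame q) - Re (drop_frame q')\<bar>"
    if q: "q \<in> ?S" "q' \<in> ?S" "pc q = pc q'" for q q'
  proof -
    let ?X = "Re (drop_frame q)" and ?Y = "Im (drop_frame q)" and ?X' = "Re (drop_frame q')" and ?Y' = "Im (drop_frame q')"
    have weaken: ?thesis if "\<bar>?Y - ?Y'\<bar> \<le> K * \<bar>?X - ?X'\<bar>" "K \<le> 5" for K
    proof -
      have "K * \<bar>?X - ?X'\<bar> \<le> 1 / sqrt \<tau> * \<bar>?X - ?X'\<bar>"
        by (rule mult_right_mono) (use five that in auto)
      with that show ?thesis by linarith
    qed
    have left: "q \<in> left_drop" if "q \<in> ?S" "q \<notin> linking_arc" for q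
      using that right_drop_bounds(2)[of q] by (auto simp: linked_drops_def)
    show ?thesis
    proof (cases "q \<in> linking_arc")
      case True
      then have True': "q' \<in> linking_arc" using q(3) by (auto simp: pc_def split: if_splits)
      let ?Z = "drop_frame arc_centre"
      have *: "(Re (drop_frame q) - Re ?Z)\<^sup>2 + (Im (drop_frame q) - Im ?Z)\<^sup>2 = arc_radius\<^sup>2 \<and> arc_radius / 5 \<le> Im (drop_frame q) - Im ?Z"
        if "q \<in> linking_arc" "q \<in> ?S" for q
      proof
        have "norm (drop_frame q - ?Z) = arc_radius"
          using that unfolding norm_drop_frame_diff by (simp add: linking_arc_eq)
        then show "(Re (drop_frame q) - Re ?Z)\<^sup>2 + (Im (drop_frame q) - Im ?Z)\<^sup>2 = arc_radius\<^sup>2"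
          using cmod_power2[of "drop_frame q - ?Z"] by simp
        have "Im (drop_frame q) - Im ?Z = (sqrt 2 / 2) * (arc_height - Im q - Re q)"
          unfolding Im_drop_frame right_diff_distrib[symmetric] by (simp add: arc_centre_def)
        \<comment> \<open>The height bound \<open>13 / 10\<close> keeps the linking arc in the part
          where it is a graph over the axis: \<open>arc_height - Im q - Re q\<close> is at least
          \<open>2724 / 1000 - 13 / 10 - 1 / 10\<close>.\<close>
        moreover have "(707 / 1000) * (132 / 100) \<le> (sqrt 2 / 2) * (arc_height - Im q - Re q)"
          using that arc_height_bounds sqrt_bounds by (intro mult_mono) auto
        ultimately show "arc_radius / 5 \<le> Im (drop_frame q) - Im ?Z" using arc_radius_bounds by simp
      qed
      have "\<bar>(?Y - Im ?Z) - (?Y' - Im ?Z)\<bar> \<le> arc_radius / (arc_radius / 5) * \<bar>(?X - Re ?Z) - (?X' - Re ?Z)\<bar>"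
        by (rule circle_arc_lipschitz) (use *[OF True q(1)] *[OF True' q(2)] arc_radius_bounds in auto)
      then show ?thesis using arc_radius_bounds by (intro weaken[of 5]) auto
    next
      case False
      then have False': "q' \<notin> linking_arc" using q(3) by (auto simp: pc_def split: if_splits)
      note c = left_drop_cases[OF left[OF q(1) False]] left_drop_cases[OF left[OF q(2) False']]
      show ?thesis
      proof (cases "arc_A (drop_frame q)")
        case True
        then have "arc_A (drop_frame q')" using q(3) False False' by (auto simp: pc_def split: if_splits)
        with True have "\<bar>(?Y + 1) - (?Y' + 1)\<bar> \<le> 1 / (1 / 2) * \<bar>(?X - sqrt 3) - (?X' - sqrt 3)\<bar>"
          by (intro circle_arc_lipschitz) (auto simp: arc_A_def)
        then show ?thesis by (intro weaken[of 2]) auto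
      next
        case nA: False
        then have nA': "\<not> arc_A (drop_frame q')" using q(3) False False' by (auto simp: pc_def split: if_splits)
        show ?thesis
        proof (cases "arc_C (drop_frame q)")
          case True
          then have "arc_C (drop_frame q')" using q(3) False False' nA nA' by (auto simp: pc_def split: if_splits)
          with True have "\<bar>(?Y - 1) - (?Y' - 1)\<bar> \<le> 1 / (1 / 2) * \<bar>(?X - sqrt 3) - (?X' - sqrt 3)\<bar>"
            by (intro circle_arc_lipschitz) (auto simp: arc_C_def)
          then show ?thesis by (intro weaken[of 2]) auto
        next
          case nC: False
          then have nC': "\<not> arc_C (drop_frame q')" using q(3) False False' nA nA' by (auto simp: pc_def split: if_splits)
          have B: "arc_B (drop_frame q)" "arc_B (drop_frame q')" using c nA nA' nC nC' by auto
          \<comment> \<open>The unit circle is vertical over the abscissas \<open>- 1\<close> and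
            \<open>1\<close>. The margin \<tau> excludes the first, the bound
            \<open>sqrt 3 / 2\<close> the second.\<close>
          have Y: "sqrt \<tau> \<le> \<bar>Im (drop_frame q)\<bar>" if "arc_B (drop_frame q)" "q \<in> ?S" for q
          proof -
            let ?X = "Re (drop_frame q)"
            have X: "- 1 + \<tau> \<le> ?X" "?X \<le> sqrt 3 / 2" and XY: "(Im (drop_frame q))\<^sup>2 = (1 - ?X) * (1 + ?X)"
              using that by (auto simp: arc_B_def power2_eq_square algebra_simps)
            have "\<tau> \<le> (1 - ?X) * (1 + ?X)"
            proof (cases "?X \<le> 0")
              case True
              have "1 * \<tau> \<le> (1 - ?X) * (1 + ?X)" by (rule mult_mono) (use X True \<tau> in auto)
              then show ?thesis by simp
            next
              case False
              have "\<tau> \<le> (1 - sqrt 3 / 2) * 1" using \<tau> sqrt_bounds by simp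
              also have "\<dots> \<le> (1 - ?X) * (1 + ?X)" by (rule mult_mono) (use X False sqrt_bounds in auto)
              finally show ?thesis .
            qed
            then have "sqrt \<tau> \<le> sqrt ((Im (drop_frame q))\<^sup>2)" using XY by simp
            then show ?thesis by simp
          qed
          have "(?Y \<ge> 0) = (?Y' \<ge> 0)" using q(3) False False' nA nA' nC nC' by (auto simp: pc_def split: if_splits)
          then have "sqrt \<tau> \<le> ?Y \<and> sqrt \<tau> \<le> ?Y' \<or> sqrt \<tau> \<le> - ?Y \<and> sqrt \<tau> \<le> - ?Y'"
            using Y[OF B(1) q(1)] Y[OF B(2) q(2)] by (auto simp: abs_if split: if_splits)
          then show ?thesis
            using B st0 by (intro circle_arc_lipschitz[of ?X ?Y 1]) (auto simp: arc_B_def)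
        qed
      qed
    qed
  qed
  show thesis
    by (rule that[of pc]) (use lip in \<open>auto simp: pc_def\<close>)
qed

text \<open>So close to abscissa \<open>- 1\<close> only \<open>arc_B\<close> is present, and on the
  unit circle the squared ordinate is \<open>(1 - X) * (1 + X)\<close>.\<close>

lemma drop_bottom:
  assumes q: "q \<in> linked_drops" "Re q \<le> 1 / 10" and \<tau>: "Re (drop_frame q) \<le> - 1 + \<tau>" "\<tau> \<le> 1 / 2"
  shows "- 1 \<le> Re (drop_frame q)" "(Im (drop_frame q))\<^sup>2 \<le> 2 * \<tau>"
proof -
  let ?X = "Re (drop_frame q)"
  have "q \<notin> linking_arc"
  proof
    assume "q \<in> linking_arc"
    then have "Im q \<ge> 0" by (simp add: linking_arc_eq)
    then have "(sqrt 2 / 2) * (- 1 / 2) \<le> ?X"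
      unfolding Re_drop_frame using q(2) sqrt_bounds by (intro mult_left_mono) auto
    then show False using \<tau> sqrt_bounds by linarith
  qed
  then have "q \<in> left_drop" using q right_drop_bounds(2)[of q] by (auto simp: linked_drops_def)
  moreover have "\<not> arc_A (drop_frame q)" "\<not> arc_C (drop_frame q)"
    using \<tau> sqrt_bounds by (auto simp: arc_A_def arc_C_def)
  ultimately have B: "?X\<^sup>2 + (Im (drop_frame q))\<^sup>2 = 1" using left_drop_cases[of q] by (auto simp: arc_B_def)
  then have "?X\<^sup>2 \<le> 1" by (smt (verit) zero_le_power2)
  then have X: "- 1 \<le> ?X" "?X \<le> 1" by (auto simp: power2_le_iff_abs_le abs_le_square_iff[of _ 1, simplified, symmetric])
  then show "- 1 \<le> ?X" by simp
  have "(1 - ?X) * (1 + ?X) \<le> 2 * \<tau>" by (rule mult_mono) (use X \<tau> in auto)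
  then show "(Im (drop_frame q))\<^sup>2 \<le> 2 * \<tau>" using B by (simp add: power2_eq_square algebra_simps)
qed

section \<open>Curves of bounded energy near the linked drops\<close>

text \<open>What the geometric estimates use of a curve of energy at most \<open>E\<close>: unit
  speed, a modulus of continuity of the tangent up to distance \<open>1 / E\<close>, and closeness
  to the drops. The notion is invariant under reflection, so one drop represents both.\<close>

definition near_curve :: "real \<Rightarrow> real \<Rightarrow> real \<Rightarrow> (real \<Rightarrow> complex) \<Rightarrow> (real \<Rightarrow> complex) \<Rightarrow> bool" where
  "near_curve E \<epsilon> L g T \<longleftrightarrow> L > 0 \<and> (\<forall>s. (g has_vector_derivative T s) (at s)) \<and> (\<forall>s. norm (T s) = 1) \<and>
     (\<forall>s. g (s + L) = g s) \<and> (\<forall>s t. \<bar>s - t\<bar> \<le> 1 / E \<longrightarrow> norm (T s - T t) \<le> sqrt (E * \<bar>s - t\<bar>)) \<and>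
     (\<forall>s. \<exists>q\<in>linked_drops. norm (g s - q) \<le> \<epsilon>)"

lemma near_curve_pos: "near_curve E \<epsilon> L g T \<Longrightarrow> L > 0"
  and near_curve_deriv: "near_curve E \<epsilon> L g T \<Longrightarrow> (g has_vector_derivative T s) (at s)"
  and near_curve_norm: "near_curve E \<epsilon> L g T \<Longrightarrow> norm (T s) = 1"
  and near_curve_periodic: "near_curve E \<epsilon> L g T \<Longrightarrow> g (s + L) = g s"
  and near_curve_holder: "near_curve E \<epsilon> L g T \<Longrightarrow> \<bar>s - t\<bar> \<le> 1 / E \<Longrightarrow> norm (T s - T t) \<le> sqrt (E * \<bar>s - t\<bar>)"
  and near_curve_near: "near_curve E \<epsilon> L g T \<Longrightarrow> \<exists>q\<in>linked_drops. norm (g s - q) \<le> \<epsilon>"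
  by (auto simp: near_curve_def)

lemma near_curve_mirror:
  assumes "near_curve E \<epsilon> L g T"
  shows "near_curve E \<epsilon> L (\<lambda>s. mirror (g s)) (\<lambda>s. mirror (T s))"
  unfolding near_curve_def
proof (intro conjI allI impI)
  show "((\<lambda>s. mirror (g s)) has_vector_derivative mirror (T s)) (at s)" for s
  proof -
    have m: "mirror = (\<lambda>z. - cnj z)" by (auto simp: mirror_def complex_eq_iff)
    show ?thesis unfolding m
      by (intro derivative_intros has_vector_derivative_cnj near_curve_deriv[OF assms])
  qed
  show "norm (mirror (T s)) = 1" for s
    using near_curve_norm[OF assms, of s] norm_mirror_diff[of "T s" 0] by (simp add: mirror_def cmod_def)
  show "norm (mirror (T s) - mirror (T t)) \<le> sqrt (E * \<bar>s - t\<bar>)" if "\<bar>s - t\<bar> \<le> 1 / E" for s t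
    unfolding norm_mirror_diff by (rule near_curve_holder[OF assms that])
  show "\<exists>q\<in>linked_drops. norm (mirror (g s) - q) \<le> \<epsilon>" for s
  proof -
    obtain q where "q \<in> linked_drops" "norm (g s - q) \<le> \<epsilon>" using near_curve_near[OF assms] by blast
    then show ?thesis using mirror_linked_drops norm_mirror_diff by metis
  qed
qed (use near_curve_pos[OF assms] near_curve_periodic[OF assms] in auto)

lemma near_curve_lipschitz:
  assumes "near_curve E \<epsilon> L g T"
  shows "norm (g x - g y) \<le> \<bar>x - y\<bar>"
proof -
  have "norm (g x - g y) \<le> 1 * norm (x - y)"
  proof (rule differentiable_bound[where S=UNIV and f'="\<lambda>s h. h *\<^sub>R T s"])
    show "(g has_derivative (\<lambda>h. h *\<^sub>R T s)) (at s within UNIV)" for s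
      using near_curve_deriv[OF assms, of s] by (simp add: has_vector_derivative_def)
    show "onorm (\<lambda>h. h *\<^sub>R T s) \<le> 1" for s
      by (rule onorm_le) (simp add: near_curve_norm[OF assms])
  qed auto
  then show ?thesis by simp
qed

text \<open>The mean value inequality for \<open>g\<close> minus its linear part at
  \<open>s\<close>, whose derivative \<open>T t - T s\<close> the Hoelder condition
  controls.\<close>

lemma near_curve_taylor:
  assumes c: "near_curve E \<epsilon> L g T" and E: "E > 0" and h: "\<bar>h\<bar> \<le> 1 / E"
  shows "norm (g (s + h) - g s - h *\<^sub>R T s) \<le> \<bar>h\<bar> * sqrt (E * \<bar>h\<bar>)"
proof -
  let ?f = "\<lambda>t. g t - t *\<^sub>R T s"
  have "norm (?f (s + h) - ?f s) \<le> sqrt (E * \<bar>h\<bar>) * norm (s + h - s)"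
  proof (rule differentiable_bound[where S="closed_segment s (s + h)" and f'="\<lambda>t k. k *\<^sub>R (T t - T s)"])
    fix t assume t: "t \<in> closed_segment s (s + h)"
    have "(?f has_vector_derivative T t - T s) (at t)"
      using near_curve_deriv[OF c, of t] by (auto intro!: derivative_eq_intros)
    then show "(?f has_derivative (\<lambda>k. k *\<^sub>R (T t - T s))) (at t within closed_segment s (s + h))"
      by (simp add: has_vector_derivative_def has_derivative_at_withinI)
    have ts: "\<bar>t - s\<bar> \<le> \<bar>h\<bar>" using t by (auto simp: closed_segment_eq_real_ivl split: if_splits)
    have "norm (T t - T s) \<le> sqrt (E * \<bar>t - s\<bar>)"
      by (rule near_curve_holder[OF c]) (use ts h in linarith)
    also have "\<dots> \<le> sqrt (E * \<bar>h\<bar>)" using ts E by simp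
    finally show "onorm (\<lambda>k. k *\<^sub>R (T t - T s)) \<le> sqrt (E * \<bar>h\<bar>)"
      by (intro onorm_le) (simp add: mult.commute mult_left_mono)
  qed auto
  moreover have "?f (s + h) - ?f s = g (s + h) - g s - h *\<^sub>R T s" by (simp add: algebra_simps)
  ultimately show ?thesis by (simp add: mult.commute)
qed

lemma linking_arc_if:
  assumes "q \<in> linked_drops" "Im q > 0 \<or> \<bar>Re q\<bar> < 1 / 2"
  shows "q \<in> linking_arc"
  using assms left_drop_bounds[of q] right_drop_bounds[of q] by (auto simp: linked_drops_def)

text \<open>A point within distance \<open>1 / 2\<close> of one at height \<open>11 / 10\<close> has
  positive height, and only the linking arc reaches there.\<close>

lemma near_curve_annulus:
  assumes c: "near_curve E \<epsilon> L g T" and "\<epsilon> \<le> 1 / 2" and im: "Im (g s) \<ge> 11 / 10"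
  shows "\<bar>norm (g s - arc_centre) - arc_radius\<bar> \<le> \<epsilon>"
proof -
  obtain q where q: "q \<in> linked_drops" "norm (g s - q) \<le> \<epsilon>" using near_curve_near[OF c] by blast
  have "\<bar>Im (g s - q)\<bar> \<le> \<epsilon>" using abs_Im_le_cmod q(2) order_trans by blast
  then have "Im q > 0" using assms by (simp add: abs_le_iff)
  then have "q \<in> linking_arc" using q linking_arc_if by blast
  then have "norm (q - arc_centre) = arc_radius" by (simp add: linking_arc_eq)
  moreover have "\<bar>norm (g s - arc_centre) - norm (q - arc_centre)\<bar> \<le> norm (g s - q)"
    using norm_triangle_ineq3[of "g s - arc_centre" "q - arc_centre"] by simp
  ultimately show ?thesis using q by simp
qed

text \<open>
  The curve has no room to turn inside the annulus: a radial velocity component would move it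
  across the annulus before its tangent can change.
\<close>

lemma near_curve_radial:
  assumes c: "near_curve E \<epsilon> L g T" and \<epsilon>: "\<epsilon> \<le> 1 / 2" and im: "Im (g s) \<ge> 12 / 10"
    and h: "0 < h" "h \<le> 1 / 10" "h \<le> 1 / E" and E: "E > 0"
  shows "\<bar>(g s - arc_centre) \<bullet> T s\<bar> \<le> 5 * (2 * \<epsilon> / h + sqrt (E * h))"
proof -
  let ?w = "\<lambda>s. g s - arc_centre"
  have w: "\<bar>norm (?w s) - arc_radius\<bar> \<le> \<epsilon>" by (rule near_curve_annulus[OF c \<epsilon>]) (use im in simp)
  have \<epsilon>0: "0 \<le> \<epsilon>" using w by linarith
  have w5: "norm (?w s) \<le> 5" using w \<epsilon> arc_radius_bounds by linarith
  \<comment> \<open>The expansion of \<open>?w s \<bullet> ?w (s + k)\<close>, bounded by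
    Cauchy-Schwarz, turns the radial velocity into a change of the distance to the centre, which is
    at most \<open>2 * \<epsilon>\<close>. Both signs of \<open>k\<close> together bound the
    absolute value.\<close>
  have one: "k * (?w s \<bullet> T s) \<le> 5 * (2 * \<epsilon>) + 5 * (h * sqrt (E * h))" if k: "\<bar>k\<bar> = h" for k
  proof -
    have "norm (g (s + k) - g s) \<le> h" using near_curve_lipschitz[OF c, of "s + k" s] k by simp
    then have "\<bar>Im (g (s + k) - g s)\<bar> \<le> h" using abs_Im_le_cmod order_trans by blast
    then have "Im (g (s + k)) \<ge> 11 / 10" using im h by (simp add: abs_le_iff)
    then have wk: "\<bar>norm (?w (s + k)) - arc_radius\<bar> \<le> \<epsilon>" by (rule near_curve_annulus[OF c \<epsilon>])
    define r where "r = g (s + k) - g s - k *\<^sub>R T s"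
    have r: "norm r \<le> h * sqrt (E * h)"
      unfolding r_def using near_curve_taylor[OF c E, of k s] h k by simp
    have "?w s \<bullet> ?w (s + k) = ?w s \<bullet> ?w s + k * (?w s \<bullet> T s) + ?w s \<bullet> r"
      by (simp add: r_def inner_diff_right inner_diff_left algebra_simps)
    moreover have "?w s \<bullet> ?w (s + k) \<le> norm (?w s) * norm (?w (s + k))" by (rule norm_cauchy_schwarz)
    moreover have "- (norm (?w s) * norm r) \<le> ?w s \<bullet> r"
      using Cauchy_Schwarz_ineq2[of "?w s" r] by (simp add: abs_le_iff)
    moreover have "?w s \<bullet> ?w s = norm (?w s) * norm (?w s)" by (simp add: power2_norm_eq_inner[symmetric] power2_eq_square)
    ultimately have "k * (?w s \<bullet> T s) \<le> norm (?w s) * (norm (?w (s + k)) - norm (?w s)) + norm (?w s) * norm r"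
      by (simp add: algebra_simps)
    also have "\<dots> \<le> norm (?w s) * (2 * \<epsilon>) + norm (?w s) * (h * sqrt (E * h))"
      using w wk r by (intro add_mono mult_left_mono) (auto simp: abs_le_iff)
    also have "\<dots> \<le> 5 * (2 * \<epsilon>) + 5 * (h * sqrt (E * h))"
      using w5 \<epsilon>0 h E by (intro add_mono mult_right_mono) auto
    finally show ?thesis .
  qed
  have "h * \<bar>?w s \<bullet> T s\<bar> \<le> 5 * (2 * \<epsilon>) + 5 * (h * sqrt (E * h))"
    using one[of h] one[of "- h"] h by (auto simp: abs_if)
  then have "h * \<bar>?w s \<bullet> T s\<bar> \<le> h * (5 * (2 * \<epsilon> / h + sqrt (E * h)))"
    using h by (simp add: distrib_left mult.left_commute)
  then show ?thesis using h by simp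
qed

lemma near_curve_radial_small:
  assumes E: "E \<ge> 1" and \<mu>: "\<mu> > 0"
  obtains \<epsilon>0 where "\<epsilon>0 > 0" "\<epsilon>0 \<le> 1 / 2"
    "\<And>\<epsilon> L g T s. \<epsilon> \<le> \<epsilon>0 \<Longrightarrow> near_curve E \<epsilon> L g T \<Longrightarrow> Im (g s) \<ge> 12 / 10 \<Longrightarrow> \<bar>(g s - arc_centre) \<bullet> T s\<bar> \<le> \<mu>"
proof -
  define \<nu> where "\<nu> = min \<mu> 1"
  have \<nu>: "0 < \<nu>" "\<nu> \<le> 1" "\<nu> \<le> \<mu>" using \<mu> by (auto simp: \<nu>_def)
  \<comment> \<open>Chosen so that \<open>sqrt (E * h) = \<nu> / 10\<close>. Then
    \<open>\<epsilon> \<le> h * \<nu> / 20\<close> gives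
    \<open>2 * \<epsilon> / h \<le> \<nu> / 10\<close>, and with the factor \<open>5\<close> the two
    add up to \<nu>.\<close>
  define h where "h = (\<nu> / 10)\<^sup>2 / E"
  have Eh: "E * h = (\<nu> / 10)\<^sup>2" using E by (simp add: h_def)
  have sq: "(\<nu> / 10)\<^sup>2 \<le> (1 / 10)\<^sup>2" using \<nu> by (intro power_mono) auto
  have h0: "h > 0" using \<nu> E by (simp add: h_def)
  have "h \<le> (\<nu> / 10)\<^sup>2 / 1" unfolding h_def using E by (intro divide_left_mono) auto
  then have h1: "h \<le> 1 / 10" using sq by (simp add: power2_eq_square)
  have h2: "h \<le> 1 / E" unfolding h_def using E sq by (intro divide_right_mono) (auto simp: power2_eq_square)
  define \<epsilon>0 where "\<epsilon>0 = min (1 / 2) (h * \<nu> / 20)"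
  show thesis
  proof (rule that[of \<epsilon>0])
    show "\<epsilon>0 > 0" "\<epsilon>0 \<le> 1 / 2" using h0 \<nu> by (auto simp: \<epsilon>0_def)
    fix \<epsilon> L g T s assume a: "\<epsilon> \<le> \<epsilon>0" "near_curve E \<epsilon> L g T" "Im (g s) \<ge> 12 / 10"
    have "\<bar>(g s - arc_centre) \<bullet> T s\<bar> \<le> 5 * (2 * \<epsilon> / h + sqrt (E * h))"
      by (rule near_curve_radial[OF a(2) _ a(3) h0 h1 h2]) (use a(1) E in \<open>auto simp: \<epsilon>0_def\<close>)
    also have "sqrt (E * h) = \<nu> / 10" unfolding Eh using \<nu> by simp
    also have "2 * \<epsilon> / h \<le> \<nu> / 10" using a(1) h0 by (simp add: \<epsilon>0_def field_simps)
    finally show "\<bar>(g s - arc_centre) \<bullet> T s\<bar> \<le> \<mu>" using \<nu> by simp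
  qed
qed

section \<open>Curves that stay low on one side of the vertical axis\<close>

lemma periodic_attains_max:
  fixes f :: "real \<Rightarrow> real"
  assumes f: "continuous_on UNIV f" and per: "\<And>s. f (s + L) = f s" and L: "L > 0"
  obtains s where "\<And>t. f t \<le> f s"
proof -
  obtain s where s: "s \<in> {0..L}" "\<And>t. t \<in> {0..L} \<Longrightarrow> f t \<le> f s"
    using continuous_attains_sup[of "{0..L}" f] L continuous_on_subset[OF f] by auto
  have "f t \<le> f s" for t
    using s(2)[of "periodic_rem L t"] periodic_rem_bounds[OF L, of t] periodic_rem_periodic[of f L t, OF per] by auto
  then show thesis by (rule that)
qed

lemma near_curve_continuous:
  assumes "near_curve E \<epsilon> L g T"
  shows "continuous_on A g"
  using near_curve_deriv[OF assms] by (intro continuous_at_imp_continuous_on ballI) (auto intro: has_vector_derivative_continuous)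

text \<open>
  Where the distance along the axis of the left drop is maximal, the tangent is orthogonal to the
  axis; but the set near which the curve runs consists of five graphs over the axis, so that six
  points of the tangent line cannot all be close to it.
\<close>

lemma near_curve_not_lower_left:
  assumes E: "E \<ge> 1"
  obtains \<epsilon>0 where "\<epsilon>0 > 0"
    "\<And>\<epsilon> L g T. \<epsilon> \<le> \<epsilon>0 \<Longrightarrow> near_curve E \<epsilon> L g T \<Longrightarrow> \<forall>s. Im (g s) \<le> 12 / 10 \<Longrightarrow> \<forall>s. Re (g s) < 0 \<Longrightarrow> False"
proof -
  \<comment> \<open>Over a length \<open>h1\<close> the tangent turns by at most
    \<open>1 / 2\<close>, so the curve advances by at least \<open>h1 / 2\<close>. The margin \<tau>
    is chosen so that the cap of depth \<open>3 * \<tau>\<close> at the bottom of the drop is too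
    small for this.\<close>
  define h1 where "h1 = 1 / (4 * E)"
  have h1: "0 < h1" "h1 \<le> 1 / 4" "h1 \<le> 1 / E" "E * h1 = 1 / 4" using E by (auto simp: h1_def field_simps)
  define \<tau> where "\<tau> = (h1 / 64)\<^sup>2"
  define M where "M = 64 / h1"
  have "h1\<^sup>2 \<le> (1 / 4)\<^sup>2" using h1 by (intro power_mono) auto
  then have \<tau>: "0 < \<tau>" "\<tau> \<le> 1 / 25" using h1 by (auto simp: \<tau>_def power_divide power2_eq_square)
  have M: "1 / sqrt \<tau> = M" "M \<ge> 256" 
  proof -
    have "sqrt \<tau> = h1 / 64" unfolding \<tau>_def real_sqrt_abs using h1 by simp
    then show "1 / sqrt \<tau> = M" unfolding M_def \<open>sqrt \<tau> = h1 / 64\<close> by simp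
    show "M \<ge> 256" using h1 by (simp add: M_def field_simps)
  qed
  have \<tau>M: "\<tau> = (1 / M)\<^sup>2" by (simp add: \<tau>_def M_def)
  \<comment> \<open>Two of the six points lie on one graph of slope at most \<open>M\<close>, and
    each is within \<delta> of the vertical tangent line. Their distance along it is at least
    \<open>h\<close> but at most \<open>2 * \<delta> + M * (2 * \<delta>) = \<delta> * K\<close>.
    The Taylor error \<open>5 * h / (20 * K)\<close> and \<open>\<epsilon> \<le> h / (4 * K)\<close>
    keep \<open>\<delta> * K\<close> below \<open>h / 2\<close>.\<close>
  define K where "K = 2 + 2 * M"
  have K: "K > 0" using M by (simp add: K_def)
  define h where "h = (1 / (20 * K))\<^sup>2 / (5 * E)"
  have h0: "h > 0" using K E by (simp add: h_def)
  have sh: "sqrt (E * (5 * h)) = 1 / (20 * K)"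
  proof -
    have "E * (5 * h) = (1 / (20 * K))\<^sup>2" using E by (simp add: h_def)
    then show ?thesis using K by simp
  qed
  have "(1 / (20 * K))\<^sup>2 \<le> (1 / M)\<^sup>2"
    using K M by (intro power_mono divide_left_mono) (auto simp: K_def)
  then have "(1 / (20 * K))\<^sup>2 \<le> \<tau>" by (simp add: \<tau>M)
  then have "h \<le> \<tau> / (5 * E)" unfolding h_def using E by (intro divide_right_mono) auto
  then have h\<tau>: "5 * h \<le> \<tau> / E" by simp
  have h5: "5 * h \<le> 1 / E"
    by (rule order_trans[OF h\<tau>]) (use E \<tau> in \<open>auto intro!: divide_right_mono\<close>)
  have "\<tau> / E \<le> \<tau>" using E \<tau> by (simp add: field_simps)
  then have h\<tau>': "h \<le> \<tau>" using h\<tau> h0 by linarith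
  define \<epsilon>0 where "\<epsilon>0 = min (min (1 / 10) \<tau>) (h / (4 * K))"
  have \<epsilon>0: "\<epsilon>0 > 0" using \<tau> h0 K by (simp add: \<epsilon>0_def)
  show thesis
  proof (rule that[OF \<epsilon>0])
    fix \<epsilon> L g T
    assume \<epsilon>: "\<epsilon> \<le> \<epsilon>0" and c: "near_curve E \<epsilon> L g T" and "\<forall>s. Im (g s) \<le> 12 / 10" "\<forall>s. Re (g s) < 0"
    then have im: "\<And>s. Im (g s) \<le> 12 / 10" and re: "\<And>s. Re (g s) < 0" by auto
    have \<epsilon>': "\<epsilon> \<le> 1 / 10" "\<epsilon> \<le> \<tau>" "\<epsilon> \<le> h / (4 * K)" using \<epsilon> by (auto simp: \<epsilon>0_def)
    have E0: "E > 0" using E by simp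
    have L: "L > 0" by (rule near_curve_pos[OF c])
    let ?e = "cis (- (3 * pi / 4))"
    let ?\<xi> = "\<lambda>s. Re (drop_frame (g s))"
    have der: "(?\<xi> has_real_derivative Re (T s * ?e)) (at s)" for s
    proof -
      have "((\<lambda>s. (g s - drop_centre) * ?e) has_vector_derivative (T s * ?e)) (at s)"
        using near_curve_deriv[OF c, of s] by (auto intro!: derivative_eq_intros)
      then have "((\<lambda>s. Re ((g s - drop_centre) * ?e)) has_vector_derivative Re (T s * ?e)) (at s)"
        by (rule bounded_linear.has_vector_derivative[OF bounded_linear_Re])
      then show ?thesis by (simp only: drop_frame_def has_real_derivative_iff_has_vector_derivative)
    qed
    obtain s where s: "\<And>t. ?\<xi> t \<le> ?\<xi> s"
      using periodic_attains_max[of ?\<xi> L] near_curve_periodic[OF c] L der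
      by (metis DERIV_isCont continuous_at_imp_continuous_on)
    have perp: "Re (T s * ?e) = 0"
      by (rule DERIV_local_max[OF der, of 1]) (use s in auto)
    have near: "\<exists>q. q \<in> linked_drops \<and> norm (g t - q) \<le> \<epsilon> \<and> Re q \<le> 1 / 10 \<and> Im q \<le> 13 / 10" for t
    proof -
      obtain q where q: "q \<in> linked_drops" "norm (g t - q) \<le> \<epsilon>" using near_curve_near[OF c] by blast
      have "\<bar>Re (g t - q)\<bar> \<le> \<epsilon>" "\<bar>Im (g t - q)\<bar> \<le> \<epsilon>"
        using abs_Re_le_cmod abs_Im_le_cmod q(2) order_trans by blast+
      then show ?thesis using q \<epsilon>' im[of t] re[of t] by (intro exI[of _ q]) (auto simp: abs_le_iff)
    qed
    then obtain qf where qf: "\<And>t. qf t \<in> linked_drops" "\<And>t. norm (g t - qf t) \<le> \<epsilon>" "\<And>t. Re (qf t) \<le> 1 / 10" "\<And>t. Im (qf t) \<le> 13 / 10"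
      by metis
    have qfF: "norm (drop_frame (qf t) - drop_frame (g t)) \<le> \<epsilon>" for t
      using qf(2)[of t] by (simp add: norm_drop_frame_diff norm_minus_commute)
    show False
    proof (cases "?\<xi> s \<ge> - 1 + 2 * \<tau>")
      case True
      obtain pc :: "complex \<Rightarrow> nat" where pc:
        "\<And>q. q \<in> linked_drops \<Longrightarrow> Re q \<le> 1 / 10 \<Longrightarrow> Im q \<le> 13 / 10 \<Longrightarrow> Re (drop_frame q) \<ge> - 1 + \<tau> \<Longrightarrow> pc q < 5"
        "\<And>q q'. q \<in> linked_drops \<Longrightarrow> Re q \<le> 1 / 10 \<Longrightarrow> Im q \<le> 13 / 10 \<Longrightarrow> Re (drop_frame q) \<ge> - 1 + \<tau> \<Longrightarrow>
           q' \<in> linked_drops \<Longrightarrow> Re q' \<le> 1 / 10 \<Longrightarrow> Im q' \<le> 13 / 10 \<Longrightarrow> Re (drop_frame q') \<ge> - 1 + \<tau> \<Longrightarrow>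
           pc q = pc q' \<Longrightarrow>
           \<bar>Im (drop_frame q) - Im (drop_frame q')\<bar> \<le> M * \<bar>Re (drop_frame q) - Re (drop_frame q')\<bar>"
        by (rule lower_left_pieces[OF \<tau>, unfolded M(1)]) (rule that; assumption)
      define \<delta> where "\<delta> = 5 * h * (1 / (20 * K)) + \<epsilon>"
      have \<delta>K: "\<delta> * K \<le> h / 2" using \<epsilon>'(3) K by (simp add: \<delta>_def field_simps)
      have "\<delta> * 2 \<le> \<delta> * K"
      proof (rule mult_left_mono)
        show "2 \<le> K" using M by (simp add: K_def)
        have "0 \<le> \<epsilon>" using qf(2)[of s] norm_ge_zero order_trans by blast
        then show "0 \<le> \<delta>" using h0 K by (simp add: \<delta>_def)
      qed
      then have \<delta>\<tau>: "\<delta> \<le> \<tau>" using \<delta>K h\<tau>' h0 by linarith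
      define p where "p k = qf (s + real k * h)" for k :: nat
      define v where "v = T s * ?e"
      have v: "Re v = 0" "\<bar>Im v\<bar> = 1"
      proof -
        show 0: "Re v = 0" using perp by (simp add: v_def)
        have "norm v = 1" by (simp add: v_def norm_mult near_curve_norm[OF c])
        then show "\<bar>Im v\<bar> = 1" using 0 by (simp add: cmod_def)
      qed
      have pk: "norm (drop_frame (p k) - (drop_frame (g s) + (real k * h) *\<^sub>R v)) \<le> \<delta>" if "k \<le> 5" for k
      proof -
        have kh: "\<bar>real k * h\<bar> \<le> 5 * h" using that h0 by (simp add: mult_right_mono)
        have "norm (g (s + real k * h) - g s - (real k * h) *\<^sub>R T s) \<le> \<bar>real k * h\<bar> * sqrt (E * \<bar>real k * h\<bar>)"
          by (rule near_curve_taylor[OF c E0]) (use kh h5 in linarith)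
        also have "\<dots> \<le> 5 * h * sqrt (E * (5 * h))"
          using kh E0 h0 by (intro mult_mono) (auto simp del: real_sqrt_mult abs_mult)
        finally have t: "norm (g (s + real k * h) - g s - (real k * h) *\<^sub>R T s) \<le> 5 * h * (1 / (20 * K))" unfolding sh .
        have "drop_frame (g (s + real k * h)) - (drop_frame (g s) + (real k * h) *\<^sub>R v)
            = (g (s + real k * h) - g s - (real k * h) *\<^sub>R T s) * ?e"
          by (simp add: drop_frame_def v_def algebra_simps)
        then have "norm (drop_frame (g (s + real k * h)) - (drop_frame (g s) + (real k * h) *\<^sub>R v)) \<le> 5 * h * (1 / (20 * K))"
          using t by (simp add: norm_mult)
        moreover have "norm (drop_frame (p k) - drop_frame (g (s + real k * h))) \<le> \<epsilon>" using qfF by (simp add: p_def)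
        ultimately have "norm ((drop_frame (p k) - drop_frame (g (s + real k * h))) +
             (drop_frame (g (s + real k * h)) - (drop_frame (g s) + (real k * h) *\<^sub>R v))) \<le> \<epsilon> + 5 * h * (1 / (20 * K))"
          by (intro norm_triangle_mono)
        moreover have "(drop_frame (p k) - drop_frame (g (s + real k * h))) +
             (drop_frame (g (s + real k * h)) - (drop_frame (g s) + (real k * h) *\<^sub>R v))
             = drop_frame (p k) - (drop_frame (g s) + (real k * h) *\<^sub>R v)" by (simp add: algebra_simps)
        ultimately show ?thesis by (simp only: \<delta>_def add.commute)
      qed
      have pRe: "\<bar>Re (drop_frame (p k)) - ?\<xi> s\<bar> \<le> \<delta>" and pIm: "\<bar>Im (drop_frame (p k)) - (Im (drop_frame (g s)) + real k * h * Im v)\<bar> \<le> \<delta>"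
        if "k \<le> 5" for k
      proof -
        let ?z = "drop_frame (p k) - (drop_frame (g s) + (real k * h) *\<^sub>R v)"
        have "\<bar>Re ?z\<bar> \<le> \<delta>" "\<bar>Im ?z\<bar> \<le> \<delta>"
          using abs_Re_le_cmod abs_Im_le_cmod pk[OF that] order_trans by blast+
        then show "\<bar>Re (drop_frame (p k)) - ?\<xi> s\<bar> \<le> \<delta>"
          "\<bar>Im (drop_frame (p k)) - (Im (drop_frame (g s)) + real k * h * Im v)\<bar> \<le> \<delta>"
          using v by auto
      qed
      have S: "p k \<in> linked_drops" "Re (p k) \<le> 1 / 10" "Im (p k) \<le> 13 / 10" "Re (drop_frame (p k)) \<ge> - 1 + \<tau>" if "k \<le> 5" for k
        using qf pRe[OF that] True \<delta>\<tau> by (auto simp: p_def abs_le_iff)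
      have "(\<lambda>k. pc (p k)) ` {..5} \<subseteq> {..<5}" using pc(1) S by auto
      then have "card ((\<lambda>k. pc (p k)) ` {..5}) \<le> card {..<5::nat}" by (intro card_mono) auto
      then have "\<not> inj_on (\<lambda>k. pc (p k)) {..5}" by (intro pigeonhole) auto
      then obtain j k where jk: "j \<le> 5" "k \<le> 5" "j < k" "pc (p j) = pc (p k)"
        unfolding inj_on_def by (metis atMost_iff linorder_neqE_nat)
      have "\<bar>Im (drop_frame (p j)) - Im (drop_frame (p k))\<bar> \<le> M * \<bar>Re (drop_frame (p j)) - Re (drop_frame (p k))\<bar>"
        by (rule pc(2)) (use S jk in auto)
      also have "\<dots> \<le> M * (2 * \<delta>)"
        using pRe[OF jk(1)] pRe[OF jk(2)] M by (intro mult_left_mono) (auto simp: abs_le_iff)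
      finally have "\<bar>Im (drop_frame (p j)) - Im (drop_frame (p k))\<bar> \<le> M * (2 * \<delta>)" .
      moreover have "\<bar>(real k * h * Im v) - (real j * h * Im v)\<bar> \<le> \<bar>Im (drop_frame (p j)) - Im (drop_frame (p k))\<bar> + 2 * \<delta>"
        using pIm[OF jk(1)] pIm[OF jk(2)] by linarith
      moreover have "h \<le> \<bar>(real k * h * Im v) - (real j * h * Im v)\<bar>"
      proof -
        have "(real k * h * Im v) - (real j * h * Im v) = (real k - real j) * h * Im v" by (simp add: algebra_simps)
        then have "\<bar>(real k * h * Im v) - (real j * h * Im v)\<bar> = (real k - real j) * h"
          using v jk h0 by (simp add: abs_mult)
        moreover have "1 * h \<le> (real k - real j) * h" using jk h0 by (intro mult_right_mono) auto
        ultimately show ?thesis by simp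
      qed
      ultimately have "h \<le> \<delta> * K" by (simp add: K_def algebra_simps)
      then show False using \<delta>K h0 by linarith
    next
      case False
      \<comment> \<open>Now even the largest abscissa is close to \<open>- 1\<close>, so the whole
        curve is confined to the neighbourhood of the bottom of the drop.\<close>
      have bot: "- 1 \<le> Re (drop_frame (qf t))" "Re (drop_frame (qf t)) \<le> - 1 + 3 * \<tau>" "\<bar>Im (drop_frame (qf t))\<bar> \<le> 5 / 2 * (h1 / 64)" for t
      proof -
        have "\<bar>Re (drop_frame (qf t) - drop_frame (g t))\<bar> \<le> \<epsilon>"
          using abs_Re_le_cmod qfF order_trans by blast
        then show *: "Re (drop_frame (qf t)) \<le> - 1 + 3 * \<tau>"
          using False s[of t] \<epsilon>' by (auto simp: abs_le_iff)
        have b: "- 1 \<le> Re (drop_frame (qf t))" "(Im (drop_frame (qf t)))\<^sup>2 \<le> 2 * (3 * \<tau>)"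
          using drop_bottom[OF qf(1) qf(3) *] \<tau> by auto
        then show "- 1 \<le> Re (drop_frame (qf t))" by simp
        have "(Im (drop_frame (qf t)))\<^sup>2 \<le> (5 / 2 * (h1 / 64))\<^sup>2"
        proof -
          have "(5 / 2 * (h1 / 64))\<^sup>2 = 25 / 4 * \<tau>" by (simp add: \<tau>_def power2_eq_square)
          then show ?thesis using b(2) \<tau> by linarith
        qed
        then show "\<bar>Im (drop_frame (qf t))\<bar> \<le> 5 / 2 * (h1 / 64)"
          using h1 abs_le_square_iff[of "Im (drop_frame (qf t))" "5 / 2 * (h1 / 64)"] by auto
      qed
      let ?d = "drop_frame (qf (s + h1)) - drop_frame (qf s)"
      have "norm ?d \<le> \<bar>Re ?d\<bar> + \<bar>Im ?d\<bar>" by (rule cmod_le)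
      also have "\<dots> \<le> 3 * \<tau> + 2 * (5 / 2 * (h1 / 64))"
        using bot[of s] bot[of "s + h1"] by (auto simp: abs_le_iff)
      finally have d: "norm (qf (s + h1) - qf s) \<le> 3 * \<tau> + 5 * (h1 / 64)"
        by (simp add: norm_drop_frame_diff)
      have "norm (g (s + h1) - g s - h1 *\<^sub>R T s) \<le> \<bar>h1\<bar> * sqrt (E * \<bar>h1\<bar>)"
        by (rule near_curve_taylor[OF c E0]) (use h1 in simp)
      also have "\<dots> = h1 / 2"
      proof -
        have "E * \<bar>h1\<bar> = (1 / 2)\<^sup>2" using h1 by (simp add: power2_eq_square)
        then have "sqrt (E * \<bar>h1\<bar>) = 1 / 2" by (simp only: real_sqrt_abs)
        then show ?thesis using h1(1) by (simp only: abs_of_pos)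
      qed
      finally have "norm (h1 *\<^sub>R T s) - norm (g (s + h1) - g s) \<le> h1 / 2"
        using norm_triangle_ineq2[of "h1 *\<^sub>R T s" "g (s + h1) - g s"] by (simp add: norm_minus_commute)
      then have 1: "h1 / 2 \<le> norm (g (s + h1) - g s)" using h1 near_curve_norm[OF c, of s] by simp
      have "g (s + h1) - g s = (g (s + h1) - qf (s + h1)) + ((qf (s + h1) - qf s) + (qf s - g s))" by simp
      then have "norm (g (s + h1) - g s) \<le> \<epsilon> + ((3 * \<tau> + 5 * (h1 / 64)) + \<epsilon>)"
        using qf(2)[of "s + h1"] qf(2)[of s] d by (metis norm_minus_commute norm_triangle_mono)
      then have "h1 / 2 \<le> 5 * \<tau> + 5 * (h1 / 64)" using 1 \<epsilon>'(2) by linarith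
      moreover have "\<tau> \<le> (h1 / 64) * (1 / 64)"
        unfolding \<tau>_def power2_eq_square using h1 by (intro mult_left_mono) auto
      ultimately show False using h1 by linarith
    qed
  qed
qed

text \<open>Near the vertical axis only the linking arc is present. Of the two heights that its
  circle takes there, the lower one is negative and hence not on the arc.\<close>

lemma near_curve_top:
  assumes c: "near_curve E \<epsilon> L g T" and \<epsilon>: "\<epsilon> \<le> 4 / 10" and re: "Re (g s) = 0"
  shows "Im (g s) \<ge> 5"
proof -
  obtain q where q: "q \<in> linked_drops" "norm (g s - q) \<le> \<epsilon>" using near_curve_near[OF c] by blast
  have d: "\<bar>Re (g s - q)\<bar> \<le> \<epsilon>" "\<bar>Im (g s - q)\<bar> \<le> \<epsilon>"
    using abs_Re_le_cmod abs_Im_le_cmod q(2) order_trans by blast+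
  then have r: "\<bar>Re q\<bar> \<le> 4 / 10" using re \<epsilon> by simp
  then have "q \<in> linking_arc" using q linking_arc_if by auto
  then have l: "norm (q - arc_centre) = arc_radius" "0 \<le> Im q" by (auto simp: linking_arc_eq)
  have "(norm (q - arc_centre))\<^sup>2 = (Re q)\<^sup>2 + (Im q - arc_height)\<^sup>2"
    by (simp add: cmod_power2 arc_centre_def)
  moreover have "(Re q)\<^sup>2 \<le> (4 / 10)\<^sup>2" using r abs_le_square_iff[of "Re q" "4 / 10"] by simp
  moreover have "(38 / 10)\<^sup>2 + (4 / 10)\<^sup>2 \<le> arc_radius\<^sup>2"
  proof -
    have "(385 / 100)\<^sup>2 \<le> arc_radius\<^sup>2" using arc_radius_bounds by (intro power_mono) auto
    then show ?thesis by (simp add: power2_eq_square)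
  qed
  ultimately have "(38 / 10)\<^sup>2 \<le> (Im q - arc_height)\<^sup>2" using l(1) by simp
  then have "38 / 10 \<le> \<bar>Im q - arc_height\<bar>" using abs_le_square_iff[of "38 / 10" "Im q - arc_height"] by simp
  moreover have "\<bar>Im (g s) - Im q\<bar> \<le> \<epsilon>" using d(2) by simp
  ultimately show ?thesis using l(2) \<epsilon> arc_height_bounds by linarith
qed

lemma unit_tangent_close:
  assumes c: "near_curve E \<epsilon> L g T" and E: "E > 0" and h: "\<bar>s - t\<bar> \<le> 1 / (4 * E)"
  shows "\<bar>Re (T s) - Re (T t)\<bar> \<le> 1 / 2"
proof -
  have "\<bar>s - t\<bar> \<le> 1 / E" by (rule order_trans[OF h]) (use E in \<open>simp add: field_simps\<close>)
  then have "norm (T s - T t) \<le> sqrt (E * \<bar>s - t\<bar>)" by (rule near_curve_holder[OF c])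
  also have "\<dots> \<le> sqrt ((1 / 2)\<^sup>2)"
    using h E by (simp add: field_simps power2_eq_square)
  finally have "norm (T s - T t) \<le> 1 / 2" by simp
  then show ?thesis using abs_Re_le_cmod[of "T s - T t"] by simp
qed

lemma near_curve_Re_deriv:
  assumes "near_curve E \<epsilon> L g T"
  shows "((\<lambda>s. Re (g s)) has_real_derivative Re (T s)) (at s)"
  using bounded_linear.has_vector_derivative[OF bounded_linear_Re near_curve_deriv[OF assms]]
  by (simp add: has_real_derivative_iff_has_vector_derivative)

text \<open>At the highest point the tangent is horizontal. If that point is at height
  \<open>12 / 10\<close> or more, the small radial velocity gives
  \<open>|Re (g s)| \<le> \<mu>\<close>, and moving with horizontal speed at least
  \<open>1 / 2\<close> for the length \<open>h = 2 * \<mu>\<close> to either side the curve meets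
  the axis. Otherwise the curve is low, and without a crossing it would stay on one side, which is
  impossible up to reflection.\<close>

lemma near_curve_crossing:
  assumes E: "E \<ge> 1"
  obtains \<epsilon>0 where "\<epsilon>0 > 0"
    "\<And>\<epsilon> L g T. \<epsilon> \<le> \<epsilon>0 \<Longrightarrow> near_curve E \<epsilon> L g T \<Longrightarrow> \<exists>s. Re (g s) = 0"
proof -
  define \<mu> where "\<mu> = 1 / (8 * E)"
  have \<mu>: "\<mu> > 0" "\<mu> \<le> 1 / 8" using E by (auto simp: \<mu>_def field_simps)
  obtain \<epsilon>1 where \<epsilon>1: "\<epsilon>1 > 0" "\<epsilon>1 \<le> 1 / 2"
    "\<And>\<epsilon> L g T s. \<epsilon> \<le> \<epsilon>1 \<Longrightarrow> near_curve E \<epsilon> L g T \<Longrightarrow> Im (g s) \<ge> 12 / 10 \<Longrightarrow> \<bar>(g s - arc_centre) \<bullet> T s\<bar> \<le> \<mu>"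
    by (rule near_curve_radial_small[OF E \<mu>(1)]) (rule that; assumption)
  obtain \<epsilon>2 where \<epsilon>2: "\<epsilon>2 > 0"
    "\<And>\<epsilon> L g T. \<epsilon> \<le> \<epsilon>2 \<Longrightarrow> near_curve E \<epsilon> L g T \<Longrightarrow> \<forall>s. Im (g s) \<le> 12 / 10 \<Longrightarrow> \<forall>s. Re (g s) < 0 \<Longrightarrow> False"
    by (rule near_curve_not_lower_left[OF E]) (rule that; assumption)
  show thesis
  proof (rule that[of "min \<epsilon>1 \<epsilon>2"])
    show "min \<epsilon>1 \<epsilon>2 > 0" using \<epsilon>1 \<epsilon>2 by simp
    fix \<epsilon> L g T assume \<epsilon>: "\<epsilon> \<le> min \<epsilon>1 \<epsilon>2" and c: "near_curve E \<epsilon> L g T"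
    have L: "L > 0" by (rule near_curve_pos[OF c])
    have cont: "continuous_on A (\<lambda>s. Re (g s))" "continuous_on A (\<lambda>s. Im (g s))" for A
      by (intro continuous_intros near_curve_continuous[OF c])+
    obtain s where s: "\<And>t. Im (g t) \<le> Im (g s)"
      using periodic_attains_max[of "\<lambda>s. Im (g s)" L] cont near_curve_periodic[OF c] L by metis
    show "\<exists>s. Re (g s) = 0"
    proof (cases "Im (g s) \<ge> 12 / 10")
      case True
      have "((\<lambda>s. Im (g s)) has_real_derivative Im (T s)) (at s)"
        using bounded_linear.has_vector_derivative[OF bounded_linear_Im near_curve_deriv[OF c]]
        by (simp add: has_real_derivative_iff_has_vector_derivative)
      then have im: "Im (T s) = 0" by (rule DERIV_local_max[of _ _ _ 1]) (use s in auto)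
      then have re: "\<bar>Re (T s)\<bar> = 1" using near_curve_norm[OF c, of s] by (simp add: cmod_def)
      have "\<bar>(g s - arc_centre) \<bullet> T s\<bar> \<le> \<mu>" using \<epsilon>1(3)[OF _ c True] \<epsilon> by simp
      then have x: "\<bar>Re (g s)\<bar> \<le> \<mu>" using re im by (simp add: inner_complex_def arc_centre_def abs_mult)
      define h where "h = 1 / (4 * E)"
      have h: "h > 0" "\<mu> = h / 2" using E by (auto simp: h_def \<mu>_def)
      have slope: "1 / 2 \<le> Re (T s) * Re (T t)" if "\<bar>t - s\<bar> \<le> h" for t
        using unit_tangent_close[OF c _ that[unfolded h_def]] E re by (auto simp: abs_if split: if_splits)
      have grow: "Re (T s) * Re (g b) - Re (T s) * Re (g a) \<ge> (b - a) / 2" if "s - h \<le> a" "a \<le> b" "b \<le> s + h" for a b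
      proof -
        have "(\<lambda>t. Re (T s) * Re (g t) - t / 2) a \<le> (\<lambda>t. Re (T s) * Re (g t) - t / 2) b"
        proof (rule DERIV_nonneg_imp_nondecreasing[OF that(2)])
          fix t assume t: "a \<le> t" "t \<le> b"
          have "((\<lambda>t. Re (T s) * Re (g t) - t / 2) has_real_derivative Re (T s) * Re (T t) - 1 / 2) (at t)"
            by (intro DERIV_diff DERIV_cmult DERIV_cdivide DERIV_ident near_curve_Re_deriv[OF c])
          moreover have "0 \<le> Re (T s) * Re (T t) - 1 / 2" using slope[of t] t that by (simp add: abs_le_iff)
          ultimately show "\<exists>y. ((\<lambda>t. Re (T s) * Re (g t) - t / 2) has_real_derivative y) (at t) \<and> 0 \<le> y" by blast
        qed
        then show ?thesis by (simp add: diff_divide_distrib)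
      qed
      have x': "\<bar>Re (T s) * Re (g s)\<bar> \<le> h / 2" using x re h by (simp add: abs_mult)
      have "\<exists>t\<ge>s - h. t \<le> s + h \<and> Re (T s) * Re (g t) = 0"
        by (rule IVT') (use grow[of "s - h" s] grow[of s "s + h"] x' h in \<open>auto simp: abs_le_iff intro!: continuous_intros cont\<close>)
      then show ?thesis using re by auto
    next
      case False
      then have low: "Im (g t) \<le> 12 / 10" for t using s[of t] by simp
      show ?thesis
      proof (rule ccontr)
        assume no: "\<not> ?thesis"
        have "connected (range (\<lambda>s. Re (g s)))" by (intro connected_continuous_image cont) auto
        then have "is_interval (range (\<lambda>s. Re (g s)))" by (simp add: is_interval_connected_1)
        have "(\<forall>s. Re (g s) < 0) \<or> (\<forall>s. Re (g s) > 0)"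
        proof (rule ccontr)
          assume "\<not> ?thesis"
          then obtain a b where "Re (g a) > 0" "Re (g b) < 0" using no by (metis linorder_neqE_linordered_idom)
          moreover have "Re (g a) \<in> range (\<lambda>s. Re (g s))" "Re (g b) \<in> range (\<lambda>s. Re (g s))" by auto
          ultimately have "0 \<in> range (\<lambda>s. Re (g s))"
            using \<open>is_interval (range (\<lambda>s. Re (g s)))\<close> unfolding is_interval_1 by (meson less_imp_le)
          then show False using no by auto
        qed
        then show False
        proof
          assume "\<forall>s. Re (g s) < 0"
          then show False using \<epsilon>2(2)[OF _ c] low \<epsilon> by simp
        next
          assume "\<forall>s. Re (g s) > 0"
          then show False using \<epsilon>2(2)[OF _ near_curve_mirror[OF c]] low \<epsilon> by simp
        qed
      qed
    qed
  qed
qed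

text \<open>The first zero after an upcrossing is a downcrossing.\<close>

lemma periodic_downcrossing:
  fixes f f' :: "real \<Rightarrow> real"
  assumes f: "\<And>s. (f has_real_derivative f' s) (at s)" and per: "\<And>s. f (s + L) = f s" and L: "L > 0"
    and zero: "f s = 0" "f' s > 0" and nz: "\<And>t. f t = 0 \<Longrightarrow> f' t \<noteq> 0"
  obtains t where "f t = 0" "f' t < 0"
proof -
  have cont: "continuous_on A f" for A
    using f by (intro continuous_at_imp_continuous_on) (auto intro: DERIV_isCont)
  obtain d1 where d1: "d1 > 0" "\<And>h. 0 < h \<Longrightarrow> h < d1 \<Longrightarrow> f s < f (s + h)"
    using DERIV_pos_inc_right[OF f zero(2)] by auto
  obtain d2 where d2: "d2 > 0" "\<And>h. 0 < h \<Longrightarrow> h < d2 \<Longrightarrow> f (s - h) < f s"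
    using DERIV_pos_inc_left[OF f zero(2)] by auto
  define h where "h = min (min d1 d2) L / 4"
  have h: "0 < h" "h < d1" "h < d2" "s + h \<le> s + L - h" using d1 d2 L by (auto simp: h_def)
  have pos: "f (s + h) > 0" using d1(2) h zero by auto
  have neg: "f (s + L - h) < 0" using d2(2)[of h] h zero per[of "s - h"] by (simp add: algebra_simps)
  let ?Z = "{t \<in> {s + h..s + L - h}. f t = 0}"
  have "\<exists>t\<ge>s + h. t \<le> s + L - h \<and> f t = 0"
    by (rule IVT2') (use pos neg h cont in auto)
  then have Z: "?Z \<noteq> {}" by auto
  have "closed ?Z"
    using continuous_closed_preimage_constant[OF cont, of "{s + h..s + L - h}" 0] by simp
  moreover have "bounded ?Z"
    by (rule bounded_subset[OF compact_imp_bounded[OF compact_Icc[of "s + h" "s + L - h"]]]) auto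
  ultimately have "compact ?Z" by (simp only: compact_eq_bounded_closed)
  then obtain t where t: "t \<in> ?Z" "\<And>u. u \<in> ?Z \<Longrightarrow> t \<le> u"
    using compact_attains_inf[OF _ Z] by auto
  have "f' t \<le> 0"
  proof (rule ccontr)
    assume "\<not> f' t \<le> 0"
    then obtain d where d: "d > 0" "\<And>h. 0 < h \<Longrightarrow> h < d \<Longrightarrow> f (t - h) < f t"
      using DERIV_pos_inc_left[OF f, of t] by auto
    have "t \<noteq> s + h" using t(1) pos by auto
    then have ts: "s + h < t" using t(1) by auto
    define k where "k = min d (t - (s + h)) / 2"
    have k: "0 < k" "k < d" "s + h \<le> t - k"
    proof -
      show "0 < k" "k < d" using d(1) ts by (auto simp: k_def min_def)
      have "k \<le> (t - (s + h)) / 2" by (simp add: k_def)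
      then show "s + h \<le> t - k" using ts by (simp add: field_simps)
    qed
    have "f (t - k) < 0" using d(2)[OF k(1,2)] t(1) by simp
    then have "\<exists>u\<ge>s + h. u \<le> t - k \<and> f u = 0"
      by (intro IVT2') (use pos k cont in auto)
    then obtain u where "s + h \<le> u" "u \<le> t - k" "f u = 0" by blast
    then show False using t(2)[of u] t(1) k by auto
  qed
  then show thesis using that[of t] nz[of t] t(1) by auto
qed

text \<open>This writes a strand as a graph over the horizontal axis. The slope \<open>2 / 5\<close>
  is what remains of the slope \<open>9 / 10\<close> on the axis after a variation of at most
  \<open>1 / 2\<close>; it makes the values of \<open>f\<close> cover \<open>2 * h / 5\<close> to
  either side of \<open>0\<close>.\<close>

lemma increasing_local_inverse:
  fixes f f' :: "real \<Rightarrow> real"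
  assumes f: "\<And>s. (f has_real_derivative f' s) (at s)" and h: "h > 0" and zero: "f s = 0"
    and slope: "\<And>t. \<bar>t - s\<bar> \<le> h \<Longrightarrow> f' t \<ge> 2 / 5"
  obtains k where "continuous_on {- (2 * h / 5)..2 * h / 5} k"
    "\<And>x. x \<in> {- (2 * h / 5)..2 * h / 5} \<Longrightarrow> \<bar>k x - s\<bar> \<le> h \<and> f (k x) = x"
    "\<And>t. \<bar>t - s\<bar> \<le> h \<Longrightarrow> k (f t) = t"
proof -
  let ?S = "{s - h..s + h}"
  have cont: "continuous_on A f" for A
    using f by (intro continuous_at_imp_continuous_on) (auto intro: DERIV_isCont)
  have grow: "(b - a) * (2 / 5) \<le> f b - f a" if "s - h \<le> a" "a \<le> b" "b \<le> s + h" for a b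
  proof -
    have "(\<lambda>t. f t - t * (2 / 5)) a \<le> (\<lambda>t. f t - t * (2 / 5)) b"
    proof (rule DERIV_nonneg_imp_nondecreasing[OF that(2)])
      fix t assume t: "a \<le> t" "t \<le> b"
      have "((\<lambda>t. f t - t * (2 / 5)) has_real_derivative f' t - 2 / 5) (at t)"
        by (auto intro!: derivative_eq_intros f)
      moreover have "f' t - 2 / 5 \<ge> 0" using slope[of t] t that by (simp add: abs_le_iff)
      ultimately show "\<exists>y. ((\<lambda>t. f t - t * (2 / 5)) has_real_derivative y) (at t) \<and> 0 \<le> y" by blast
    qed
    then show ?thesis by (simp add: left_diff_distrib)
  qed
  have inj: "inj_on f ?S"
  proof (rule inj_onI)
    fix a b assume ab: "a \<in> ?S" "b \<in> ?S" "f a = f b"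
    show "a = b"
    proof (cases "a \<le> b")
      case True
      then have "(b - a) * (2 / 5) \<le> 0" using grow[of a b] ab by simp
      then show ?thesis using True by simp
    next
      case False
      then have "(a - b) * (2 / 5) \<le> 0" using grow[of b a] ab by simp
      then show ?thesis using False by simp
    qed
  qed
  define k where "k = inv_into ?S f"
  have kf: "k (f t) = t" if "\<bar>t - s\<bar> \<le> h" for t
    unfolding k_def by (rule inv_into_f_f[OF inj]) (use that in \<open>auto simp: abs_le_iff\<close>)
  have kc: "continuous_on (f ` ?S) k"
    by (rule continuous_on_inv[OF cont]) (use kf in \<open>auto simp: abs_le_iff\<close>)
  have sub: "{- (2 * h / 5)..2 * h / 5} \<subseteq> f ` ?S"
  proof
    fix x assume x: "x \<in> {- (2 * h / 5)..2 * h / 5}"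
    have "\<exists>t\<ge>s - h. t \<le> s + h \<and> f t = x"
      by (rule IVT') (use x grow[of "s - h" s] grow[of s "s + h"] zero h cont in auto)
    then show "x \<in> f ` ?S" by auto
  qed
  show thesis
  proof (rule that[of k])
    show "continuous_on {- (2 * h / 5)..2 * h / 5} k" by (rule continuous_on_subset[OF kc sub])
    show "\<bar>k x - s\<bar> \<le> h \<and> f (k x) = x" if "x \<in> {- (2 * h / 5)..2 * h / 5}" for x
    proof -
      have x: "x \<in> f ` ?S" using that sub by blast
      have "k x \<in> ?S" unfolding k_def by (rule inv_into_into[OF x])
      moreover have "f (k x) = x" unfolding k_def by (rule f_inv_into_f[OF x])
      ultimately show ?thesis by (auto simp: abs_le_iff)
    qed
  qed (use kf in auto)
qed

text \<open>
  The linking arc is traversed in both directions. Near its top the two strands are disjoint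
  graphs over the horizontal axis, so that the lower one does not reach the outer circle.
\<close>

lemma near_curve_inner_strand:
  assumes E: "E \<ge> 1" and \<mu>: "\<mu> > 0"
  obtains \<epsilon>0 where "\<epsilon>0 > 0"
    "\<And>\<epsilon> L g T. \<epsilon> \<le> \<epsilon>0 \<Longrightarrow> near_curve E \<epsilon> L g T \<Longrightarrow> inj_on g {0..<L} \<Longrightarrow>
       (\<And>s. T (s + L) = T s) \<Longrightarrow>
       \<exists>s0. \<forall>s. \<bar>s - s0\<bar> \<le> 1 / (16 * E) \<longrightarrow>
         Im (g s) \<ge> 4 \<and> \<bar>(g s - arc_centre) \<bullet> T s\<bar> \<le> \<mu> \<and> norm (g s - arc_centre) < arc_radius + \<epsilon>"
proof -
  obtain \<epsilon>1 where \<epsilon>1: "\<epsilon>1 > 0" "\<epsilon>1 \<le> 1 / 2"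
    "\<And>\<epsilon> L g T s. \<epsilon> \<le> \<epsilon>1 \<Longrightarrow> near_curve E \<epsilon> L g T \<Longrightarrow> Im (g s) \<ge> 12 / 10 \<Longrightarrow> \<bar>(g s - arc_centre) \<bullet> T s\<bar> \<le> min \<mu> (1 / 10)"
  proof -
    have "min \<mu> (1 / 10) > 0" using \<mu> by simp
    then show ?thesis by (rule near_curve_radial_small[OF E]) (rule that; assumption)
  qed
  obtain \<epsilon>2 where \<epsilon>2: "\<epsilon>2 > 0" "\<And>\<epsilon> L g T. \<epsilon> \<le> \<epsilon>2 \<Longrightarrow> near_curve E \<epsilon> L g T \<Longrightarrow> \<exists>s. Re (g s) = 0"
    by (rule near_curve_crossing[OF E]) (rule that; assumption)
  show thesis
  proof (rule that[of "min (min \<epsilon>1 \<epsilon>2) (4 / 10)"])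
    show "min (min \<epsilon>1 \<epsilon>2) (4 / 10) > 0" using \<epsilon>1 \<epsilon>2 by simp
    fix \<epsilon> L g T
    assume \<epsilon>: "\<epsilon> \<le> min (min \<epsilon>1 \<epsilon>2) (4 / 10)" and c: "near_curve E \<epsilon> L g T" and inj: "inj_on g {0..<L}"
      and perT: "\<And>s. T (s + L) = T s"
    have E0: "E > 0" using E by simp
    have L: "L > 0" by (rule near_curve_pos[OF c])
    have rad: "\<bar>(g s - arc_centre) \<bullet> T s\<bar> \<le> \<mu>" "\<bar>(g s - arc_centre) \<bullet> T s\<bar> \<le> 1 / 10" if "Im (g s) \<ge> 12 / 10" for s
      using \<epsilon>1(3)[OF _ c that] \<epsilon> by auto
    have top: "Im (g s) \<ge> 5" if "Re (g s) = 0" for s by (rule near_curve_top[OF c _ that]) (use \<epsilon> in simp)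
    \<comment> \<open>On the axis the vector from the centre is vertical and longer than
      \<open>2\<close>, so the small radial velocity makes the tangent nearly horizontal.\<close>
    have steep: "\<bar>Re (T s)\<bar> \<ge> 9 / 10" if z: "Re (g s) = 0" for s
    proof -
      have t: "Im (g s) \<ge> 5" by (rule top[OF z])
      have "\<bar>(Im (g s) - arc_height) * Im (T s)\<bar> \<le> 1 / 10"
        using rad(2)[of s] t z by (simp add: inner_complex_def arc_centre_def)
      moreover have "2 * \<bar>Im (T s)\<bar> \<le> \<bar>(Im (g s) - arc_height) * Im (T s)\<bar>"
        unfolding abs_mult using t arc_height_bounds by (intro mult_right_mono) auto
      ultimately have "\<bar>Im (T s)\<bar> \<le> 1 / 20" by linarith
      then have "(Im (T s))\<^sup>2 \<le> (1 / 20)\<^sup>2" using abs_le_square_iff[of "Im (T s)" "1 / 20"] by simp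
      moreover have "(Re (T s))\<^sup>2 + (Im (T s))\<^sup>2 = 1" using near_curve_norm[OF c, of s] cmod_power2[of "T s"] by simp
      ultimately have "(9 / 10)\<^sup>2 \<le> (Re (T s))\<^sup>2" by (simp add: power2_eq_square)
      then show ?thesis using abs_le_square_iff[of "9 / 10" "Re (T s)"] by simp
    qed
    obtain s0 where s0: "Re (g s0) = 0" using \<epsilon>2(2)[OF _ c] \<epsilon> by auto
    have nz: "Re (T s) \<noteq> 0" if "Re (g s) = 0" for s using steep[OF that] by auto
    obtain s1 s2 where s1: "Re (g s1) = 0" "Re (T s1) > 0" and s2: "Re (g s2) = 0" "Re (T s2) < 0"
    proof (cases "Re (T s0) > 0")
      case True
      obtain t where "Re (g t) = 0" "Re (T t) < 0"
        by (rule periodic_downcrossing[of "\<lambda>s. Re (g s)" "\<lambda>s. Re (T s)" L s0])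
           (use near_curve_Re_deriv[OF c] near_curve_periodic[OF c] L s0 True nz in auto)
      then show ?thesis using that s0 True by blast
    next
      case False
      then have "Re (T s0) < 0" using nz[OF s0] by linarith
      moreover obtain t where "Re (g t) = 0" "Re (T t) > 0"
        by (rule periodic_downcrossing[of "\<lambda>s. - Re (g s)" "\<lambda>s. - Re (T s)" L s0])
           (use DERIV_minus[OF near_curve_Re_deriv[OF c]] near_curve_periodic[OF c] L s0 \<open>Re (T s0) < 0\<close> nz in auto)
      ultimately show ?thesis using that s0 by blast
    qed
    define h where "h = 1 / (4 * E)"
    have h: "0 < h" "h \<le> 1 / 4" using E by (auto simp: h_def field_simps)
    have slope1: "Re (T t) \<ge> 2 / 5" if "\<bar>t - s1\<bar> \<le> h" for t
      using unit_tangent_close[OF c E0 that[unfolded h_def]] steep[OF s1(1)] s1(2) by linarith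
    have slope2: "- Re (T t) \<ge> 2 / 5" if "\<bar>t - s2\<bar> \<le> h" for t
      using unit_tangent_close[OF c E0 that[unfolded h_def]] steep[OF s2(1)] s2(2) by linarith
    have high: "Im (g t) \<ge> 4" "\<bar>Re (g t)\<bar> \<le> \<bar>t - s\<bar>" if "\<bar>t - s\<bar> \<le> h" "Re (g s) = 0" for t s
    proof -
      have "norm (g t - g s) \<le> \<bar>t - s\<bar>" by (rule near_curve_lipschitz[OF c])
      then have "\<bar>Re (g t - g s)\<bar> \<le> \<bar>t - s\<bar>" "\<bar>Im (g t - g s)\<bar> \<le> \<bar>t - s\<bar>"
        using abs_Re_le_cmod abs_Im_le_cmod order_trans by blast+
      then show "Im (g t) \<ge> 4" "\<bar>Re (g t)\<bar> \<le> \<bar>t - s\<bar>" using top[OF that(2)] that h by auto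
    qed
    obtain k1 where k1: "continuous_on {- (2 * h / 5)..2 * h / 5} k1"
      "\<And>x. x \<in> {- (2 * h / 5)..2 * h / 5} \<Longrightarrow> \<bar>k1 x - s1\<bar> \<le> h \<and> Re (g (k1 x)) = x"
      "\<And>t. \<bar>t - s1\<bar> \<le> h \<Longrightarrow> k1 (Re (g t)) = t"
      by (rule increasing_local_inverse[OF near_curve_Re_deriv[OF c] h(1) s1(1) slope1]) (assumption | rule that)+
    \<comment> \<open>On the second strand it is \<open>- Re g\<close> that increases, so its point
      over the abscissa \<open>x\<close> has parameter \<open>k2 (- x)\<close>.\<close>
    obtain k2 where k2: "continuous_on {- (2 * h / 5)..2 * h / 5} k2"
      "\<And>x. x \<in> {- (2 * h / 5)..2 * h / 5} \<Longrightarrow> \<bar>k2 x - s2\<bar> \<le> h \<and> - Re (g (k2 x)) = x"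
      "\<And>t. \<bar>t - s2\<bar> \<le> h \<Longrightarrow> k2 (- Re (g t)) = t"
    proof -
      have "- Re (g s2) = 0" using s2 by simp
      then show ?thesis
        by (rule increasing_local_inverse[OF DERIV_minus[OF near_curve_Re_deriv[OF c]] h(1) _ slope2])
           (assumption | rule that)+
    qed
    \<comment> \<open>If both strands reached the outer circle, each would be the upper one over
      some abscissa. By the intermediate value theorem the difference of heights would then vanish
      somewhere, and the strands would meet.\<close>
    have inner: "\<exists>s\<in>{s1, s2}. \<forall>t. \<bar>t - s\<bar> \<le> h / 4 \<longrightarrow> norm (g t - arc_centre) < arc_radius + \<epsilon>"
    proof (rule ccontr)
      assume "\<not> ?thesis"
      then obtain p1 p2 where p1: "\<bar>p1 - s1\<bar> \<le> h / 4" "norm (g p1 - arc_centre) \<ge> arc_radius + \<epsilon>"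
        and p2: "\<bar>p2 - s2\<bar> \<le> h / 4" "norm (g p2 - arc_centre) \<ge> arc_radius + \<epsilon>"
        by (auto simp: not_less)
      let ?I = "{- (2 * h / 5)..2 * h / 5}"
      let ?D = "\<lambda>x. Im (g (k1 x)) - Im (g (k2 (- x)))"
      define x1 x2 where "x1 = Re (g p1)" and "x2 = Re (g p2)"
      have x1: "x1 \<in> ?I" "- x1 \<in> ?I" and x2: "x2 \<in> ?I" "- x2 \<in> ?I"
      proof -
        have "\<bar>Re (g p1)\<bar> \<le> h / 4"
          using high(2)[OF _ s1(1), of p1] p1(1) h by linarith
        moreover have "\<bar>Re (g p2)\<bar> \<le> h / 4"
          using high(2)[OF _ s2(1), of p2] p2(1) h by linarith
        ultimately show "x1 \<in> ?I" "- x1 \<in> ?I" "x2 \<in> ?I" "- x2 \<in> ?I"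
          using h unfolding x1_def x2_def abs_le_iff atLeastAtMost_iff by linarith+
      qed
      have kx1: "k1 x1 = p1" using k1(3)[of p1] p1(1) h by (simp add: x1_def)
      have kx2: "k2 (- x2) = p2" using k2(3)[of p2] p2(1) h by (simp add: x2_def)
      \<comment> \<open>A point on the outer circle is highest over its abscissa among the points of
        the curve above the centre.\<close>
      have below: "Im (g t) \<le> Im (g p)"
        if "norm (g p - arc_centre) \<ge> arc_radius + \<epsilon>" "Im (g t) \<ge> 4" "Im (g p) \<ge> 4" "Re (g t) = Re (g p)" for t p
      proof -
        have "\<bar>norm (g t - arc_centre) - arc_radius\<bar> \<le> \<epsilon>" by (rule near_curve_annulus[OF c]) (use \<epsilon> that in auto)
        then have "norm (g t - arc_centre) \<le> norm (g p - arc_centre)" using that by linarith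
        then have "(norm (g t - arc_centre))\<^sup>2 \<le> (norm (g p - arc_centre))\<^sup>2" by (intro power_mono) auto
        then have "(Im (g t) - arc_height)\<^sup>2 \<le> (Im (g p) - arc_height)\<^sup>2"
          using that(4) by (simp add: cmod_power2 arc_centre_def)
        then show ?thesis
          using that(2,3) arc_height_bounds abs_le_square_iff[of "Im (g t) - arc_height" "Im (g p) - arc_height"] by simp
      qed
      have D1: "?D x1 \<ge> 0"
        unfolding kx1
        using below[OF p1(2), of "k2 (- x1)"] k2(2)[OF x1(2)] high(1)[of p1 s1] high(1)[of "k2 (- x1)" s2] p1(1) s1 s2 h
        by (simp add: x1_def)
      have D2: "?D x2 \<le> 0"
        unfolding kx2
        using below[OF p2(2), of "k1 x2"] k1(2)[OF x2(1)] high(1)[of p2 s2] high(1)[of "k1 x2" s1] p2(1) s1 s2 h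
        by (simp add: x2_def)
      have k2c: "continuous_on ?I (\<lambda>x. k2 (- x))"
        by (rule continuous_on_compose2[OF k2(1)]) (auto intro!: continuous_intros)
      have gc: "continuous_on UNIV g" by (rule near_curve_continuous[OF c])
      have contD: "continuous_on ?I ?D"
        by (intro continuous_intros continuous_on_compose2[OF gc k1(1)] continuous_on_compose2[OF gc k2c]) auto
      have conn: "is_interval (?D ` ?I)"
        unfolding is_interval_connected_1 by (intro connected_continuous_image contD) auto
      have "0 \<in> ?D ` ?I"
        by (rule mem_is_interval_1_I[OF conn imageI[OF x2(1)] imageI[OF x1(1)] D2 D1])
      then obtain x where x: "x \<in> ?I" "?D x = 0" by auto
      have mx: "- x \<in> ?I" using x by auto
      have eq: "g (k1 x) = g (k2 (- x))"
        using x k1(2)[OF x(1)] k2(2)[OF mx] by (simp add: complex_eq_iff)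
      have "g (periodic_rem L (k1 x)) = g (periodic_rem L (k2 (- x)))"
        using eq by (simp add: periodic_rem_periodic[of g L, OF near_curve_periodic[OF c]])
      then have "periodic_rem L (k1 x) = periodic_rem L (k2 (- x))"
        by (rule inj_onD[OF inj]) (use periodic_rem_bounds[OF L] in auto)
      \<comment> \<open>Injectivity identifies the two parameters up to a multiple of
        \<open>L\<close>, so the contradiction is drawn from the tangents, whose horizontal
        components have opposite signs.\<close>
      then have "T (k1 x) = T (k2 (- x))"
        using periodic_rem_periodic[of T L, OF perT] by metis
      then show False
        using slope1[OF conjunct1[OF k1(2)[OF x(1)]]] slope2[OF conjunct1[OF k2(2)[OF mx]]] by simp
    qed
    then obtain s where s: "s \<in> {s1, s2}" "\<And>t. \<bar>t - s\<bar> \<le> h / 4 \<Longrightarrow> norm (g t - arc_centre) < arc_radius + \<epsilon>" by blast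
    have z: "Re (g s) = 0" using s s1 s2 by auto
    show "\<exists>s0. \<forall>s. \<bar>s - s0\<bar> \<le> 1 / (16 * E) \<longrightarrow>
         Im (g s) \<ge> 4 \<and> \<bar>(g s - arc_centre) \<bullet> T s\<bar> \<le> \<mu> \<and> norm (g s - arc_centre) < arc_radius + \<epsilon>"
    proof (intro exI[of _ s] allI impI conjI)
      fix t assume t: "\<bar>t - s\<bar> \<le> 1 / (16 * E)"
      have t4: "\<bar>t - s\<bar> \<le> h / 4" using t by (simp add: h_def)
      show "norm (g t - arc_centre) < arc_radius + \<epsilon>" by (rule s(2)[OF t4])
      show 4: "Im (g t) \<ge> 4" by (rule high(1)[OF _ z]) (use t4 h in simp)
      show "\<bar>(g t - arc_centre) \<bullet> T t\<bar> \<le> \<mu>" by (rule rad(1)) (use 4 in simp)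
    qed
  qed
qed

section \<open>The outward variation\<close>

text \<open>Used to move the strand to the middle of the period, so that the variation stays away
  from the end points \<open>0\<close> and \<open>L\<close>.\<close>

lemma h2_data_shift:
  assumes h: "h2_data L g u a"
  shows "h2_data L (\<lambda>s. g (s + c)) (\<lambda>s. u (s + c)) (\<lambda>s. a (s + c))"
    and "integral {0..L} (\<lambda>s. (norm (a (s + c)))\<^sup>2) = integral {0..L} (\<lambda>s. (norm (a s))\<^sup>2)"
proof -
  have L: "L > 0" by (rule h2_data_pos[OF h])
  have der: "((\<lambda>t. t + c) has_real_derivative 1) (at t within S)" for t S
    by (auto intro!: derivative_eq_intros)
  show "h2_data L (\<lambda>s. g (s + c)) (\<lambda>s. u (s + c)) (\<lambda>s. a (s + c))"
    unfolding h2_data_def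
  proof (intro conjI allI)
    show "((\<lambda>s. g (s + c)) has_vector_derivative u (s + c)) (at s)" for s
    proof -
      have "((g \<circ> (\<lambda>s. s + c)) has_vector_derivative 1 *\<^sub>R u (s + c)) (at s)"
        by (rule vector_diff_chain_at[OF _ h2_data_deriv[OF h]]) (auto intro!: derivative_eq_intros)
      then show ?thesis by (simp add: o_def)
    qed
    show "g (s + L + c) = g (s + c)" "a (s + L + c) = a (s + c)" for s
      using h2_data_periodic[OF h, of "s + c"] h2_data_periodic''[OF h, of "s + c"] by (simp_all add: ac_simps)
    show "has_density x y (\<lambda>s. u (s + c)) (\<lambda>s. a (s + c))" for x y
    proof -
      have "has_density x y (\<lambda>t. u (t + c)) (\<lambda>t. 1 *\<^sub>R a (t + c))"
        by (rule has_density_compose[OF h2_data_density[OF h] der]) (auto simp: inj_on_def)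
      then show ?thesis by simp
    qed
    show "(\<lambda>s. (norm (a (s + c)))\<^sup>2) integrable_on {0..L}"
      using integrable_translate(1)[OF h2_data_square_integrable[OF h], where x=0 and c=c and y=L]
      by (rule set_lebesgue_integral_eq_integral(1))
  qed (use L h2_data_nz[OF h] in auto)
  have "integral {0..L} (\<lambda>s. (norm (a (s + c)))\<^sup>2) = integral {0 + c..L + c} (\<lambda>s. (norm (a s))\<^sup>2)"
    by (rule integrable_translate(2)[OF h2_data_square_integrable[OF h]])
  also have "\<dots> = integral {0..L} (\<lambda>s. (norm (a s))\<^sup>2)"
    using integral_over_period[OF _ L h2_data_square_integrable[OF h], of c] h2_data_periodic''[OF h]
    by (simp add: add.commute)
  finally show "integral {0..L} (\<lambda>s. (norm (a (s + c)))\<^sup>2) = integral {0..L} (\<lambda>s. (norm (a s))\<^sup>2)" .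
qed

lemma periodic_inj:
  fixes g :: "real \<Rightarrow> 'a" and L :: real
  assumes inj: "inj_on g {0..<L}" and per: "\<And>s. g (s + L) = g s" and L: "L > 0"
    and eq: "g x = g y" "\<bar>x - y\<bar> < L"
  shows "x = y"
proof -
  have "g (periodic_rem L x) = g (periodic_rem L y)"
    using eq(1) by (simp add: periodic_rem_periodic[of g L, OF per])
  then have "periodic_rem L x = periodic_rem L y"
    by (rule inj_onD[OF inj]) (use periodic_rem_bounds[OF L] in auto)
  then have xy: "x - y = L * of_int (\<lfloor>x / L\<rfloor> - \<lfloor>y / L\<rfloor>)" by (simp add: periodic_rem_def algebra_simps)
  then have "L * \<bar>of_int (\<lfloor>x / L\<rfloor> - \<lfloor>y / L\<rfloor>)\<bar> < L * 1" using eq(2) L by (simp add: abs_mult)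
  then have "\<bar>of_int (\<lfloor>x / L\<rfloor> - \<lfloor>y / L\<rfloor>) :: real\<bar> < 1" using L by (simp only: mult_less_cancel_left_pos)
  then have "\<lfloor>x / L\<rfloor> - \<lfloor>y / L\<rfloor> = 0" by linarith
  then show ?thesis using xy by simp
qed

text \<open>\<open>B\<close> is the fourth power of the positive part of
  \<open>1 - ((s - m) / r)^2\<close>, three times continuously differentiable because integration by
  parts puts three derivatives on it. The constants are \<open>81 / 256 = (3 / 4)^4\<close>,
  \<open>8 = 4 * 2\<close>, \<open>56 = 12 * 4 + 4 * 2\<close> and
  \<open>336 = 24 * 8 + 36 * 4\<close>.\<close>

lemma bump_function:
  assumes r: "r > 0"
  obtains B B1 B2 B3 :: "real \<Rightarrow> real" where
    "\<And>s. (B has_real_derivative B1 s) (at s)" "\<And>s. (B1 has_real_derivative B2 s) (at s)"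
    "\<And>s. (B2 has_real_derivative B3 s) (at s)" "continuous_on UNIV B3"
    "\<And>s. \<bar>s - m\<bar> \<ge> r \<Longrightarrow> B s = 0 \<and> B1 s = 0 \<and> B2 s = 0"
    "\<And>s. 0 \<le> B s \<and> B s \<le> 1" "\<And>s. \<bar>s - m\<bar> \<le> r / 2 \<Longrightarrow> 81 / 256 \<le> B s"
    "\<And>s. \<bar>B1 s\<bar> \<le> 8 / r" "\<And>s. \<bar>B2 s\<bar> \<le> 56 / r ^ 2" "\<And>s. \<bar>B3 s\<bar> \<le> 336 / r ^ 3"
proof -
  define y where "y s = 1 - ((s - m) / r)\<^sup>2" for s
  define y1 where "y1 s = (- 2 / r\<^sup>2) * (s - m)" for s
  define y2 where "y2 = - 2 / r\<^sup>2"
  define P where "P s = max 0 (y s)" for s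
  define B where "B s = P s ^ 4" for s
  define B1 where "B1 s = 4 * P s ^ 3 * y1 s" for s
  define B2 where "B2 s = 12 * P s ^ 2 * y1 s ^ 2 + 4 * P s ^ 3 * y2" for s
  define B3 where "B3 s = 24 * P s * y1 s ^ 3 + 36 * P s ^ 2 * (y1 s * y2)" for s
  have yd: "(y has_real_derivative y1 s) (at s)" for s
    unfolding y_def[abs_def] y1_def using r
    by (auto intro!: derivative_eq_intros simp: power2_eq_square field_simps)
  have y1d: "(y1 has_real_derivative y2) (at s)" for s
    unfolding y1_def[abs_def] y2_def
    by (rule DERIV_cong[OF DERIV_cmult[OF DERIV_diff[OF DERIV_ident DERIV_const]]]) simp
  have Pd: "((\<lambda>s. P s ^ Suc (Suc n)) has_real_derivative real (Suc (Suc n)) * P s ^ Suc n * y1 s) (at s)" for n s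
    unfolding P_def by (rule DERIV_chain2[OF has_real_derivative_pos_part_power yd])
  have P2: "((\<lambda>s. P s ^ 2) has_real_derivative 2 * P s * y1 s) (at s)"
    and P3: "((\<lambda>s. P s ^ 3) has_real_derivative 3 * P s ^ 2 * y1 s) (at s)"
    and P4: "((\<lambda>s. P s ^ 4) has_real_derivative 4 * P s ^ 3 * y1 s) (at s)" for s
    using Pd[of 0 s] Pd[of 1 s] Pd[of 2 s] by (simp_all add: eval_nat_numeral)
  have d1: "(B has_real_derivative B1 s) (at s)" for s
    unfolding B_def[abs_def] B1_def by (rule P4)
  have d2: "(B1 has_real_derivative B2 s) (at s)" for s
    unfolding B1_def[abs_def] B2_def
    by (rule DERIV_cong[OF DERIV_mult[OF DERIV_cmult[OF P3] y1d]]) (simp add: power2_eq_square algebra_simps)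
  have d3: "(B2 has_real_derivative B3 s) (at s)" for s
  proof -
    have "((\<lambda>s. y1 s ^ 2) has_real_derivative 2 * y1 s * y2) (at s)"
      by (rule DERIV_cong[OF DERIV_power[OF y1d]]) simp
    from DERIV_add[OF DERIV_mult[OF DERIV_cmult[OF P2, of 12] this] DERIV_mult[OF DERIV_cmult[OF P3, of 4] DERIV_const[of y2]]]
    show ?thesis unfolding B2_def[abs_def] B3_def
      by (rule DERIV_cong) (simp add: power2_eq_square power3_eq_cube algebra_simps)
  qed
  have c3: "continuous_on UNIV B3"
    unfolding B3_def[abs_def] P_def[abs_def] y_def[abs_def] y1_def[abs_def] using r by (intro continuous_intros) auto
  have out: "P s = 0" if "\<bar>s - m\<bar> \<ge> r" for s
  proof -
    have "1\<^sup>2 \<le> \<bar>(s - m) / r\<bar>\<^sup>2" using that r by (intro power_mono) auto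
    then have "1 \<le> ((s - m) / r)\<^sup>2" unfolding power2_abs by simp
    then show ?thesis by (simp add: P_def y_def)
  qed
  have P01: "0 \<le> P s" "P s \<le> 1" for s by (auto simp: P_def y_def)
  have Pn: "P s ^ k \<le> 1" "0 \<le> P s ^ k" for s k using P01 by (auto intro: power_le_one)
  have y1b: "\<bar>y1 s\<bar> \<le> 2 / r" if "\<bar>s - m\<bar> \<le> r" for s
  proof -
    have "\<bar>y1 s\<bar> = \<bar>- 2 / r\<^sup>2\<bar> * \<bar>s - m\<bar>" unfolding y1_def by (rule abs_mult)
    also have "\<dots> = 2 * \<bar>s - m\<bar> / r\<^sup>2" by simp
    also have "\<dots> \<le> 2 * r / r\<^sup>2" using that r by (intro divide_right_mono) auto
    finally show ?thesis using r by (simp add: power2_eq_square)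
  qed
  have y2b: "\<bar>y2\<bar> = 2 / r\<^sup>2" by (simp add: y2_def)
  show thesis
  proof (rule that[of B B1 B2 B3, OF d1 d2 d3 c3])
    show "B s = 0 \<and> B1 s = 0 \<and> B2 s = 0" if "\<bar>s - m\<bar> \<ge> r" for s
      using out[OF that] by (simp add: B_def B1_def B2_def)
    show "0 \<le> B s \<and> B s \<le> 1" for s using Pn by (simp add: B_def)
    show "81 / 256 \<le> B s" if "\<bar>s - m\<bar> \<le> r / 2" for s
    proof -
      have "\<bar>(s - m) / r\<bar>\<^sup>2 \<le> (1 / 2)\<^sup>2" using that r by (intro power_mono) (auto simp: field_simps)
      then have "((s - m) / r)\<^sup>2 \<le> 1 / 4" unfolding power2_abs by (simp add: power_one_over)
      then have "3 / 4 \<le> P s" by (simp add: P_def y_def)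
      then have "(3 / 4) ^ 4 \<le> P s ^ 4" by (intro power_mono) auto
      then show ?thesis by (simp add: B_def eval_nat_numeral)
    qed
    show "\<bar>B1 s\<bar> \<le> 8 / r" for s
    proof (cases "\<bar>s - m\<bar> \<le> r")
      case True
      have "\<bar>B1 s\<bar> = 4 * P s ^ 3 * \<bar>y1 s\<bar>" using P01 by (simp add: B1_def abs_mult)
      also have "\<dots> \<le> 4 * 1 * (2 / r)" using Pn P01 y1b[OF True] by (intro mult_mono) auto
      finally show ?thesis by simp
    next
      case False
      then show ?thesis using out[of s] r by (simp add: B1_def)
    qed
    show "\<bar>B2 s\<bar> \<le> 56 / r ^ 2" for s
    proof (cases "\<bar>s - m\<bar> \<le> r")
      case True
      have "\<bar>B2 s\<bar> \<le> 12 * P s ^ 2 * \<bar>y1 s\<bar> ^ 2 + 4 * P s ^ 3 * \<bar>y2\<bar>"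
        unfolding B2_def by (rule order_trans[OF abs_triangle_ineq]) (use P01 in \<open>simp add: abs_mult\<close>)
      also have "\<dots> \<le> 12 * 1 * (2 / r) ^ 2 + 4 * 1 * (2 / r\<^sup>2)"
        using Pn P01 y1b[OF True] y2b by (intro add_mono mult_mono power_mono) auto
      finally show ?thesis using r by (simp add: power_divide)
    next
      case False
      then show ?thesis using out[of s] r by (simp add: B2_def)
    qed
    show "\<bar>B3 s\<bar> \<le> 336 / r ^ 3" for s
    proof (cases "\<bar>s - m\<bar> \<le> r")
      case True
      have "\<bar>B3 s\<bar> \<le> 24 * P s * \<bar>y1 s\<bar> ^ 3 + 36 * P s ^ 2 * (\<bar>y1 s\<bar> * \<bar>y2\<bar>)"
        unfolding B3_def by (rule order_trans[OF abs_triangle_ineq]) (use P01 in \<open>simp add: abs_mult power_abs\<close>)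
      also have "\<dots> \<le> 24 * 1 * (2 / r) ^ 3 + 36 * 1 * ((2 / r) * (2 / r\<^sup>2))"
        using Pn P01 y1b[OF True] y2b r by (intro add_mono mult_mono power_mono) auto
      also have "\<dots> = 336 / r ^ 3" using r by (simp add: power_divide power2_eq_square power3_eq_cube)
      finally show ?thesis .
    next
      case False
      then show ?thesis using out[of s] r by (simp add: B3_def)
    qed
  qed
qed

text \<open>An expansion to first order in \<open>t\<close> with explicit remainder. Cauchy-Schwarz
  bounds the speed \<open>norm (T + t *\<^sub>R V)\<close> below by \<open>1 + y\<close>, where
  \<open>y = t * (T \<bullet> V)\<close>, and the inverse cube of \<open>1 + y\<close> is at most
  \<open>1 - 3 * y + 50 * y^2\<close> for \<open>|y| \<le> 1 / 2\<close>.\<close>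

lemma variation_integrand_bound:
  fixes a T A V :: complex
  assumes T: "norm T = 1" and V: "norm V \<le> K" and A: "norm A \<le> K + norm a" and K: "K \<ge> 1"
    and t: "0 \<le> t" "t * K \<le> 1 / 2"
  shows "(norm (a + t *\<^sub>R A))\<^sup>2 / norm (T + t *\<^sub>R V) ^ 3
      \<le> (norm a)\<^sup>2 + t * (2 * (a \<bullet> A) - 3 * (norm a)\<^sup>2 * (T \<bullet> V)) + t\<^sup>2 * (164 * K ^ 3 * (1 + (norm a)\<^sup>2))"
proof -
  define n X Y v where "n = (norm a)\<^sup>2" and "X = 2 * (a \<bullet> A)" and "Y = (norm A)\<^sup>2" and "v = T \<bullet> V"
  define y where "y = t * v"
  have n: "n \<ge> 0" by (simp add: n_def)
  have v: "\<bar>v\<bar> \<le> K"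
    using Cauchy_Schwarz_ineq2[of T V] T V by (simp add: v_def)
  have y: "\<bar>y\<bar> \<le> 1 / 2"
  proof -
    have "\<bar>y\<bar> \<le> t * K" unfolding y_def abs_mult using v t by (intro mult_mono) auto
    then show ?thesis using t by simp
  qed
  have KK: "1 \<le> K\<^sup>2" using K by simp
  have X: "\<bar>X\<bar> \<le> 3 * K\<^sup>2 * (1 + n)"
  proof -
    have "\<bar>X\<bar> \<le> 2 * (norm a * norm A)" using Cauchy_Schwarz_ineq2[of a A] by (simp add: X_def)
    also have "\<dots> \<le> 2 * (norm a * (K + norm a))" using A by (intro mult_left_mono) auto
    also have "\<dots> \<le> K\<^sup>2 + 3 * n"
      using zero_le_power2[of "norm a - K"] unfolding n_def power2_eq_square by (simp add: algebra_simps)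
    also have "\<dots> \<le> 3 * K\<^sup>2 * (1 + n)"
      using mult_right_mono[OF KK n] KK by (simp add: algebra_simps)
    finally show ?thesis .
  qed
  have Y: "Y \<le> 2 * K\<^sup>2 * (1 + n)" "Y \<ge> 0"
  proof -
    have "Y \<le> (K + norm a)\<^sup>2" unfolding Y_def using A by (intro power_mono) auto
    also have "\<dots> \<le> 2 * K\<^sup>2 + 2 * n"
      using zero_le_power2[of "norm a - K"] unfolding n_def power2_eq_square by (simp add: algebra_simps)
    also have "\<dots> \<le> 2 * K\<^sup>2 * (1 + n)" using mult_right_mono[OF KK n] by (simp add: algebra_simps)
    finally show "Y \<le> 2 * K\<^sup>2 * (1 + n)" .
  qed (simp add: Y_def)
  have num: "(norm (a + t *\<^sub>R A))\<^sup>2 = n + t * X + t\<^sup>2 * Y"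
    unfolding n_def X_def Y_def power2_norm_eq_inner inner_add_left inner_add_right inner_scaleR_left inner_scaleR_right inner_commute[of A a]
    by (simp add: power2_eq_square algebra_simps)
  have "1 + y \<le> norm (T + t *\<^sub>R V)"
  proof -
    have "1 + y = T \<bullet> (T + t *\<^sub>R V)"
      using T power2_norm_eq_inner[of T] by (simp add: y_def v_def inner_add_right)
    also have "\<dots> \<le> norm T * norm (T + t *\<^sub>R V)" by (rule norm_cauchy_schwarz)
    finally show ?thesis using T by simp
  qed
  then have den: "(1 + y) ^ 3 \<le> norm (T + t *\<^sub>R V) ^ 3" using y by (intro power_mono) auto
  have pos: "(1 + y) ^ 3 > 0" using y by (intro zero_less_power) linarith
  have inv: "1 / norm (T + t *\<^sub>R V) ^ 3 \<le> 1 - 3 * y + 50 * y\<^sup>2"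
  proof -
    \<comment> \<open>The constant \<open>50\<close> comes from \<open>y = - 1 / 2\<close>, where
      the cube is \<open>1 / 8\<close>: then \<open>50 / 8\<close> exceeds \<open>6\<close>, and for
      negative \<open>y\<close> the other two terms together are not positive.\<close>
    have c: "6 + 8 * y + 3 * y\<^sup>2 \<le> 50 * (1 + y) ^ 3"
    proof (cases "y \<ge> 0")
      case True
      have "y\<^sup>2 \<le> (1 / 2)\<^sup>2" using y True by (intro power_mono) auto
      moreover have "1 ^ 3 \<le> (1 + y) ^ 3" using True by (intro power_mono) auto
      ultimately show ?thesis using y by (simp add: power2_eq_square)
    next
      case False
      have "(1 / 2) ^ 3 \<le> (1 + y) ^ 3" using y by (intro power_mono) auto
      moreover have "8 * y + 3 * y\<^sup>2 \<le> 0"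
      proof -
        have "y * (8 + 3 * y) \<le> 0" using False y by (intro mult_nonpos_nonneg) auto
        then show ?thesis by (simp add: power2_eq_square algebra_simps)
      qed
      ultimately show ?thesis by (simp add: power3_eq_cube)
    qed
    have "(1 - 3 * y + 50 * y\<^sup>2) * (1 + y) ^ 3 = 1 + y\<^sup>2 * (50 * (1 + y) ^ 3 - (6 + 8 * y + 3 * y\<^sup>2))"
      by (simp add: power2_eq_square power3_eq_cube algebra_simps)
    also have "\<dots> \<ge> 1" using c by simp
    finally have "1 / (1 + y) ^ 3 \<le> 1 - 3 * y + 50 * y\<^sup>2" using pos by (simp add: pos_divide_le_eq)
    moreover have "1 / norm (T + t *\<^sub>R V) ^ 3 \<le> 1 / (1 + y) ^ 3"
      using den pos less_le_trans[OF pos den] by (intro divide_left_mono mult_pos_pos) auto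
    ultimately show ?thesis by linarith
  qed
  have "(norm (a + t *\<^sub>R A))\<^sup>2 * (1 / norm (T + t *\<^sub>R V) ^ 3) \<le> (n + t * X + t\<^sup>2 * Y) * (1 - 3 * y + 50 * y\<^sup>2)"
    unfolding num[symmetric] using inv by (intro mult_left_mono) auto
  also have "\<dots> = n + t * (X - 3 * n * v) + t\<^sup>2 * (Y - 3 * (X * v) + 50 * (n * v\<^sup>2) + (- 3) * (y * Y) + 50 * (y * (X * v)) + 50 * (y\<^sup>2 * Y))"
    by (simp add: y_def power2_eq_square algebra_simps)
  also have "\<dots> \<le> n + t * (X - 3 * n * v) + t\<^sup>2 * (164 * K ^ 3 * (1 + n))"
  proof -
    \<comment> \<open>Every second-order term is a multiple of \<open>N\<close>, and
      \<open>164 = 2 + 9 + 50 + 3 + 75 + 25\<close>.\<close>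
    define N where "N = K ^ 3 * (1 + n)"
    have K3: "K\<^sup>2 \<le> K ^ 3" using K by (intro power_increasing) auto
    have K2N: "K\<^sup>2 * (1 + n) \<le> N" unfolding N_def using K3 n by (intro mult_right_mono) auto
    have N0: "0 \<le> N" using K2N n by (smt (verit) mult_nonneg_nonneg zero_le_power2)
    have Xv: "\<bar>X * v\<bar> \<le> 3 * N"
    proof -
      have "\<bar>X * v\<bar> \<le> (3 * K\<^sup>2 * (1 + n)) * K" unfolding abs_mult using X v n by (intro mult_mono) auto
      then show ?thesis by (simp add: N_def power2_eq_square power3_eq_cube algebra_simps)
    qed
    have nv: "n * v\<^sup>2 \<le> N"
    proof -
      have "v\<^sup>2 \<le> K\<^sup>2" using v power_mono[OF v, of 2] by simp
      then have "n * v\<^sup>2 \<le> (1 + n) * K\<^sup>2" using n by (intro mult_mono) auto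
      then show ?thesis using K2N by (simp add: mult.commute)
    qed
    have YN: "Y \<le> 2 * N" using Y(1) K2N by linarith
    have yY: "\<bar>y * Y\<bar> \<le> N"
    proof -
      have "\<bar>y * Y\<bar> \<le> (1 / 2) * (2 * N)" unfolding abs_mult using y YN Y(2) by (intro mult_mono) auto
      then show ?thesis by simp
    qed
    have yXv: "\<bar>y * (X * v)\<bar> \<le> 3 / 2 * N"
    proof -
      have "\<bar>y * (X * v)\<bar> \<le> (1 / 2) * (3 * N)" unfolding abs_mult[of y] using y Xv by (intro mult_mono) auto
      then show ?thesis by simp
    qed
    have yyY: "y\<^sup>2 * Y \<le> N / 2"
    proof -
      have "y\<^sup>2 \<le> (1 / 2)\<^sup>2" using power_mono[OF y, of 2] by simp
      then have "y\<^sup>2 * Y \<le> (1 / 2)\<^sup>2 * (2 * N)" using YN Y(2) by (intro mult_mono) auto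
      then show ?thesis by (simp add: power2_eq_square)
    qed
    have "Y - 3 * (X * v) + 50 * (n * v\<^sup>2) + (- 3) * (y * Y) + 50 * (y * (X * v)) + 50 * (y\<^sup>2 * Y) \<le> 164 * N"
      using Xv nv YN yY yXv yyY N0 by (simp only: abs_le_iff) linarith
    then have "t\<^sup>2 * (Y - 3 * (X * v) + 50 * (n * v\<^sup>2) + (- 3) * (y * Y) + 50 * (y * (X * v)) + 50 * (y\<^sup>2 * Y)) \<le> t\<^sup>2 * (164 * N)"
      by (rule mult_left_mono) simp
    then show ?thesis by (simp add: N_def mult.assoc)
  qed
  finally show ?thesis by (simp add: n_def X_def v_def)
qed

text \<open>The radial projection of the point to the circle lies on the linking arc, since it stays
  above the centre.\<close>

lemma tubular_nbhd_near_linking_arc: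
  assumes "norm w > 0" "\<bar>norm w - arc_radius\<bar> < \<epsilon>" "Im w \<ge> 0"
  shows "arc_centre + w \<in> tubular_nbhd linked_drops \<epsilon>"
proof -
  define q where "q = arc_centre + (arc_radius / norm w) *\<^sub>R w"
  have "norm (q - arc_centre) = arc_radius" using assms arc_radius_bounds by (simp add: q_def)
  moreover have "Im q \<ge> 0"
    using assms arc_radius_bounds arc_height_bounds by (simp add: q_def arc_centre_def)
  ultimately have "q \<in> linked_drops" by (simp add: linked_drops_def linking_arc_eq)
  moreover have "dist (arc_centre + w) q < \<epsilon>"
  proof -
    have "arc_centre + w - q = ((norm w - arc_radius) / norm w) *\<^sub>R w"
      using assms by (simp add: q_def diff_divide_distrib scaleR_diff_left)
    then show ?thesis using assms by (simp add: dist_norm)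
  qed
  ultimately show ?thesis
    unfolding tubular_nbhd_def using infdist_le[of q linked_drops "arc_centre + w"] by simp
qed

text \<open>
  The radial field \<open>B * w\<close> pushes the strand outwards. The second variation of the energy along it
  is controlled by \<open>w \<bullet> T\<close>, which is small, except for the term \<open>- B * |a|\<^sup>2\<close>.
\<close>

lemma outward_variation_integrand:
  fixes g T a :: "real \<Rightarrow> complex"
  assumes g: "\<And>x y. has_density x y g T" and T: "\<And>x y. has_density x y T a" and nT: "\<And>s. norm (T s) = 1"
    and a2: "\<And>x y. (\<lambda>s. (norm (a s))\<^sup>2) integrable_on {x..y}"
    and r: "0 < r" "r \<le> 1 / 16"
    and B: "\<And>s. (B has_real_derivative B1 s) (at s)" "\<And>s. (B1 has_real_derivative B2 s) (at s)"
      "\<And>s. (B2 has_real_derivative B3 s) (at s)" "continuous_on UNIV B3"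
      "\<And>s. \<bar>s - m\<bar> \<ge> r \<Longrightarrow> B s = 0 \<and> B1 s = 0 \<and> B2 s = 0"
      "\<And>s. 0 \<le> B s \<and> B s \<le> 1" "\<And>s. \<bar>s - m\<bar> \<le> r / 2 \<Longrightarrow> 81 / 256 \<le> B s"
      "\<And>s. \<bar>B1 s\<bar> \<le> 8 / r" "\<And>s. \<bar>B3 s\<bar> \<le> 336 / r ^ 3"
    and E: "integral {m - r..m + r} (\<lambda>s. (norm (a s))\<^sup>2) \<le> 1 / (16 * r)"
    and rad: "\<And>s. \<bar>s - m\<bar> \<le> r \<Longrightarrow> \<bar>g s \<bullet> T s\<bar> \<le> r ^ 3 / 200000 \<and> norm (g s) \<le> 5"
  obtains U I where "(U has_integral I) {m - r..m + r}" "I < 0"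
    "\<And>s. s \<in> {m - r..m + r} \<Longrightarrow>
       2 * (a s \<bullet> ((B2 s *\<^sub>R g s + (2 * B1 s) *\<^sub>R T s) + B s *\<^sub>R a s))
       - 3 * (norm (a s))\<^sup>2 * (T s \<bullet> (B1 s *\<^sub>R g s + B s *\<^sub>R T s)) \<le> U s"
proof -
  define \<mu> where "\<mu> = r ^ 3 / 200000"
  let ?p = "m - r" and ?q = "m + r"
  let ?J = "{?p..?q}"
  have pq: "?p \<le> ?q" using r by simp
  have contB: "continuous_on S B" "continuous_on S B1" "continuous_on S B2" "continuous_on S B3" for S
    using B(1-3) continuous_on_subset[OF B(4)]
    by (auto intro!: continuous_at_imp_continuous_on intro: DERIV_isCont)
  have dB: "has_density x y B B1" "has_density x y B1 B2" "has_density x y B2 B3" for x y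
    using B(1-3) contB
    by (auto intro!: has_density_of_derivative simp: has_real_derivative_iff_has_vector_derivative
        intro: has_vector_derivative_at_within)
  have end0: "B ?p = 0" "B ?q = 0" "B1 ?p = 0" "B1 ?q = 0" "B2 ?p = 0" "B2 ?q = 0"
    using B(5)[of ?p] B(5)[of ?q] r by auto
  have TT: "T s \<bullet> T s = 1" for s using nT[of s] power2_norm_eq_inner[of "T s"] by simp
  have dq: "has_density x y (\<lambda>s. g s \<bullet> T s) (\<lambda>s. 1 + g s \<bullet> a s)" for x y
    using has_density_inner[OF g T, of x y] by (simp add: TT)
  \<comment> \<open>The identity \<open>T \<bullet> a = 0\<close> is available only almost
    everywhere. Recording \<open>2 * (T \<bullet> a)\<close> as a density of the constant
    \<open>1\<close> lets it be integrated away without exceptional sets.\<close>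
  have dT: "has_density x y (\<lambda>s. 1 :: real) (\<lambda>s. 2 * (T s \<bullet> a s))" for x y
    using has_density_inner[OF T T, of x y] by (simp add: TT inner_commute[of "a _"])
  \<comment> \<open>Products that vanish at both end points have densities of integral zero. In this
    way \<open>g \<bullet> a\<close>, with \<open>g\<close> the position relative to the centre, is
    traded for the small radial velocity \<open>g \<bullet> T\<close>.\<close>
  have H1: "((\<lambda>s. B3 s * (g s \<bullet> T s) + B2 s * (1 + g s \<bullet> a s)) has_integral 0) ?J"
    using has_density_has_integral[OF has_density_scaleR[OF dB(3) dq] order_refl pq order_refl] by (simp add: end0)
  have H2: "((\<lambda>s. B1 s * (g s \<bullet> T s) + B s * (1 + g s \<bullet> a s)) has_integral 0) ?J"
    using has_density_has_integral[OF has_density_scaleR[OF dB(1) dq] order_refl pq order_refl] by (simp add: end0)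
  have H3: "((\<lambda>s. B2 s * 1 + B1 s * (2 * (T s \<bullet> a s))) has_integral 0) ?J"
    using has_density_has_integral[OF has_density_scaleR[OF dB(2) dT] order_refl pq order_refl] by (simp add: end0)
  have H4: "(B2 has_integral 0) ?J"
    using has_density_has_integral[OF dB(2) order_refl pq order_refl] by (simp add: end0)
  \<comment> \<open>\<open>k\<close> and \<open>c\<close> absorb the terms that contain the radial
    velocity, those free of \<open>a\<close> and the one with \<open>|a|^2\<close>
    respectively.\<close>
  define k where "k = 2 * (336 / r ^ 3 * \<mu>) + 2 / 25 * (8 / r * \<mu>)"
  define c where "c = 3 * (8 / r * \<mu>)"
  define U where "U s = (2 * (B3 s * (g s \<bullet> T s) + B2 s * (1 + g s \<bullet> a s)) + 2 * (B2 s * 1 + B1 s * (2 * (T s \<bullet> a s)))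
     + 2 / 25 * (B1 s * (g s \<bullet> T s) + B s * (1 + g s \<bullet> a s)) - 4 * B2 s) + ((k - 1 / 25 * B s) + c * (norm (a s))\<^sup>2)" for s
  have iB: "(B has_integral integral ?J B) ?J"
    by (intro integrable_integral integrable_continuous_real contB)
  have ia: "((\<lambda>s. (norm (a s))\<^sup>2) has_integral integral ?J (\<lambda>s. (norm (a s))\<^sup>2)) ?J"
    by (rule integrable_integral[OF a2])
  define I where "I = (2 * 0 + 2 * 0 + 2 / 25 * 0 - 4 * 0) + (((?q - ?p) * k - 1 / 25 * integral ?J B) + c * integral ?J (\<lambda>s. (norm (a s))\<^sup>2))"
  have ik: "((\<lambda>s. k) has_integral (?q - ?p) * k) ?J"
    using has_integral_const_real[of k ?p ?q] pq by simp
  have U: "(U has_integral I) ?J"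
    unfolding U_def[abs_def] I_def
    by (intro has_integral_add has_integral_diff has_integral_mult_right H1 H2 H3 H4 iB ia ik)
  have \<mu>0: "\<mu> > 0" using r by (simp add: \<mu>_def)
  \<comment> \<open>The gain is at least \<open>81 / 6400 * r\<close>, the losses at most
    \<open>68 / 10000 * r\<close> and \<open>3 / 400000 * r\<close>. The divisor
    \<open>200000\<close> in the bound on the radial velocity is there to make the losses this
    small.\<close>
  have "I < 0"
  proof -
    have "r * (81 / 256) \<le> integral {m - r / 2..m + r / 2} B"
    proof -
      have "((\<lambda>_. 81 / 256) has_integral ((m + r / 2) - (m - r / 2)) * (81 / 256)) {m - r / 2..m + r / 2}"
        using has_integral_const_real[of "81 / 256 :: real" "m - r / 2" "m + r / 2"] r by simp
      moreover have "(B has_integral integral {m - r / 2..m + r / 2} B) {m - r / 2..m + r / 2}"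
        by (intro integrable_integral integrable_continuous_real contB)
      ultimately have "((m + r / 2) - (m - r / 2)) * (81 / 256) \<le> integral {m - r / 2..m + r / 2} B"
      proof (rule has_integral_le)
        fix s assume "s \<in> {m - r / 2..m + r / 2}"
        then have "\<bar>s - m\<bar> \<le> r / 2" unfolding atLeastAtMost_iff abs_le_iff by linarith
        then show "81 / 256 \<le> B s" by (rule B(7))
      qed
      then show ?thesis by (simp add: algebra_simps)
    qed
    also have "\<dots> \<le> integral ?J B"
      using r B(6) by (intro integral_subset_le integrable_continuous_real contB) auto
    finally have b: "r * (81 / 256) \<le> integral ?J B" .
    have "c * integral ?J (\<lambda>s. (norm (a s))\<^sup>2) \<le> c * (1 / (16 * r))"
      using E r \<mu>0 by (intro mult_left_mono) (auto simp: c_def)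
    also have "\<dots> = 3 / 400000 * r" using r by (simp add: c_def \<mu>_def power3_eq_cube)
    finally have c: "c * integral ?J (\<lambda>s. (norm (a s))\<^sup>2) \<le> 3 / 400000 * r" .
    have r2: "r\<^sup>2 \<le> 1" using r by (simp add: power_le_one)
    have "k = 672 / 200000 + 16 / 5000000 * r\<^sup>2"
      using r by (simp add: k_def \<mu>_def power3_eq_cube power2_eq_square)
    then have "k \<le> 34 / 10000" using r2 by simp
    then have "(?q - ?p) * k \<le> (2 * r) * (34 / 10000)" using r by (intro mult_mono) (auto simp: k_def \<mu>_def)
    then have "I \<le> (2 * r) * (34 / 10000) - 1 / 25 * (r * (81 / 256)) + 3 / 400000 * r"
      using b c by (simp add: I_def)
    also have "\<dots> < 0" using r by simp
    finally show ?thesis .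
  qed
  moreover have "2 * (a s \<bullet> ((B2 s *\<^sub>R g s + (2 * B1 s) *\<^sub>R T s) + B s *\<^sub>R a s))
       - 3 * (norm (a s))\<^sup>2 * (T s \<bullet> (B1 s *\<^sub>R g s + B s *\<^sub>R T s)) \<le> U s" if s: "s \<in> ?J" for s
  proof -
    have sm: "\<bar>s - m\<bar> \<le> r" using s by (auto simp: abs_le_iff)
    define n q x y where "n = (norm (a s))\<^sup>2" and "q = g s \<bullet> T s" and "x = g s \<bullet> a s" and "y = T s \<bullet> a s"
    have na: "a s \<bullet> a s = n" unfolding n_def by (rule power2_norm_eq_inner[symmetric])
    have q: "\<bar>q\<bar> \<le> \<mu>" and g5: "norm (g s) \<le> 5" using rad[OF sm] by (auto simp: q_def \<mu>_def)
    have n0: "n \<ge> 0" by (simp add: n_def)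
    have eq: "2 * (a s \<bullet> ((B2 s *\<^sub>R g s + (2 * B1 s) *\<^sub>R T s) + B s *\<^sub>R a s))
       - 3 * (norm (a s))\<^sup>2 * (T s \<bullet> (B1 s *\<^sub>R g s + B s *\<^sub>R T s))
       = 2 * B2 s * x + 4 * B1 s * y - B s * n - 3 * n * (B1 s * q)"
      unfolding inner_add_right inner_scaleR_right na TT n_def[symmetric]
      by (simp add: q_def x_def y_def inner_commute[of "a s" "g s"] inner_commute[of "a s" "T s"] inner_commute[of "T s" "g s"] algebra_simps)
    have Us: "U s = 2 * B2 s * x + 4 * B1 s * y + 2 / 25 * (B s * x) + 1 / 25 * B s
        + (2 * (B3 s * q) + 2 / 25 * (B1 s * q) + k) + c * n"
      by (simp add: U_def n_def q_def x_def y_def algebra_simps)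
    \<comment> \<open>The square of \<open>a + g / 25\<close> is nonnegative, and
      \<open>|g| \<le> 5\<close>. Equality holds for a circle of radius \<open>5\<close> about the
      origin; integrated, the inequality is the lower bound on the curvature.\<close>
    have 1: "- n \<le> 2 / 25 * x + 1 / 25"
    proof -
      have "0 \<le> (norm (a s + (1 / 25) *\<^sub>R g s))\<^sup>2" by simp
      also have "\<dots> = n + 2 / 25 * x + (norm (g s))\<^sup>2 / 625"
        unfolding power2_norm_eq_inner inner_add_left inner_add_right inner_scaleR_left inner_scaleR_right na
        by (simp add: x_def inner_commute[of "a s" "g s"] add_divide_distrib)
      also have "\<dots> \<le> n + 2 / 25 * x + 1 / 25"
        using power_mono[OF g5, of 2] by simp
      finally show ?thesis by simp
    qed
    have "B s * (- n) \<le> B s * (2 / 25 * x + 1 / 25)" by (rule mult_left_mono[OF 1]) (use B(6) in simp)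
    then have 2: "- B s * n \<le> 2 / 25 * (B s * x) + 1 / 25 * B s" by (simp add: algebra_simps)
    have B1q: "\<bar>B1 s * q\<bar> \<le> 8 / r * \<mu>" unfolding abs_mult using B(8)[of s] q r by (intro mult_mono) auto
    have B3q: "\<bar>B3 s * q\<bar> \<le> 336 / r ^ 3 * \<mu>" unfolding abs_mult using B(9)[of s] q r by (intro mult_mono) auto
    have "n * (- (B1 s * q)) \<le> n * (8 / r * \<mu>)" using B1q n0 by (intro mult_left_mono) (auto simp: abs_le_iff)
    then have "3 * (n * (- (B1 s * q))) \<le> 3 * (n * (8 / r * \<mu>))" by simp
    then have 3: "- 3 * n * (B1 s * q) \<le> c * n" unfolding c_def by (simp only: ac_simps mult_minus_left mult_minus_right)
    have 4: "0 \<le> 2 * (B3 s * q) + 2 / 25 * (B1 s * q) + k"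
      using B1q B3q unfolding k_def abs_le_iff by linarith
    show ?thesis unfolding eq Us using 2 3 4 by linarith
  qed
  ultimately show thesis using U that by blast
qed

text \<open>The varied curve has energy at most that of \<open>g\<close> plus
  \<open>t * I + t^2 * C\<close> with \<open>I < 0\<close>. For small \<open>t\<close> it stays in
  the closed neighbourhood and remains injective on a period, hence is admissible, since there are
  no self-intersections to check; this contradicts minimality.\<close>

lemma outward_variation:
  assumes h: "h2_data L g T a" and nT: "\<And>s. norm (T s) = 1" and inj: "inj_on g {0..<L}"
    and E: "E \<ge> 1" "integral {0..L} (\<lambda>s. (norm (a s))\<^sup>2) \<le> E" "1 / E \<le> L" and \<epsilon>: "0 < \<epsilon>" "\<epsilon> \<le> 1 / 2"
    and r: "r = 1 / (16 * E)"
    and strand: "\<And>s. \<bar>s - L / 2\<bar> \<le> r \<Longrightarrow> Im (g s) \<ge> 4 \<and> \<bar>(g s - arc_centre) \<bullet> T s\<bar> \<le> r ^ 3 / 200000 \<and>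
       arc_radius - \<epsilon> \<le> norm (g s - arc_centre) \<and> norm (g s - arc_centre) < arc_radius + \<epsilon>"
    and ran: "range g \<subseteq> closure (tubular_nbhd linked_drops \<epsilon>)"
    and min: "\<And>\<gamma>. \<gamma> \<in> admissible_curves (tubular_nbhd linked_drops \<epsilon>) \<Longrightarrow>
       integral {0..L} (\<lambda>s. (norm (a s))\<^sup>2) \<le> bending_energy \<gamma>"
  shows False
proof -
  let ?\<Omega> = "tubular_nbhd linked_drops \<epsilon>"
  define m where "m = L / 2"
  have L: "L > 0" by (rule h2_data_pos[OF h])
  have r0: "0 < r" "r \<le> 1 / 16" using E(1) by (auto simp: r field_simps)
  have rL: "1 / (4 * E) \<le> m - r" "1 / (4 * E) \<le> L / 4"
  proof -
    have e: "1 / E = 16 * r" "1 / (4 * E) = 4 * r" by (simp_all add: r)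
    show "1 / (4 * E) \<le> m - r" "1 / (4 * E) \<le> L / 4" using E(3) r0 unfolding e m_def by auto
  qed
  define w where "w s = g s - arc_centre" for s
  let ?J = "{m - r..m + r}"
  have J: "s \<in> ?J \<longleftrightarrow> \<bar>s - m\<bar> \<le> r" for s
    unfolding atLeastAtMost_iff abs_le_iff by linarith
  have JL: "?J \<subseteq> {0..L}" using rL E(1) 
  proof -
    have "0 \<le> 1 / (4 * E)" using E(1) by simp
    then have "0 \<le> m - r" using rL(1) by linarith
    then show ?thesis unfolding m_def by auto
  qed
  obtain B B1 B2 B3 where B: "\<And>s. (B has_real_derivative B1 s) (at s)" "\<And>s. (B1 has_real_derivative B2 s) (at s)"
    "\<And>s. (B2 has_real_derivative B3 s) (at s)" "continuous_on UNIV B3"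
    "\<And>s. \<bar>s - m\<bar> \<ge> r \<Longrightarrow> B s = 0 \<and> B1 s = 0 \<and> B2 s = 0"
    "\<And>s. 0 \<le> B s \<and> B s \<le> 1" "\<And>s. \<bar>s - m\<bar> \<le> r / 2 \<Longrightarrow> 81 / 256 \<le> B s"
    "\<And>s. \<bar>B1 s\<bar> \<le> 8 / r" "\<And>s. \<bar>B2 s\<bar> \<le> 56 / r ^ 2" "\<And>s. \<bar>B3 s\<bar> \<le> 336 / r ^ 3"
    by (rule bump_function[OF r0(1)]) (rule that; assumption)
  have contB: "continuous_on S B" "continuous_on S B1" "continuous_on S B2" for S
    using B(1-3) by (auto intro!: continuous_at_imp_continuous_on intro: DERIV_isCont)
  have dB: "has_density x y B B1" "has_density x y B1 B2" for x y
    using B(1,2) contB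
    by (auto intro!: has_density_of_derivative simp: has_real_derivative_iff_has_vector_derivative
        intro: has_vector_derivative_at_within)
  have dT: "has_density x y T a" and dg: "has_density x y g T" for x y
    by (rule h2_data_density[OF h] h2_data_g_density[OF h])+
  have dw: "has_density x y w T" for x y using dg[of x y] by (simp add: has_density_def w_def)
  have contT: "continuous_on S T" and contg: "continuous_on S g" for S by (rule h2_data_continuous[OF h])+
  have contw: "continuous_on S w" for S unfolding w_def[abs_def] by (intro continuous_intros contg)
  have a2: "(\<lambda>s. (norm (a s))\<^sup>2) absolutely_integrable_on {x..y}" for x y by (rule h2_data_square_integrable[OF h])
  have a2i: "(\<lambda>s. (norm (a s))\<^sup>2) integrable_on {x..y}" for x y using a2 by (rule set_lebesgue_integral_eq_integral(1))
  have strand': "Im (w s) > 0" "\<bar>w s \<bullet> T s\<bar> \<le> r ^ 3 / 200000" "arc_radius - \<epsilon> \<le> norm (w s)" "norm (w s) < arc_radius + \<epsilon>"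
    if "\<bar>s - m\<bar> \<le> r" for s
    using strand[of s] that arc_height_bounds by (auto simp: w_def m_def arc_centre_def)
  have w5: "norm (w s) \<le> 5" if "\<bar>s - m\<bar> \<le> r" for s
    using strand'(4)[OF that] \<epsilon> arc_radius_bounds by linarith
  have EJ: "integral ?J (\<lambda>s. (norm (a s))\<^sup>2) \<le> E"
    using integral_subset_le[OF JL a2i a2i] E(2) by force
  have EJ': "integral ?J (\<lambda>s. (norm (a s))\<^sup>2) \<le> 1 / (16 * r)" using EJ E(1) by (simp add: r)
  define Z where "Z s = B2 s *\<^sub>R w s + (2 * B1 s) *\<^sub>R T s" for s
  define A where "A s = Z s + B s *\<^sub>R a s" for s
  define V where "V s = B1 s *\<^sub>R w s + B s *\<^sub>R T s" for s
  obtain U I where U: "(U has_integral I) ?J" "I < 0"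
    "\<And>s. s \<in> ?J \<Longrightarrow> 2 * (a s \<bullet> A s) - 3 * (norm (a s))\<^sup>2 * (T s \<bullet> V s) \<le> U s"
  proof -
    have rad: "\<bar>w s \<bullet> T s\<bar> \<le> r ^ 3 / 200000 \<and> norm (w s) \<le> 5" if "\<bar>s - m\<bar> \<le> r" for s
      using strand'(2)[OF that] w5[OF that] by simp
    show ?thesis
      by (rule outward_variation_integrand[OF dw dT nT a2i r0 B(1-8,10) EJ' rad])
         (assumption | rule that[unfolded A_def Z_def V_def])+
  qed
  have outside: "B s = 0" "V s = 0" "A s = 0" if "s \<notin> ?J" for s
    using B(5)[of s] that unfolding J by (auto simp: V_def A_def Z_def)
  \<comment> \<open>One constant for both vector fields: with
    \<open>1 \<le> 1 / r \<le> 1 / r^2\<close> it covers \<open>56 * 5 + 2 * 8\<close> for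
    \<open>Z\<close> and \<open>8 * 5 + 1\<close> for \<open>V\<close>.\<close>
  define K where "K = 297 / r\<^sup>2"
  have r2: "1 \<le> 1 / r\<^sup>2" "1 / r \<le> 1 / r\<^sup>2"
    using r0 by (auto simp: field_simps power2_eq_square mult_le_one)
  have K1: "K \<ge> 1" using r2 by (simp add: K_def)
  have Vb: "norm (V s) \<le> K" and Zb: "norm (Z s) \<le> K" for s
  proof -
    have "norm (V s) \<le> K \<and> norm (Z s) \<le> K"
    proof (cases "s \<in> ?J")
      case True
      then have w: "norm (w s) \<le> 5" by (rule w5[OF J[THEN iffD1]])
      have "norm (V s) \<le> \<bar>B1 s\<bar> * norm (w s) + \<bar>B s\<bar> * norm (T s)"
        unfolding V_def by (rule order_trans[OF norm_triangle_ineq]) simp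
      also have "\<dots> \<le> 8 / r * 5 + 1 * 1"
        using B(6)[of s] B(8)[of s] w nT r0 by (intro add_mono mult_mono) auto
      also have "\<dots> \<le> K" using r2 by (simp add: K_def)
      finally have 1: "norm (V s) \<le> K" .
      have "norm (Z s) \<le> \<bar>B2 s\<bar> * norm (w s) + (2 * \<bar>B1 s\<bar>) * norm (T s)"
        unfolding Z_def by (rule order_trans[OF norm_triangle_ineq]) (simp add: abs_mult)
      also have "\<dots> \<le> 56 / r ^ 2 * 5 + (2 * (8 / r)) * 1"
        using B(8)[of s] B(9)[of s] w nT r0 by (intro add_mono mult_mono) auto
      also have "\<dots> \<le> K" using r2 by (simp add: K_def)
      finally show ?thesis using 1 by simp
    next
      case False
      then have "B s = 0" "B1 s = 0" "B2 s = 0" using B(5)[of s] unfolding J by auto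
      then show ?thesis using K1 by (simp add: V_def Z_def)
    qed
    then show "norm (V s) \<le> K" "norm (Z s) \<le> K" by auto
  qed
  have Ab: "norm (A s) \<le> K + norm (a s)" for s
  proof -
    have "norm (A s) \<le> norm (Z s) + norm (B s *\<^sub>R a s)" unfolding A_def by (rule norm_triangle_ineq)
    also have "norm (B s *\<^sub>R a s) \<le> 1 * norm (a s)" unfolding norm_scaleR using B(6)[of s] by (intro mult_right_mono) auto
    finally show ?thesis using Zb[of s] by linarith
  qed
  \<comment> \<open>Where \<open>B\<close> is constant, this is a dilation about
    \<open>arc_centre\<close>.\<close>
  define gt where "gt t s = g s + t *\<^sub>R (B s *\<^sub>R w s)" for t s
  define ut where "ut t s = T s + t *\<^sub>R V s" for t s
  define acc where "acc t s = a s + t *\<^sub>R A s" for t s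
  have dV: "has_density x y V A" for x y
  proof -
    have "has_density x y (\<lambda>s. B1 s *\<^sub>R w s + B s *\<^sub>R T s) (\<lambda>s. (B2 s *\<^sub>R w s + B1 s *\<^sub>R T s) + (B1 s *\<^sub>R T s + B s *\<^sub>R a s))"
      by (intro has_density_add has_density_scaleR dB dw dT)
    moreover have "(\<lambda>s. (B2 s *\<^sub>R w s + B1 s *\<^sub>R T s) + (B1 s *\<^sub>R T s + B s *\<^sub>R a s)) = A"
      by (simp add: A_def Z_def fun_eq_iff scaleR_conv_of_real algebra_simps)
    ultimately show ?thesis by (simp add: V_def[abs_def])
  qed
  have dgt: "has_density x y (gt t) (ut t)" for t x y
    unfolding gt_def[abs_def] ut_def[abs_def] V_def[abs_def]
    by (intro has_density_add dg has_density_linear[OF _ bounded_linear_scaleR_right] has_density_scaleR dB dw)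
  have dut: "has_density x y (ut t) (acc t)" for t x y
    unfolding ut_def[abs_def] acc_def[abs_def]
    by (intro has_density_add dT has_density_linear[OF dV bounded_linear_scaleR_right])
  have contut: "continuous_on {x..y} (ut t)" for t x y by (rule has_density_continuous_on[OF dut])
  have utnz: "norm (ut t s) \<ge> 1 / 2" if "0 \<le> t" "t * K \<le> 1 / 2" for t s
  proof -
    have "norm (t *\<^sub>R V s) \<le> t * K" using that Vb[of s] by (simp add: mult_left_mono)
    then show ?thesis using that nT[of s] norm_triangle_ineq2[of "T s" "- (t *\<^sub>R V s)"] by (simp add: ut_def)
  qed
  have at2: "(\<lambda>s. (norm (acc t s))\<^sup>2) absolutely_integrable_on {x..y}" for t x y
  proof -
    \<comment> \<open>Expanding the square around \<open>a\<close> leaves \<open>|a|^2\<close> and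
      \<open>a\<close> with continuous coefficients and a continuous remainder, so each summand is
      integrable.\<close>
    have eq: "(norm (acc t s))\<^sup>2 = ((1 + t * B s)\<^sup>2 *\<^sub>R (norm (a s))\<^sup>2 + ((2 * (1 + t * B s) * t) *\<^sub>R Z s) \<bullet> a s) + t\<^sup>2 * (norm (Z s))\<^sup>2" for s
    proof -
      have "acc t s = (1 + t * B s) *\<^sub>R a s + t *\<^sub>R Z s" by (simp add: acc_def A_def algebra_simps)
      then show ?thesis
        unfolding power2_norm_eq_inner
        by (simp add: inner_add_left inner_add_right inner_commute[of "a s" "Z s"] power2_eq_square algebra_simps)
    qed
    have contZ: "continuous_on S Z" for S
      unfolding Z_def[abs_def] by (intro continuous_intros contB contw contT)
    show ?thesis unfolding eq
      by (intro set_integral_add(1) absolutely_integrable_scaleR_continuous absolutely_integrable_inner_continuous a2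
          has_density_abs_int[OF dT] absolutely_integrable_continuous_real continuous_intros contB contZ)
  qed
  define F where "F t s = (norm (acc t s))\<^sup>2 / norm (ut t s) ^ 3" for t s
  have Fint: "F t integrable_on {x..y}" if "0 \<le> t" "t * K \<le> 1 / 2" for t x y
  proof -
    have "ut t s \<noteq> 0" for s using utnz[OF that, of s] by auto
    then have "(\<lambda>s. (1 / norm (ut t s) ^ 3) *\<^sub>R (norm (acc t s))\<^sup>2) absolutely_integrable_on {x..y}"
      by (intro absolutely_integrable_scaleR_continuous at2 continuous_intros contut) auto
    then show ?thesis unfolding F_def[abs_def]
      using set_lebesgue_integral_eq_integral(1) by fastforce
  qed
  define C where "C = 164 * K ^ 3 * (2 * r + E)"
  have C: "C > 0" using K1 r0 E(1) by (simp add: C_def)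
  have energy: "integral {0..L} (F t) \<le> integral {0..L} (\<lambda>s. (norm (a s))\<^sup>2) + t * I + t\<^sup>2 * C"
    if t: "0 \<le> t" "t * K \<le> 1 / 2" for t
  proof -
    have d: "(\<lambda>s. F t s - (norm (a s))\<^sup>2) integrable_on {x..y}" for x y
      by (intro integrable_diff Fint[OF t] a2i)
    have "integral {0..L} (\<lambda>s. F t s - (norm (a s))\<^sup>2) = integral ?J (\<lambda>s. F t s - (norm (a s))\<^sup>2)"
    proof (rule integral_unique, rule has_integral_on_superset[OF integrable_integral[OF d] _ JL])
      show "F t s - (norm (a s))\<^sup>2 = 0" if "s \<notin> ?J" for s
        using outside[OF that] nT[of s] by (simp add: F_def acc_def ut_def)
    qed
    also have "\<dots> \<le> t * I + t\<^sup>2 * (164 * K ^ 3 * ((m + r - (m - r)) * 1 + integral ?J (\<lambda>s. (norm (a s))\<^sup>2)))"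
    proof (rule has_integral_le[OF integrable_integral[OF d]])
      show "((\<lambda>s. t * U s + t\<^sup>2 * (164 * K ^ 3 * (1 + (norm (a s))\<^sup>2))) has_integral
         t * I + t\<^sup>2 * (164 * K ^ 3 * ((m + r - (m - r)) * 1 + integral ?J (\<lambda>s. (norm (a s))\<^sup>2)))) ?J"
        using has_integral_const_real[of "1 :: real" "m - r" "m + r"] r0
        by (intro has_integral_add has_integral_mult_right U(1) integrable_integral a2i) auto
      fix s assume s: "s \<in> ?J"
      have "F t s \<le> (norm (a s))\<^sup>2 + t * (2 * (a s \<bullet> A s) - 3 * (norm (a s))\<^sup>2 * (T s \<bullet> V s)) + t\<^sup>2 * (164 * K ^ 3 * (1 + (norm (a s))\<^sup>2))"
        unfolding F_def acc_def ut_def by (rule variation_integrand_bound[OF nT Vb Ab K1 t])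
      also have "t * (2 * (a s \<bullet> A s) - 3 * (norm (a s))\<^sup>2 * (T s \<bullet> V s)) \<le> t * U s"
        using U(3)[OF s] t(1) by (rule mult_left_mono)
      finally show "F t s - (norm (a s))\<^sup>2 \<le> t * U s + t\<^sup>2 * (164 * K ^ 3 * (1 + (norm (a s))\<^sup>2))" by simp
    qed
    also have "\<dots> \<le> t * I + t\<^sup>2 * C"
      unfolding C_def using EJ K1 by (intro add_left_mono mult_left_mono) auto
    finally have "integral {0..L} (\<lambda>s. F t s - (norm (a s))\<^sup>2) \<le> t * I + t\<^sup>2 * C" .
    then show ?thesis using Henstock_Kurzweil_Integration.integral_diff[OF Fint[OF t] a2i] by simp
  qed
  have pinj: "x = y" if "g x = g y" "\<bar>x - y\<bar> < L" for x y
    by (rule periodic_inj[OF inj h2_data_periodic[OF h] L that])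
  \<comment> \<open>Within the length \<delta> the tangent changes by at most \<open>1 / 2\<close>,
    and \<open>1 / E \<le> L\<close> keeps the pieces of length \<delta> at both ends of the period
    outside the support of \<open>B\<close>.\<close>
  define \<delta> where "\<delta> = 1 / (4 * E)"
  have \<delta>: "0 < \<delta>" "\<delta> \<le> m - r" "\<delta> < L" using rL E(1) L by (auto simp: \<delta>_def)
  \<comment> \<open>By compactness and injectivity, points whose parameters are at least \<delta>
    apart around the circle keep a positive distance.\<close>
  obtain m0 where m0: "m0 > 0" "\<And>x y. x \<in> {0..L} \<Longrightarrow> y \<in> {0..L} \<Longrightarrow> \<delta> \<le> y - x \<Longrightarrow> y - x \<le> L - \<delta> \<Longrightarrow> m0 \<le> norm (g y - g x)"
  proof -
    let ?C = "({0..L} \<times> {0..L}) \<inter> {p. \<delta> \<le> snd p - fst p} \<inter> {p. snd p - fst p \<le> L - \<delta>}"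
    have comp: "compact ?C"
      by (intro compact_Int_closed compact_Times compact_Icc closed_Collect_le continuous_intros)
    show ?thesis
    proof (cases "?C = {}")
      case True
      show ?thesis by (rule that[of 1]) (use True in \<open>auto simp: set_eq_iff\<close>)
    next
      case False
      have cont: "continuous_on ?C (\<lambda>p. norm (g (snd p) - g (fst p)))"
        by (intro continuous_intros continuous_on_compose2[OF contg[of UNIV]]) auto
      obtain p where p: "p \<in> ?C" "\<forall>q\<in>?C. norm (g (snd p) - g (fst p)) \<le> norm (g (snd q) - g (fst q))"
        using continuous_attains_inf[OF comp False cont] by blast
      show ?thesis
      proof (rule that[of "norm (g (snd p) - g (fst p))"])
        have "g (snd p) \<noteq> g (fst p)" using pinj[of "snd p" "fst p"] p(1) \<delta>(1) by auto
        then show "norm (g (snd p) - g (fst p)) > 0" by simp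
        show "norm (g (snd p) - g (fst p)) \<le> norm (g y - g x)"
          if "x \<in> {0..L}" "y \<in> {0..L}" "\<delta> \<le> y - x" "y - x \<le> L - \<delta>" for x y
          using p(2)[rule_format, of "(x, y)"] that by simp
      qed
    qed
  qed
  \<comment> \<open>The distance to the centre attains its maximum on the strand, so the strict
    inequality there leaves a uniform margin.\<close>
  obtain s1 where s1: "s1 \<in> ?J" "\<And>s. s \<in> ?J \<Longrightarrow> norm (w s) \<le> norm (w s1)"
  proof -
    have "?J \<noteq> {}" using r0 by simp
    from continuous_attains_sup[OF compact_Icc this continuous_on_norm[OF contw]] show ?thesis
      using that by blast
  qed
  have gap: "norm (w s1) < arc_radius + \<epsilon>" "0 < norm (w s1)"
    using strand'(3,4)[of s1] s1(1) \<epsilon> arc_radius_bounds unfolding J by auto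
  \<comment> \<open>The four bounds serve, in this order, a nonvanishing speed, staying inside the
    outer circle, injectivity, and the sign of \<open>I + t0 * C\<close>.\<close>
  define t0 where "t0 = min (min (1 / (4 * K)) ((arc_radius + \<epsilon> - norm (w s1)) / (2 * norm (w s1)))) (min (m0 / 20) (- I / (2 * C)))"
  have t0: "t0 > 0" using K1 gap m0(1) U(2) C by (simp add: t0_def divide_neg_pos)
  have t0b: "t0 * K \<le> 1 / 4" "(1 + t0) * norm (w s1) < arc_radius + \<epsilon>" "10 * t0 < m0" "t0 * C < - I"
  proof -
    have "t0 * K \<le> 1 / (4 * K) * K" using K1 by (intro mult_right_mono) (auto simp: t0_def)
    then show "t0 * K \<le> 1 / 4" using K1 by simp
    have "t0 * norm (w s1) \<le> (arc_radius + \<epsilon> - norm (w s1)) / (2 * norm (w s1)) * norm (w s1)"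
      by (intro mult_right_mono) (auto simp: t0_def)
    also have "\<dots> = (arc_radius + \<epsilon> - norm (w s1)) / 2" using gap by simp
    finally have tw: "t0 * norm (w s1) \<le> (arc_radius + \<epsilon> - norm (w s1)) / 2" .
    have "(1 + t0) * norm (w s1) = norm (w s1) + t0 * norm (w s1)" by (simp add: algebra_simps)
    then show "(1 + t0) * norm (w s1) < arc_radius + \<epsilon>" using tw gap by simp
    have "t0 \<le> m0 / 20" by (simp add: t0_def)
    then show "10 * t0 < m0" using m0(1) by simp
    have "t0 * C \<le> - I / (2 * C) * C" using C by (intro mult_right_mono) (auto simp: t0_def)
    then show "t0 * C < - I" using C U(2) by simp
  qed
  have t0K: "t0 * K \<le> 1 / 2" using t0b(1) by simp
  have inside: "gt t0 s \<in> closure ?\<Omega>" for s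
  proof (cases "B s = 0")
    case True
    then show ?thesis using ran by (auto simp: gt_def)
  next
    case False
    then have sJ: "s \<in> ?J" using outside(1) by blast
    then have s: "\<bar>s - m\<bar> \<le> r" by (rule J[THEN iffD1])
    have B01: "0 < B s" "B s \<le> 1" using B(6)[of s] False by auto
    define w' where "w' = (1 + t0 * B s) *\<^sub>R w s"
    have c1: "1 < 1 + t0 * B s" "1 + t0 * B s \<le> 1 + t0 * 1" using B01 t0 by auto
    have w0: "0 < norm (w s)" using strand'(3)[OF s] \<epsilon> arc_radius_bounds by linarith
    have nw': "norm w' = (1 + t0 * B s) * norm (w s)" using c1 by (simp add: w'_def)
    \<comment> \<open>Pushing outwards preserves the lower bound on the radius, so only the outer
      circle restricts \<open>t0\<close>.\<close>
    have "1 * norm (w s) < norm w'" unfolding nw' using c1 w0 by (intro mult_strict_right_mono) auto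
    then have lo: "arc_radius - \<epsilon> < norm w'" using strand'(3)[OF s] by simp
    have "norm w' \<le> (1 + t0 * 1) * norm (w s1)"
      unfolding nw' using c1 s1(2)[OF sJ] t0 by (intro mult_mono) auto
    then have hi: "norm w' < arc_radius + \<epsilon>" using t0b(2) by simp
    have "Im w' \<ge> 0" using strand'(1)[OF s] c1 by (simp add: w'_def)
    then have "arc_centre + w' \<in> ?\<Omega>"
      using lo hi w0 nw' c1 by (intro tubular_nbhd_near_linking_arc) (auto simp: abs_less_iff)
    moreover have "gt t0 s = arc_centre + w'" by (simp add: gt_def w'_def w_def algebra_simps)
    ultimately show ?thesis using closure_subset by auto
  qed
  \<comment> \<open>For close parameters the varied velocity stays within
    \<open>1 / 2 + 1 / 4\<close> of a unit vector. For parameters close across the end of the period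
    nothing has been moved. Otherwise the distance \<open>m0\<close> exceeds the two displacements,
    each at most \<open>5 * t0\<close>.\<close>
  have gt_inj: "gt t0 x \<noteq> gt t0 y" if xy: "0 \<le> x" "x < y" "y < L" for x y
  proof -
    consider "y - x \<le> \<delta>" | "y - x \<ge> L - \<delta>" | "\<delta> \<le> y - x" "y - x \<le> L - \<delta>" by linarith
    then show ?thesis
    proof cases
      case 1
      have "norm ((gt t0 y - gt t0 x) - (y - x) *\<^sub>R T x) \<le> 3 / 4 * (y - x)"
      proof -
        have hi: "((\<lambda>s. ut t0 s - T x) has_integral (gt t0 y - gt t0 x) - (y - x) *\<^sub>R T x) {x..y}"
          using has_integral_diff[OF has_density_has_integral[OF dgt[of x y t0], of x y] has_integral_const_real[of "T x" x y]] xy by simp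
        have b: "norm (ut t0 s - T x) \<le> 3 / 4" if s: "s \<in> {x..y} - {}" for s
        proof -
          have sx: "\<bar>s - x\<bar> \<le> \<delta>" "\<bar>s - x\<bar> \<le> L" using s 1 \<delta>(3) by auto
          have "(norm (T s - T x))\<^sup>2 \<le> E * \<bar>s - x\<bar>"
            by (rule h2_data_holder[OF h E(2) sx(2)])
          also have "\<dots> \<le> E * \<delta>" using sx E(1) by (intro mult_left_mono) auto
          also have "\<dots> = (1 / 2)\<^sup>2" using E(1) by (simp add: \<delta>_def power2_eq_square)
          finally have T2: "norm (T s - T x) \<le> 1 / 2" by (rule power2_le_imp_le) simp
          have "norm (t0 *\<^sub>R V s) \<le> t0 * K" using t0 Vb[of s] by (simp add: mult_left_mono)
          then have "norm (t0 *\<^sub>R V s) \<le> 1 / 4" using t0b(1) by linarith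
          moreover have "norm (ut t0 s - T x) = norm ((T s - T x) + t0 *\<^sub>R V s)" by (simp add: ut_def algebra_simps)
          ultimately show ?thesis using T2 norm_triangle_ineq[of "T s - T x" "t0 *\<^sub>R V s"] by linarith
        qed
        show ?thesis using has_integral_bound_real[OF _ finite.emptyI hi b] xy by simp
      qed
      then show ?thesis using xy nT[of x] by auto
    next
      case 2
      then have "x \<le> \<delta>" "y \<ge> L - \<delta>" using xy by auto
      then have "\<bar>x - m\<bar> \<ge> r" "\<bar>y - m\<bar> \<ge> r" using \<delta> by (auto simp: m_def)
      then have "B x = 0" "B y = 0" using B(5) by auto
      moreover have "g x \<noteq> g y" using pinj[of x y] xy by auto
      ultimately show ?thesis by (simp add: gt_def)
    next
      case 3
      have "m0 \<le> norm (g y - g x)" by (rule m0(2)) (use 3 xy in auto)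
      moreover have "norm (t0 *\<^sub>R (B s *\<^sub>R w s)) \<le> 5 * t0" for s
      proof (cases "s \<in> ?J")
        case True
        then have "norm (w s) \<le> 5" by (rule w5[OF J[THEN iffD1]])
        then have "\<bar>B s\<bar> * norm (w s) \<le> 1 * 5" using B(6)[of s] by (intro mult_mono) auto
        then have "t0 * (\<bar>B s\<bar> * norm (w s)) \<le> t0 * 5" using t0 by simp
        then show ?thesis using t0 by (simp add: abs_mult ac_simps)
      next
        case False
        then show ?thesis using outside(1)[OF False] t0 by simp
      qed
      note this[of x] this[of y]
      moreover have "norm (g y - g x) \<le> norm (gt t0 y - gt t0 x) + norm (t0 *\<^sub>R (B x *\<^sub>R w x)) + norm (t0 *\<^sub>R (B y *\<^sub>R w y))"
      proof -
        have "g y - g x = (gt t0 y - gt t0 x) + t0 *\<^sub>R (B x *\<^sub>R w x) - t0 *\<^sub>R (B y *\<^sub>R w y)" by (simp add: gt_def)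
        then show ?thesis by (metis norm_triangle_ineq norm_triangle_ineq4 order_trans add_right_mono)
      qed
      ultimately have "norm (gt t0 y - gt t0 x) > 0" using t0b(3) by linarith
      then show ?thesis by auto
    qed
  qed
  have B0: "B 0 = 0" "B L = 0" "V 0 = 0" "V L = 0"
  proof -
    have "\<bar>0 - m\<bar> \<ge> r" "\<bar>L - m\<bar> \<ge> r" using \<delta> by (auto simp: m_def)
    then show "B 0 = 0" "B L = 0" "V 0 = 0" "V L = 0" using B(5)[of 0] B(5)[of L] by (auto simp: V_def)
  qed
  obtain \<gamma> where \<gamma>: "\<gamma> \<in> admissible_curves ?\<Omega>" "bending_energy \<gamma> \<le> integral {0..L} (\<lambda>s. (norm (acc t0 s))\<^sup>2 / norm (ut t0 s) ^ 3)"
  proof (rule closed_path_admissible[OF L dgt _ dut, of t0])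
    show "gt t0 L = gt t0 0" using h2_data_periodic[OF h, of 0] by (simp add: gt_def B0)
    show "ut t0 L = ut t0 0" using h2_data_periodic'[OF h, of 0] by (simp add: ut_def B0)
    show "ut t0 s \<noteq> 0" for s using utnz[of t0 s] t0 t0K by auto
    show "(\<lambda>s. (norm (acc t0 s))\<^sup>2) integrable_on {0..L}" using at2 by (rule set_lebesgue_integral_eq_integral(1))
    show "parallel (ut t0 s) (ut t0 t)" if "0 \<le> s" "s < L" "0 \<le> t" "t < L" "s \<noteq> t" "gt t0 s = gt t0 t" for s t
      using gt_inj[of s t] gt_inj[of t s] that by (metis linorder_neqE_linordered_idom)
  qed (use inside in auto)
  have "integral {0..L} (\<lambda>s. (norm (a s))\<^sup>2) \<le> integral {0..L} (F t0)"
    using min[OF \<gamma>(1)] \<gamma>(2) by (simp add: F_def[abs_def])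
  also have "\<dots> \<le> integral {0..L} (\<lambda>s. (norm (a s))\<^sup>2) + t0 * I + t0\<^sup>2 * C"
    by (rule energy) (use t0 t0K in auto)
  finally have "0 \<le> t0 * (I + t0 * C)" by (simp add: power2_eq_square algebra_simps)
  moreover have "t0 * (I + t0 * C) < 0" using t0 t0b(4) by (intro mult_pos_neg) auto
  ultimately show False by simp
qed

section \<open>An admissible curve along the linked drops\<close>

lemma parallel_refl: "parallel v v"
  unfolding parallel_def by (intro exI[of _ 1]) simp

lemma parallel_sym:
  assumes "parallel v w"
  shows "parallel w v"
proof -
  obtain k where "k \<noteq> 0" "v = k *\<^sub>R w" using assms by (auto simp: parallel_def)
  then show ?thesis unfolding parallel_def by (intro exI[of _ "1 / k"]) simp
qed

lemma parallel_trans: "parallel u v \<Longrightarrow> parallel v w \<Longrightarrow> parallel u w"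
  unfolding parallel_def by (metis mult_eq_0_iff scaleR_scaleR)

lemma parallel_minus: "parallel v w \<Longrightarrow> parallel (- v) w"
  unfolding parallel_def by (metis neg_equal_0_iff_equal scaleR_minus_left)

lemma mirror_eq: "mirror z = - cnj z"
  by (simp add: mirror_def complex_eq_iff)

lemma parallel_mirror: "parallel v w \<Longrightarrow> parallel (mirror v) (mirror w)"
  unfolding parallel_def mirror_eq by auto

text \<open>A path comes with its initial and final states, each a point with a unit tangent, so
  that concatenation only has to match states; \<open>Q\<close> restricts position and tangent along
  the way.\<close>

definition unit_speed_path :: "(complex \<Rightarrow> complex \<Rightarrow> bool) \<Rightarrow> complex \<Rightarrow> complex \<Rightarrow> complex \<Rightarrow> complex \<Rightarrow> bool" where
  "unit_speed_path Q x v y w \<longleftrightarrow> (\<exists>l>0. \<exists>g T a. has_density 0 l g T \<and> has_density 0 l T a \<and>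
     (\<lambda>s. (norm (a s))\<^sup>2) integrable_on {0..l} \<and> (\<forall>s\<in>{0..l}. norm (T s) = 1 \<and> Q (g s) (T s)) \<and>
     g 0 = x \<and> T 0 = v \<and> g l = y \<and> T l = w)"

lemma unit_speed_path_trans:
  assumes 1: "unit_speed_path Q x v y w" and 2: "unit_speed_path Q y w z u"
  shows "unit_speed_path Q x v z u"
proof -
  obtain l1 g1 T1 a1 where 1: "l1 > 0" "has_density 0 l1 g1 T1" "has_density 0 l1 T1 a1"
    "(\<lambda>s. (norm (a1 s))\<^sup>2) integrable_on {0..l1}" "\<forall>s\<in>{0..l1}. norm (T1 s) = 1 \<and> Q (g1 s) (T1 s)"
    "g1 0 = x" "T1 0 = v" "g1 l1 = y" "T1 l1 = w"
    using 1 unfolding unit_speed_path_def by blast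
  obtain l2 g2 T2 a2 where 2: "l2 > 0" "has_density 0 l2 g2 T2" "has_density 0 l2 T2 a2"
    "(\<lambda>s. (norm (a2 s))\<^sup>2) integrable_on {0..l2}" "\<forall>s\<in>{0..l2}. norm (T2 s) = 1 \<and> Q (g2 s) (T2 s)"
    "g2 0 = y" "T2 0 = w" "g2 l2 = z" "T2 l2 = u"
    using 2 unfolding unit_speed_path_def by blast
  define glue :: "(real \<Rightarrow> complex) \<Rightarrow> (real \<Rightarrow> complex) \<Rightarrow> real \<Rightarrow> complex"
    where "glue f1 f2 s = (if s \<le> l1 then f1 s else f2 (s - l1))" for f1 f2 s
  have G: "has_density 0 (l1 + l2) (glue f1 f2) (glue b1 b2)"
    if f: "has_density 0 l1 f1 b1" "has_density 0 l2 f2 b2" "f1 l1 = f2 0" for f1 f2 b1 b2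
  proof (rule has_density_combine[of 0 l1])
    show "has_density 0 l1 (glue f1 f2) (glue b1 b2)"
      by (rule has_density_cong[OF f(1), of _ "{}"]) (auto simp: glue_def)
    have "has_density l1 (l1 + l2) (\<lambda>s. f2 (s - l1)) (\<lambda>s. 1 *\<^sub>R b2 (s - l1))"
      by (rule has_density_compose[where \<phi> = "\<lambda>s. s - l1" and \<phi>' = "\<lambda>_. 1"])
         (use f(2) in \<open>auto intro!: derivative_eq_intros inj_onI\<close>)
    then show "has_density l1 (l1 + l2) (glue f1 f2) (glue b1 b2)"
      by (rule has_density_cong[where S = "{l1}"]) (use f(3) in \<open>auto simp: glue_def\<close>)
  qed (use 1(1) 2(1) in auto)
  have "(\<lambda>s. (norm (glue a1 a2 s))\<^sup>2) integrable_on {0..l1 + l2}"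
  proof (rule Henstock_Kurzweil_Integration.integrable_combine[of 0 l1])
    show "(\<lambda>s. (norm (glue a1 a2 s))\<^sup>2) integrable_on {0..l1}"
      by (rule integrable_eq[OF 1(4)]) (auto simp: glue_def)
    have "(\<lambda>s. (norm (a2 s))\<^sup>2) absolutely_integrable_on {l1 + - l1..(l1 + l2) + - l1}"
      using 2(4) by (intro nonnegative_absolutely_integrable_1) auto
    then have "(\<lambda>s. (norm (a2 (s + - l1)))\<^sup>2) integrable_on {l1..l1 + l2}"
      by (intro set_lebesgue_integral_eq_integral(1) integrable_translate(1)[where f = "\<lambda>s. (norm (a2 s))\<^sup>2"])
    then show "(\<lambda>s. (norm (glue a1 a2 s))\<^sup>2) integrable_on {l1..l1 + l2}"
      by (rule integrable_spike_finite[of "{l1}", rotated 2]) (auto simp: glue_def)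
  qed (use 1(1) 2(1) in auto)
  moreover have "\<forall>s\<in>{0..l1 + l2}. norm (glue T1 T2 s) = 1 \<and> Q (glue g1 g2 s) (glue T1 T2 s)"
    using bspec[OF 1(5)] bspec[OF 2(5)] by (auto simp: glue_def)
  moreover have "l1 + l2 > 0" "glue g1 g2 0 = x" "glue T1 T2 0 = v" "glue g1 g2 (l1 + l2) = z" "glue T1 T2 (l1 + l2) = u"
    using 1(1,6,7) 2(1,8,9) by (auto simp: glue_def)
  moreover have "has_density 0 (l1 + l2) (glue g1 g2) (glue T1 T2)" "has_density 0 (l1 + l2) (glue T1 T2) (glue a1 a2)"
    using G[OF 1(2) 2(2)] G[OF 1(3) 2(3)] 1(8,9) 2(6,7) by simp_all
  ultimately show ?thesis
    unfolding unit_speed_path_def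
    by (intro exI[of _ "l1 + l2"] conjI exI[of _ "glue g1 g2"] exI[of _ "glue T1 T2"] exI[of _ "glue a1 a2"])
qed

text \<open>\<sigma> is the orientation: the arc of length \<open>r * |\<beta> - \<alpha>|\<close>
  is run through with angular speed \<open>\<sigma> / r\<close>.\<close>

lemma unit_speed_path_arc:
  assumes r: "r > 0" and \<sigma>: "\<sigma> = 1 \<and> \<alpha> < \<beta> \<or> \<sigma> = - 1 \<and> \<beta> < \<alpha>"
    and Q: "\<And>\<theta>. \<theta> \<in> closed_segment \<alpha> \<beta> \<Longrightarrow> Q (z + of_real r * cis \<theta>) (of_real \<sigma> * \<i> * cis \<theta>)"
  shows "unit_speed_path Q (z + of_real r * cis \<alpha>) (of_real \<sigma> * \<i> * cis \<alpha>) (z + of_real r * cis \<beta>) (of_real \<sigma> * \<i> * cis \<beta>)"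
proof -
  define l where "l = r * \<bar>\<beta> - \<alpha>\<bar>"
  have l: "l > 0" using r \<sigma> by (auto simp: l_def)
  define \<theta> where "\<theta> s = \<alpha> + \<sigma> / r * s" for s
  define g where "g s = z + of_real r * cis (\<theta> s)" for s
  define T where "T s = of_real \<sigma> * \<i> * cis (\<theta> s)" for s
  define a where "a s = - (of_real (1 / r) * cis (\<theta> s))" for s
  have \<sigma>2: "\<sigma> * \<sigma> = 1" using \<sigma> by auto
  have end': "\<theta> 0 = \<alpha>" "\<theta> l = \<beta>" using \<sigma> r by (auto simp: \<theta>_def l_def)
  have \<theta>: "\<theta> s \<in> closed_segment \<alpha> \<beta>" if "s \<in> {0..l}" for s
  proof -
    have "0 \<le> s / r" "s / r \<le> \<bar>\<beta> - \<alpha>\<bar>" using that r by (auto simp: l_def field_simps)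
    then show ?thesis using \<sigma> by (auto simp: \<theta>_def closed_segment_eq_real_ivl)
  qed
  have dc: "((\<lambda>s. cis (\<theta> s)) has_vector_derivative (\<sigma> / r) *\<^sub>R (\<i> * cis (\<theta> s))) (at s within S)" for s S
    unfolding has_vector_derivative_def \<theta>_def using r by (auto intro!: derivative_eq_intros)
  have dg: "(g has_vector_derivative T s) (at s within S)" for s S
  proof -
    have "((\<lambda>s. z + of_real r * cis (\<theta> s)) has_vector_derivative 0 + of_real r * ((\<sigma> / r) *\<^sub>R (\<i> * cis (\<theta> s)))) (at s within S)"
      by (intro has_vector_derivative_add has_vector_derivative_const has_vector_derivative_mult_right dc)
    moreover have "0 + of_real r * ((\<sigma> / r) *\<^sub>R (\<i> * cis (\<theta> s))) = T s" using r by (simp add: T_def scaleR_conv_of_real)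
    ultimately show ?thesis unfolding g_def[abs_def] by simp
  qed
  have dT: "(T has_vector_derivative a s) (at s within S)" for s S
  proof -
    have "(T has_vector_derivative of_real \<sigma> * \<i> * ((\<sigma> / r) *\<^sub>R (\<i> * cis (\<theta> s)))) (at s within S)"
      unfolding T_def[abs_def] by (intro has_vector_derivative_mult_right dc)
    also have "of_real \<sigma> * \<i> * ((\<sigma> / r) *\<^sub>R (\<i> * cis (\<theta> s))) = of_real (\<sigma> * \<sigma> / r) * (\<i> * \<i>) * cis (\<theta> s)"
      by (simp only: scaleR_conv_of_real of_real_mult of_real_divide times_divide_eq_left times_divide_eq_right ac_simps)
    also have "\<dots> = a s" by (simp add: \<sigma>2 a_def)
    finally show ?thesis .
  qed
  have cont: "continuous_on S (\<lambda>s. cis (\<theta> s))" for S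
    using dc by (rule continuous_on_vector_derivative)
  have contT: "continuous_on {0..l} T" and conta: "continuous_on {0..l} a"
    unfolding T_def[abs_def] a_def[abs_def]
    by (intro continuous_on_mult_left continuous_on_minus cont)+
  have "has_density 0 l g T" by (rule has_density_of_derivative[OF dg contT])
  moreover have "has_density 0 l T a" by (rule has_density_of_derivative[OF dT conta])
  moreover have "(\<lambda>s. (norm (a s))\<^sup>2) integrable_on {0..l}"
    by (intro integrable_continuous_real continuous_on_power continuous_on_norm conta)
  moreover have "norm (T s) = 1 \<and> Q (g s) (T s)" if "s \<in> {0..l}" for s
    using Q[OF \<theta>[OF that]] \<sigma> by (auto simp: g_def T_def norm_mult)
  ultimately show ?thesis
    unfolding unit_speed_path_def using l end' by (intro exI[of _ l] conjI exI[of _ g] exI[of _ T] exI[of _ a] ballI) (simp_all add: g_def T_def)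
qed

lemma unit_speed_path_mirror:
  assumes "unit_speed_path Q x v y w" and Q: "\<And>p v. Q p v \<Longrightarrow> Q (mirror p) (mirror v)"
  shows "unit_speed_path Q (mirror x) (mirror v) (mirror y) (mirror w)"
proof -
  obtain l g T a where *: "l > 0" "has_density 0 l g T" "has_density 0 l T a"
    "(\<lambda>s. (norm (a s))\<^sup>2) integrable_on {0..l}" "\<forall>s\<in>{0..l}. norm (T s) = 1 \<and> Q (g s) (T s)"
    "g 0 = x" "T 0 = v" "g l = y" "T l = w"
    using assms(1) unfolding unit_speed_path_def by blast
  have lin: "bounded_linear mirror"
    unfolding mirror_eq[abs_def] by (intro bounded_linear_minus bounded_linear_cnj)
  have n: "norm (mirror z) = norm z" for z by (simp add: mirror_eq)
  show ?thesis
    unfolding unit_speed_path_def using * has_density_linear[OF *(2) lin] has_density_linear[OF *(3) lin] Q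
    by (intro exI[of _ l] conjI exI[of _ "\<lambda>s. mirror (g s)"] exI[of _ "\<lambda>s. mirror (T s)"] exI[of _ "\<lambda>s. mirror (a s)"])
       (auto simp: n)
qed

text \<open>The bound is the energy integral of one fixed loop and so does not depend on \<Omega>.
  Self-intersections are tangential because \<open>Q\<close> allows a single direction, up to a
  factor, at each point.\<close>

lemma unit_speed_loop_admissible:
  assumes "unit_speed_path Q x v x v" and Q: "\<And>p v w. Q p v \<Longrightarrow> Q p w \<Longrightarrow> parallel v w" "\<And>p v. Q p v \<Longrightarrow> p \<in> S"
  obtains E where "\<And>\<Omega>. S \<subseteq> closure \<Omega> \<Longrightarrow> \<exists>\<gamma>\<in>admissible_curves \<Omega>. bending_energy \<gamma> \<le> E"
proof -
  obtain l g T a where *: "l > 0" "has_density 0 l g T" "has_density 0 l T a"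
    "(\<lambda>s. (norm (a s))\<^sup>2) integrable_on {0..l}" "\<forall>s\<in>{0..l}. norm (T s) = 1 \<and> Q (g s) (T s)"
    "g 0 = x" "T 0 = v" "g l = x" "T l = v"
    using assms(1) unfolding unit_speed_path_def by blast
  show thesis
  proof (rule that)
    fix \<Omega> assume \<Omega>: "S \<subseteq> closure \<Omega>"
    obtain \<gamma> where "\<gamma> \<in> admissible_curves \<Omega>" "bending_energy \<gamma> \<le> integral {0..l} (\<lambda>s. (norm (a s))\<^sup>2 / norm (T s) ^ 3)"
    proof (rule closed_path_admissible[OF *(1,2) _ *(3) _ _ *(4)])
      have Qs: "Q (g s) (T s)" "norm (T s) = 1" if "0 \<le> s" "s < l" for s
        using bspec[OF *(5), of s] that by auto
      show "T s \<noteq> 0" if "0 \<le> s" "s < l" for s using Qs(2)[OF that] by auto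
      show "g s \<in> closure \<Omega>" if "0 \<le> s" "s < l" for s using Qs(1)[OF that] Q(2) \<Omega> by auto
      show "parallel (T s) (T t)" if "0 \<le> s" "s < l" "0 \<le> t" "t < l" "s \<noteq> t" "g s = g t" for s t
        using Qs(1)[of s] Qs(1)[of t] that Q(1) by auto
    qed (use * in auto)
    then show "\<exists>\<gamma>\<in>admissible_curves \<Omega>. bending_energy \<gamma> \<le> integral {0..l} (\<lambda>s. (norm (a s))\<^sup>2 / norm (T s) ^ 3)"
      by blast
  qed
qed

text \<open>
  As the arcs are tangent to each other wherever they meet, a single direction at each point suffices.
\<close>

definition drop_direction :: "complex \<Rightarrow> complex" where
  "drop_direction p = (if Re (drop_frame p) \<le> sqrt 3 / 2 then \<i> * (p - drop_centre)
     else if Im (drop_frame p) < 0 then \<i> * (p - (drop_centre + 2 * cis (7 * pi / 12)))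
     else \<i> * (p - (drop_centre + 2 * cis (11 * pi / 12))))"

text \<open>The drops meet the half-plane \<open>Im p \<ge> 0\<close> in the cusps only, and there
  the tangent of the linking arc is also theirs.\<close>

definition curve_direction :: "complex \<Rightarrow> complex" where
  "curve_direction p = (if Im p \<ge> 0 then \<i> * (p - arc_centre)
     else if Re p < 0 then drop_direction p else mirror (drop_direction (mirror p)))"

definition along_curve :: "complex \<Rightarrow> complex \<Rightarrow> bool" where
  "along_curve p v \<longleftrightarrow> p \<in> linked_drops \<and> parallel v (curve_direction p)"

text \<open>Reflection reverses the direction field on the linking arc, which parallelism ignores;
  on the right drop the field is the reflected one by construction.\<close>

lemma along_curve_mirror:
  assumes "along_curve p v"
  shows "along_curve (mirror p) (mirror v)"
proof -
  have 1: "parallel (mirror v) (mirror (curve_direction p))"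
    using assms by (auto simp: along_curve_def intro: parallel_mirror)
  have "mirror (\<i> * (p - arc_centre)) = - (\<i> * (mirror p - arc_centre))"
    by (simp add: mirror_def arc_centre_def complex_eq_iff)
  then have "parallel (mirror (curve_direction p)) (curve_direction (mirror p))" if "Im p \<ge> 0"
    using that parallel_minus[OF parallel_refl] by (simp add: curve_direction_def)
  moreover have "mirror (curve_direction p) = curve_direction (mirror p)" if "Im p < 0"
  proof -
    have "p \<notin> linking_arc" using that by (auto simp: linking_arc_eq)
    then have "Re p \<noteq> 0"
      using assms left_drop_bounds(2)[of p] right_drop_bounds(2)[of p] by (auto simp: along_curve_def linked_drops_def)
    then show ?thesis using that by (auto simp: curve_direction_def)
  qed
  ultimately have "parallel (mirror (curve_direction p)) (curve_direction (mirror p))"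
    using parallel_refl by (metis not_less)
  then show ?thesis
    using assms 1 mirror_linked_drops parallel_trans unfolding along_curve_def by blast
qed

text \<open>The centres of the linking arc and of the two arcs ending in the cusp share its abscissa
  \<open>sqrt 3\<close>, which is why all three are tangent there.\<close>

lemma drop_frame_centres:
  "drop_frame drop_centre = 0" "drop_frame (drop_centre + 2 * cis (7 * pi / 12)) = Complex (sqrt 3) (- 1)"
  "drop_frame (drop_centre + 2 * cis (11 * pi / 12)) = Complex (sqrt 3) 1"
  "drop_frame arc_centre = Complex (sqrt 3) (- arc_radius)"
proof -
  have c30: "cis (- (pi / 6)) = Complex (sqrt 3 / 2) (- 1 / 2)" "cis (pi / 6) = Complex (sqrt 3 / 2) (1 / 2)"
    by (simp_all add: complex_eq_iff cos_30 sin_30)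
  show "drop_frame drop_centre = 0" by (simp add: drop_frame_def)
  have *: "7 * pi / 12 + - (3 * pi / 4) = - (pi / 6)" "11 * pi / 12 + - (3 * pi / 4) = pi / 6" by simp_all
  show "drop_frame (drop_centre + 2 * cis (7 * pi / 12)) = Complex (sqrt 3) (- 1)"
    "drop_frame (drop_centre + 2 * cis (11 * pi / 12)) = Complex (sqrt 3) 1"
    unfolding drop_frame_def add_diff_cancel_left' mult.assoc cis_mult * c30 by (simp_all add: complex_eq_iff)
  have "sqrt 6 = sqrt 2 * sqrt 3" by (simp flip: real_sqrt_mult)
  then have "Re (drop_frame arc_centre) = sqrt 3"
    using sqrt2_half_sq[of "2 * sqrt 3"] by (simp add: Re_drop_frame arc_centre_def arc_height_def field_simps)
  moreover have "Im (drop_frame arc_centre) = - arc_radius"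
    by (simp add: Im_drop_frame arc_centre_def arc_height_def arc_radius_def field_simps)
  ultimately show "drop_frame arc_centre = Complex (sqrt 3) (- arc_radius)" by (simp add: complex_eq_iff)
qed

lemma parallel_radial:
  assumes "drop_frame p - drop_frame o1 = of_real k * (drop_frame p - drop_frame o2)" "k \<noteq> 0"
  shows "parallel (\<i> * (p - o1)) (\<i> * (p - o2))"
proof -
  have "p - o1 = of_real k * (p - o2)"
    using assms(1) unfolding drop_frame_diff by (simp flip: mult.assoc)
  then show ?thesis unfolding parallel_def using assms(2) by (intro exI[of _ k]) (simp add: scaleR_conv_of_real)
qed

lemma Im_drop_frame_cusp: "Im p = (sqrt 2 / 2) * (Re (drop_frame p) - Im (drop_frame p) - sqrt 3)"
proof -
  have "sqrt 6 = sqrt 2 * sqrt 3" by (simp flip: real_sqrt_mult)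
  then show ?thesis using Im_of_drop_frame[of p] by (simp add: field_simps)
qed

text \<open>In the interior of the arc the two sides coincide. Only its end points call for an
  argument: at the cusp the direction is taken from the linking arc, at abscissa
  \<open>sqrt 3 / 2\<close> from the unit circle, and in both cases the point is collinear with the
  two centres.\<close>

lemma curve_direction_arc_A:
  assumes p: "p \<in> left_drop" "arc_A (drop_frame p)"
  shows "parallel (\<i> * (p - (drop_centre + 2 * cis (7 * pi / 12)))) (curve_direction p)"
proof -
  define a b where "a = sqrt 3 - Re (drop_frame p)" and "b = Im (drop_frame p) + 1"
  have ab: "a\<^sup>2 + b\<^sup>2 = 1" "0 \<le> a" "a \<le> sqrt 3 / 2" "1 / 2 \<le> b" "b \<le> 1"
    using p(2) unfolding arc_A_def by (auto simp: a_def b_def power2_commute)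
  have f: "drop_frame p = Complex (sqrt 3 - a) (b - 1)" by (simp add: a_def b_def complex_eq_iff)
  have im: "Im p = (sqrt 2 / 2) * (1 - a - b)" using Im_drop_frame_cusp[of p] by (simp add: a_def b_def algebra_simps)
  have Re: "Re p < 0" using left_drop_bounds(2)[OF p(1)] by simp
  show ?thesis
  proof (cases "Im p \<ge> 0")
    case True
    then have "a + b \<le> 1" unfolding im by (simp add: zero_le_mult_iff)
    then have "(a + b)\<^sup>2 \<le> 1\<^sup>2" using ab by (intro power_mono) auto
    then have "a * b \<le> 0" using ab(1) by (simp add: power2_sum)
    then have "a = 0" using ab by (auto simp: mult_le_0_iff)
    then have "b = 1" using ab by (simp add: power2_eq_1_iff)
    then have "parallel (\<i> * (p - (drop_centre + 2 * cis (7 * pi / 12)))) (\<i> * (p - arc_centre))"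
      using \<open>a = 0\<close> arc_radius_bounds
      by (intro parallel_radial[of _ _ "1 / arc_radius"]) (auto simp: f drop_frame_centres complex_eq_iff)
    then show ?thesis using True by (simp add: curve_direction_def)
  next
    case False
    show ?thesis
    proof (cases "Re (drop_frame p) \<le> sqrt 3 / 2")
      case True
      then have "a = sqrt 3 / 2" using ab(3) by (simp add: f)
      then have "a\<^sup>2 = 3 / 4" by (simp only: power_divide) simp
      then have "b\<^sup>2 = (1 / 2)\<^sup>2" using ab(1) by (simp add: power_divide)
      then have "b = 1 / 2" using ab(4) by (simp add: power2_eq_iff)
      then have "parallel (\<i> * (p - (drop_centre + 2 * cis (7 * pi / 12)))) (\<i> * (p - drop_centre))"
        using \<open>a = sqrt 3 / 2\<close>
        by (intro parallel_radial[of _ _ "- 1"]) (auto simp: f drop_frame_centres complex_eq_iff)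
      then show ?thesis using True False Re by (simp add: curve_direction_def drop_direction_def)
    next
      case F2: False
      have "b \<noteq> 1"
      proof
        assume "b = 1"
        then have "Im p = 0" using ab(1) by (simp add: im)
        then show False using False by simp
      qed
      then have "Im (drop_frame p) < 0" using ab(5) by (simp add: f)
      then show ?thesis using F2 False Re by (simp add: curve_direction_def drop_direction_def parallel_refl)
    qed
  qed
qed

lemma curve_direction_arc_C:
  assumes p: "p \<in> left_drop" "arc_C (drop_frame p)"
  shows "parallel (\<i> * (p - (drop_centre + 2 * cis (11 * pi / 12)))) (curve_direction p)"
proof -
  define a b where "a = sqrt 3 - Re (drop_frame p)" and "b = 1 - Im (drop_frame p)"
  have ab: "a\<^sup>2 + b\<^sup>2 = 1" "0 \<le> a" "a \<le> sqrt 3 / 2" "1 / 2 \<le> b" "b \<le> 1"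
    using p(2) unfolding arc_C_def by (auto simp: a_def b_def power2_commute)
  have f: "drop_frame p = Complex (sqrt 3 - a) (1 - b)" by (simp add: a_def b_def complex_eq_iff)
  have im: "Im p = (sqrt 2 / 2) * (b - a - 1)" using Im_drop_frame_cusp[of p] by (simp add: a_def b_def algebra_simps)
  have Re: "Re p < 0" using left_drop_bounds(2)[OF p(1)] by simp
  show ?thesis
  proof (cases "Im p \<ge> 0")
    case True
    then have "a + 1 \<le> b" unfolding im by (simp add: zero_le_mult_iff)
    then have "a = 0" "b = 1" using ab by auto
    then have "parallel (\<i> * (p - (drop_centre + 2 * cis (11 * pi / 12)))) (\<i> * (p - arc_centre))"
      using arc_radius_bounds
      by (intro parallel_radial[of _ _ "- 1 / arc_radius"]) (auto simp: f drop_frame_centres complex_eq_iff)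
    then show ?thesis using True by (simp add: curve_direction_def)
  next
    case False
    show ?thesis
    proof (cases "Re (drop_frame p) \<le> sqrt 3 / 2")
      case True
      then have "a = sqrt 3 / 2" using ab(3) by (simp add: f)
      then have "a\<^sup>2 = 3 / 4" by (simp only: power_divide) simp
      then have "b\<^sup>2 = (1 / 2)\<^sup>2" using ab(1) by (simp add: power_divide)
      then have "b = 1 / 2" using ab(4) by (simp add: power2_eq_iff)
      then have "parallel (\<i> * (p - (drop_centre + 2 * cis (11 * pi / 12)))) (\<i> * (p - drop_centre))"
        using \<open>a = sqrt 3 / 2\<close>
        by (intro parallel_radial[of _ _ "- 1"]) (auto simp: f drop_frame_centres complex_eq_iff)
      then show ?thesis using True False Re by (simp add: curve_direction_def drop_direction_def)
    next
      case F2: False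
      have "\<not> Im (drop_frame p) < 0" using ab(5) by (simp add: f)
      then show ?thesis using F2 False Re by (simp add: curve_direction_def drop_direction_def parallel_refl)
    qed
  qed
qed

text \<open>The unit circle satisfies \<open>X - Y \<le> sqrt 2 < sqrt 3\<close>, so it remains
  strictly below the real axis and the first case of \<open>curve_direction\<close> does not
  occur.\<close>

lemma curve_direction_arc_B:
  assumes p: "p \<in> left_drop" "arc_B (drop_frame p)"
  shows "curve_direction p = \<i> * (p - drop_centre)"
proof -
  let ?X = "Re (drop_frame p)" and ?Y = "Im (drop_frame p)"
  have XY: "?X\<^sup>2 + ?Y\<^sup>2 = 1" "?X \<le> sqrt 3 / 2" using p(2) by (auto simp: arc_B_def)
  have "(?X - ?Y)\<^sup>2 \<le> (sqrt 2)\<^sup>2" using XY(1) zero_le_power2[of "?X + ?Y"] by (simp add: power2_sum power2_diff)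
  then have "?X - ?Y \<le> sqrt 2" by (rule power2_le_imp_le) simp
  then have "?X - ?Y - sqrt 3 < 0" using sqrt_bounds by linarith
  then have "Im p < 0" by (subst Im_drop_frame_cusp, intro mult_pos_neg) auto
  moreover have "Re p < 0" using left_drop_bounds(2)[OF p(1)] by simp
  ultimately show ?thesis using XY(2) by (simp add: curve_direction_def drop_direction_def)
qed

text \<open>Half of the loop runs from the left cusp round the left drop and along the linking arc
  to the right cusp. Its final state is the reflection of its initial state, so the reflected half
  closes it; the linking arc is thereby run through once in each direction.\<close>

lemma linked_drops_loop:
  obtains x v where "unit_speed_path along_curve x v x v"
proof -
  let ?A = "drop_centre + 2 * cis (7 * pi / 12)" and ?C = "drop_centre + 2 * cis (11 * pi / 12)"
  have arc: "unit_speed_path along_curve (z + of_real r * cis (deg a)) (of_real \<sigma> * \<i> * cis (deg a))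
      (z + of_real r * cis (deg b)) (of_real \<sigma> * \<i> * cis (deg b))"
    if "r > 0" "\<sigma> = 1 \<and> a < b \<or> \<sigma> = - 1 \<and> b < a" "circle_arc z r a b \<subseteq> linked_drops"
      and par: "\<And>p. p \<in> circle_arc z r a b \<Longrightarrow> parallel (\<i> * (p - z)) (curve_direction p)" for z r \<sigma> a b
  proof (rule unit_speed_path_arc[OF that(1)])
    show "\<sigma> = 1 \<and> deg a < deg b \<or> \<sigma> = - 1 \<and> deg b < deg a" using that(2) by (auto simp: deg_def)
    fix \<theta> assume "\<theta> \<in> closed_segment (deg a) (deg b)"
    then have p: "z + of_real r * cis \<theta> \<in> circle_arc z r a b" unfolding circle_arc_eq by blast
    have "parallel (of_real \<sigma> * \<i> * cis \<theta>) (\<i> * (z + of_real r * cis \<theta> - z))"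
      unfolding parallel_def using that(1,2) by (intro exI[of _ "\<sigma> / r"]) (auto simp: scaleR_conv_of_real)
    then show "along_curve (z + of_real r * cis \<theta>) (of_real \<sigma> * \<i> * cis \<theta>)"
      unfolding along_curve_def using par[OF p] p that(3) parallel_trans by blast
  qed
  have A: "circle_arc ?A 1 225 285 \<subseteq> left_drop" and B: "circle_arc drop_centre 1 105 (- 195) \<subseteq> left_drop"
    and C: "circle_arc ?C 1 (- 15) 45 \<subseteq> left_drop" unfolding left_drop_eq by auto
  have D: "circle_arc arc_centre arc_radius 225 (- 45) = linking_arc"
    by (simp add: linking_arc_def arc_centre_def arc_radius_def arc_height_def)
  have l: "left_drop \<subseteq> linked_drops" "linking_arc \<subseteq> linked_drops" unfolding linked_drops_def by auto
  have pD: "parallel (\<i> * (p - arc_centre)) (curve_direction p)" if "p \<in> linking_arc" for p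
    using that by (simp add: linking_arc_eq curve_direction_def parallel_refl)
  have pA: "unit_speed_path along_curve (?A + cis (deg 225)) (\<i> * cis (deg 225)) (?A + cis (deg 285)) (\<i> * cis (deg 285))"
    using arc[of 1 1 225 285 ?A] A l(1) curve_direction_arc_A drop_arc_A by (simp add: subset_iff)
  have pB: "unit_speed_path along_curve (drop_centre + cis (deg 105)) (- \<i> * cis (deg 105))
      (drop_centre + cis (deg (- 195))) (- \<i> * cis (deg (- 195)))"
    using arc[of 1 "- 1" 105 "- 195" drop_centre] B l(1) curve_direction_arc_B drop_arc_B by (simp add: subset_iff parallel_refl)
  have pC: "unit_speed_path along_curve (?C + cis (deg (- 15))) (\<i> * cis (deg (- 15))) (?C + cis (deg 45)) (\<i> * cis (deg 45))"
    using arc[of 1 1 "- 15" 45 ?C] C l(1) curve_direction_arc_C drop_arc_C by (simp add: subset_iff)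
  have pD: "unit_speed_path along_curve (arc_centre + of_real arc_radius * cis (deg 225)) (- \<i> * cis (deg 225))
      (arc_centre + of_real arc_radius * cis (deg (- 45))) (- \<i> * cis (deg (- 45)))"
    using arc[of arc_radius "- 1" 225 "- 45" arc_centre] l(2) pD arc_radius_bounds unfolding D by simp
  have c45: "cis (deg 45) = Complex (sqrt 2 / 2) (sqrt 2 / 2)" "cis (deg (- 45)) = Complex (sqrt 2 / 2) (- sqrt 2 / 2)"
    by (simp_all add: deg_def complex_eq_iff cos_45 sin_45)
  have opp: "cis (deg (a + 180)) = - cis (deg a)" for a
    by (simp add: deg_def add_divide_distrib distrib_right flip: cis_mult)
  have c225: "cis (deg 225) = - cis (deg 45)" and c285: "cis (deg 285) = - cis (deg 105)"
    and cm15: "cis (deg (- 15)) = - cis (deg (- 195))" using opp[of 45] opp[of 105] opp[of "- 195"] by simp_all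
  have cm195: "cis (deg (- 195)) = cis (11 * pi / 12)"
    using opp[of "- 15"] cm15 by (simp add: deg_def)
  have c105: "cis (deg 105) = cis (7 * pi / 12)" by (simp add: deg_def)
  have c60: "cis (pi / 3) = Complex (1 / 2) (sqrt 3 / 2)" by (simp add: complex_eq_iff cos_60 sin_60)
  have s6: "sqrt 6 = sqrt 2 * sqrt 3" by (simp flip: real_sqrt_mult)
  have ang: "7 * pi / 12 = pi / 3 + deg 45" "11 * pi / 12 = pi / 3 + (pi / 3 + deg 45)" by (simp_all add: deg_def)
  have cusp: "?A + cis (deg 225) = Complex (- arc_height) 0" "?C + cis (deg 45) = Complex (- arc_height) 0"
    unfolding c225 ang cis_mult[symmetric] c60 c45 s6 drop_centre_def arc_height_def
    by (simp_all add: complex_eq_iff s6 field_simps)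
  have cusp': "arc_centre + of_real arc_radius * cis (deg 225) = Complex (- arc_height) 0"
    "arc_centre + of_real arc_radius * cis (deg (- 45)) = Complex arc_height 0"
    unfolding c225 c45 by (simp_all add: complex_eq_iff arc_centre_def arc_radius_def)
  have AB: "?A + cis (deg 285) = drop_centre + cis (deg 105)" "\<i> * cis (deg 285) = - \<i> * cis (deg 105)"
    unfolding c285 c105 by simp_all
  have BC: "?C + cis (deg (- 15)) = drop_centre + cis (deg (- 195))" "\<i> * cis (deg (- 15)) = - \<i> * cis (deg (- 195))"
    unfolding cm15 cm195 by simp_all
  have CD: "- \<i> * cis (deg 225) = \<i> * cis (deg 45)" unfolding c225 by simp
  have "unit_speed_path along_curve (Complex (- arc_height) 0) (\<i> * cis (deg 225)) (Complex arc_height 0) (- \<i> * cis (deg (- 45)))"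
    using unit_speed_path_trans[OF unit_speed_path_trans[OF unit_speed_path_trans[OF pA[unfolded AB] pB] pC[unfolded BC]]]
      pD[unfolded cusp' CD] unfolding cusp by blast
  moreover have "Complex arc_height 0 = mirror (Complex (- arc_height) 0)" "- \<i> * cis (deg (- 45)) = mirror (\<i> * cis (deg 225))"
    unfolding c225 c45 by (simp_all add: mirror_def complex_eq_iff)
  ultimately have half: "unit_speed_path along_curve (Complex (- arc_height) 0) (\<i> * cis (deg 225))
      (mirror (Complex (- arc_height) 0)) (mirror (\<i> * cis (deg 225)))" by simp
  then have "unit_speed_path along_curve (mirror (Complex (- arc_height) 0)) (mirror (\<i> * cis (deg 225)))
      (Complex (- arc_height) 0) (\<i> * cis (deg 225))"
    using unit_speed_path_mirror[OF half along_curve_mirror] by simp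
  with half show ?thesis by (rule that[OF unit_speed_path_trans])
qed

lemma admissible_curve_bounded_energy:
  obtains E where "\<And>\<epsilon>. \<epsilon> > 0 \<Longrightarrow> \<exists>\<gamma>\<in>admissible_curves (tubular_nbhd linked_drops \<epsilon>). bending_energy \<gamma> \<le> E"
proof -
  obtain x v where loop: "unit_speed_path along_curve x v x v" by (rule linked_drops_loop)
  obtain E where E: "\<And>\<Omega>. linked_drops \<subseteq> closure \<Omega> \<Longrightarrow> \<exists>\<gamma>\<in>admissible_curves \<Omega>. bending_energy \<gamma> \<le> E"
  proof (rule unit_speed_loop_admissible[OF loop])
    show "parallel v w" if "along_curve p v" "along_curve p w" for p v w
      using that parallel_trans parallel_sym unfolding along_curve_def by blast
    show "p \<in> linked_drops" if "along_curve p v" for p v using that by (simp add: along_curve_def)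
  qed (rule that)
  show thesis
  proof (rule that, rule E)
    show "linked_drops \<subseteq> closure (tubular_nbhd linked_drops \<epsilon>)" if "\<epsilon> > 0" for \<epsilon>
      using that closure_subset[of "tubular_nbhd linked_drops \<epsilon>"] by (auto simp: tubular_nbhd_def)
  qed
qed

section \<open>Self-contact of minimal curves\<close>

lemma compact_linked_drops: "compact linked_drops"
proof -
  have arc: "compact (circle_arc z r a b)" for z r a b
    unfolding circle_arc_def by (intro compact_path_image valid_path_imp_path valid_path_part_circlepath)
  have "continuous_on left_drop mirror"
    unfolding mirror_eq[abs_def] by (intro continuous_intros)
  then have "compact (mirror ` left_drop)"
    by (rule compact_continuous_image) (auto simp: left_drop_def intro!: arc compact_Un)
  then show ?thesis
    unfolding linked_drops_def right_drop_eq by (intro compact_Un) (auto simp: left_drop_def linking_arc_def intro!: arc compact_Un)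
qed

lemma closure_tubular_nbhdE:
  assumes "p \<in> closure (tubular_nbhd S \<epsilon>)" "closed S" "S \<noteq> {}"
  obtains q where "q \<in> S" "norm (p - q) \<le> \<epsilon>"
proof -
  have "closed {x. infdist x S \<le> \<epsilon>}"
    by (intro closed_Collect_le continuous_intros)
  then have "closure (tubular_nbhd S \<epsilon>) \<subseteq> {x. infdist x S \<le> \<epsilon>}"
    by (intro closure_minimal) (auto simp: tubular_nbhd_def)
  then have "infdist p S \<le> \<epsilon>" using assms(1) by auto
  then show thesis using infdist_attains_inf[OF assms(2,3), of p] that by (metis dist_norm)
qed

text \<open>A shorter closed curve would have to turn through an angle of at least \<open>1\<close> within the length \<open>1 / E\<close>.\<close>

lemma h2_data_length_ge:
  assumes h: "h2_data L g T a" and nT: "\<And>s. norm (T s) = 1"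
    and E: "E > 0" "integral {0..L} (\<lambda>s. (norm (a s))\<^sup>2) \<le> E"
  shows "1 / E \<le> L"
proof (rule ccontr)
  assume "\<not> 1 / E \<le> L"
  then have EL: "E * L < 1" using E(1) by (simp add: field_simps)
  have L: "L > 0" by (rule h2_data_pos[OF h])
  have i: "((\<lambda>s. T s - T 0) has_integral (g L - g 0) - L *\<^sub>R T 0) {0..L}"
    using has_integral_diff[OF has_density_has_integral[OF h2_data_g_density[OF h, of 0 L], of 0 L] has_integral_const_real[of "T 0" 0 L]] L
    by simp
  have b: "norm (T s - T 0) \<le> sqrt (E * L)" if "s \<in> {0..L} - {}" for s
  proof -
    have "(norm (T s - T 0))\<^sup>2 \<le> E * \<bar>s - 0\<bar>" by (rule h2_data_holder[OF h E(2)]) (use that in auto)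
    also have "\<dots> \<le> E * L" using that E(1) by auto
    finally show ?thesis by (rule real_le_rsqrt)
  qed
  have "norm ((g L - g 0) - L *\<^sub>R T 0) \<le> sqrt (E * L) * L"
    using has_integral_bound_real[OF _ finite.emptyI i b] L E(1) by simp
  moreover have "g L = g 0" using h2_data_periodic[OF h, of 0] by simp
  ultimately have "1 \<le> sqrt (E * L)" using L nT by simp
  moreover have "sqrt (E * L) < 1" using EL by simp
  ultimately show False by simp
qed

lemma h2_data_near_curve:
  assumes h: "h2_data L g T a" and nT: "\<And>s. norm (T s) = 1"
    and E: "E > 0" "integral {0..L} (\<lambda>s. (norm (a s))\<^sup>2) \<le> E"
    and ran: "range g \<subseteq> closure (tubular_nbhd linked_drops \<epsilon>)"
  shows "near_curve E \<epsilon> L g T"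
  unfolding near_curve_def
proof (intro conjI allI impI)
  show "L > 0" "(g has_vector_derivative T s) (at s)" "norm (T s) = 1" "g (s + L) = g s" for s
    using h2_data_pos[OF h] h2_data_deriv[OF h] nT h2_data_periodic[OF h] by auto
  show "norm (T s - T t) \<le> sqrt (E * \<bar>s - t\<bar>)" if "\<bar>s - t\<bar> \<le> 1 / E" for s t
    by (rule real_le_rsqrt, rule h2_data_holder[OF h E(2)]) (use that h2_data_length_ge[OF h nT E] in linarith)
  have "linked_drops \<noteq> {}" by (simp add: linked_drops_def left_drop_def circle_arc_def)
  then show "\<exists>q\<in>linked_drops. norm (g s - q) \<le> \<epsilon>" for s
    using closure_tubular_nbhdE[of "g s" linked_drops \<epsilon>] compact_imp_closed[OF compact_linked_drops] ran by blast
qed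

theorem theorem7p2:
  "\<exists>\<epsilon>\<^sub>0>0. \<forall>\<epsilon>. 0 < \<epsilon> \<longrightarrow> \<epsilon> < \<epsilon>\<^sub>0 \<longrightarrow>
     (\<forall>\<gamma>. minimal_curve (tubular_nbhd linked_drops \<epsilon>) \<gamma> \<longrightarrow>
        (\<exists>t\<in>{0..<2 * pi}. \<exists>s\<in>{0..<2 * pi}. t \<noteq> s \<and> \<gamma> t = \<gamma> s))"
proof -
  obtain E0 where E0: "\<And>\<epsilon>. \<epsilon> > 0 \<Longrightarrow> \<exists>\<gamma>\<in>admissible_curves (tubular_nbhd linked_drops \<epsilon>). bending_energy \<gamma> \<le> E0"
    by (rule admissible_curve_bounded_energy) (rule that)
  define E where "E = max 1 E0"
  \<comment> \<open>The half-length of the strand on which the estimates hold and the bump is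
    supported. As it depends on \<open>E\<close> only, the bound on the radial velocity can be fixed
    before the width of the neighbourhood.\<close>
  define r where "r = 1 / (16 * E)"
  have E: "E \<ge> 1" "E0 \<le> E" by (auto simp: E_def)
  have r: "r > 0" using E(1) by (simp add: r_def)
  have \<mu>: "r ^ 3 / 200000 > 0" using r by simp
  obtain \<epsilon>0 where \<epsilon>0: "\<epsilon>0 > 0"
    "\<And>\<epsilon> L g T. \<epsilon> \<le> \<epsilon>0 \<Longrightarrow> near_curve E \<epsilon> L g T \<Longrightarrow> inj_on g {0..<L} \<Longrightarrow> (\<And>s. T (s + L) = T s) \<Longrightarrow>
       \<exists>s0. \<forall>s. \<bar>s - s0\<bar> \<le> 1 / (16 * E) \<longrightarrow>
         Im (g s) \<ge> 4 \<and> \<bar>(g s - arc_centre) \<bullet> T s\<bar> \<le> r ^ 3 / 200000 \<and> norm (g s - arc_centre) < arc_radius + \<epsilon>"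
    by (rule near_curve_inner_strand[OF E(1) \<mu>], rule that, assumption) blast
  have "\<exists>t\<in>{0..<2 * pi}. \<exists>s\<in>{0..<2 * pi}. t \<noteq> s \<and> \<gamma> t = \<gamma> s"
    if \<epsilon>: "0 < \<epsilon>" "\<epsilon> < min \<epsilon>0 (1 / 2)" and \<gamma>: "minimal_curve (tubular_nbhd linked_drops \<epsilon>) \<gamma>" for \<epsilon> \<gamma>
  proof (rule ccontr)
    let ?\<Omega> = "tubular_nbhd linked_drops \<epsilon>"
    assume "\<not> ?thesis"
    then have ninj: "\<gamma> t \<noteq> \<gamma> s" if "t \<in> {0..<2 * pi}" "s \<in> {0..<2 * pi}" "t \<noteq> s" for t s
      using that by blast
    obtain L g T a where h: "h2_data L g T a" and nT: "\<And>s. norm (T s) = 1" and ran: "range g \<subseteq> closure ?\<Omega>"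
      and inj: "inj_on g {0..<L}"
      and min: "\<And>\<gamma>'. \<gamma>' \<in> admissible_curves ?\<Omega> \<Longrightarrow> integral {0..L} (\<lambda>s. (norm (a s))\<^sup>2) \<le> bending_energy \<gamma>'"
      by (rule minimal_curve_unit_speed[OF \<gamma>], rule ninj, assumption+) (rule that; assumption)
    have L: "L > 0" by (rule h2_data_pos[OF h])
    have int: "integral {0..L} (\<lambda>s. (norm (a s))\<^sup>2) \<le> E"
      using E0[OF \<epsilon>(1)] min E(2) by force
    have near: "near_curve E \<epsilon> L g T" using E(1) by (intro h2_data_near_curve[OF h nT _ int ran]) auto
    obtain s0 where s0: "\<And>s. \<bar>s - s0\<bar> \<le> r \<Longrightarrow> Im (g s) \<ge> 4 \<and> \<bar>(g s - arc_centre) \<bullet> T s\<bar> \<le> r ^ 3 / 200000 \<and>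
        norm (g s - arc_centre) < arc_radius + \<epsilon>"
      using \<epsilon>0(2)[OF _ near inj h2_data_periodic'[OF h]] \<epsilon>(2) unfolding r_def by auto
    define c where "c = s0 - L / 2"
    show False
    proof (rule outward_variation[OF h2_data_shift(1)[OF h, of c] nT _ E(1) _ _ \<epsilon>(1) _ r_def])
      show "inj_on (\<lambda>s. g (s + c)) {0..<L}"
        by (rule inj_onI, rule add_right_imp_eq[of _ c], rule periodic_inj[OF inj h2_data_periodic[OF h] L]) auto
      show "integral {0..L} (\<lambda>s. (norm (a (s + c)))\<^sup>2) \<le> E" using int by (simp add: h2_data_shift(2)[OF h])
      show "1 / E \<le> L" using h2_data_length_ge[OF h nT _ int] E(1) by simp
      show "\<epsilon> \<le> 1 / 2" using \<epsilon>(2) by simp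
      show "range (\<lambda>s. g (s + c)) \<subseteq> closure ?\<Omega>" using ran by auto
      show "integral {0..L} (\<lambda>s. (norm (a (s + c)))\<^sup>2) \<le> bending_energy \<gamma>'"
        if "\<gamma>' \<in> admissible_curves ?\<Omega>" for \<gamma>' using min[OF that] by (simp add: h2_data_shift(2)[OF h])
      show "Im (g (s + c)) \<ge> 4 \<and> \<bar>(g (s + c) - arc_centre) \<bullet> T (s + c)\<bar> \<le> r ^ 3 / 200000 \<and>
          arc_radius - \<epsilon> \<le> norm (g (s + c) - arc_centre) \<and> norm (g (s + c) - arc_centre) < arc_radius + \<epsilon>"
        if "\<bar>s - L / 2\<bar> \<le> r" for s
      proof -
        have s: "\<bar>(s + c) - s0\<bar> \<le> r" using that by (simp add: c_def)
        have "\<bar>norm (g (s + c) - arc_centre) - arc_radius\<bar> \<le> \<epsilon>"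
          by (rule near_curve_annulus[OF near]) (use s0[OF s] \<epsilon>(2) in auto)
        then show ?thesis using s0[OF s] by linarith
      qed
    qed
  qed
  then show ?thesis using \<epsilon>0(1) by (intro exI[of _ "min \<epsilon>0 (1 / 2)"]) auto
qed

end
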